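(* Let $n \geq 1$ and $N_x \in \mathbb{Z}$ be integers. Suppose $u_0, u_1:[0,\infty)\to \mathbb{R}$ satisfy $$(1+x)^n\big(|u_0 - 2\pi N_x| + |u_{0x}|+|u_1|\big)\in L^1([0,\infty)).$$ Then the Volterra integral equations $$X(x,k) = I + \int_{\infty}^x e^{i\theta_1(x'-x)\hat{\sigma}_3} (\mathsf{U}X)(x',k)\, dx', \qquad Y(x,k) = I + \int_{0}^x e^{i\theta_1(x'-x)\hat{\sigma}_3} (\mathsf{U}Y)(x',k)\, dx'$$ uniquely define two $2 \times 2$-matrix valued solutions $X$ and $Y$ of the differential equation $$X_x + i\theta_1[\sigma_3, X] = \mathsf{U} X \qquad (\ast)$$ with the following properties: (a) The function $X(x, k)$ is defined for $x \geq 0$ and $k \in (\bar{\mathbb{C}}_-, \bar{\mathbb{C}}_+) \setminus \{0\}$. For each $k \in (\bar{\mathbb{C}}_-, \bar{\mathbb{C}}_+)\setminus \{0\}$, $X(\cdot, k)$ is weakly differentiable and satisfies $(\ast)$. (b) The function $Y(x, k)$ is defined for $x \geq 0$ and $k \in \mathbb{C}\setminus \{0\}$. For each $k \in \mathbb{C}\setminus\{0\}$, $Y(\cdot, k)$ is weakly differentiable and satisfies $(\ast)$. (c) For each $x \geq 0$, the function $X(x,\cdot)$ is continuous for $k \in (\bar{\mathbb{C}}_-, \bar{\mathbb{C}}_+)\setminus \{0\}$ and analytic for $k \in (\mathbb{C}_-, \mathbb{C}_+)$. (d) For each $x \geq 0$, the function $Y(x,\cdot)$ is analytic for $k \in \mathbb{C}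 \setminus \{0\}$. (e) For each $x \geq 0$ and each $j = 1, \dots, n$, the partial derivative $\frac{\partial^j X}{\partial k^j}(x, \cdot)$ has a continuous extension to $(\bar{\mathbb{C}}_-, \bar{\mathbb{C}}_+)\setminus \{0\}$. (f) There is a constant $C>0$ (independent of $x$ and $k$) such that $X$ and $Y$ satisfy the following estimates for $x \geq 0$ and $j = 0, 1, \dots, n$: $$\bigg|\frac{\partial^j}{\partial k^j}\big(X(x,k) - I\big) \bigg| \leq \frac{C}{(1+x)^{n-j}}, \qquad k \in (\bar{D}_4, \bar{D}_1),$$ $$\bigg|\frac{\partial^j}{\partial k^j}\big(Y(x,k) - I\big) \bigg| \leq C(1 + x)^j, \qquad k \in (\bar{D}_1, \bar{D}_4),$$ $$\bigg|\frac{\partial^j}{\partial k^j}\Big((Y(x,k) - I)e^{-2i\theta_1x\sigma_3}\Big) \bigg| \leq C(1 + x)^j, \qquad k \in (\bar{D}_4, \bar{D}_1).$$ (g) $\det X(x,k) = 1$ for $x \geq 0$, $k \in \mathbb{R}\setminus \{0\}$, and $\det Y(x,k) = 1$ for $x \geq 0$, $k \in \mathbb{C} \setminus \{0\}$. (h) $X$ and $Y$ obey the following symmetries for each $x \geq 0$: $$X(x,k) = \sigma_2 X(x,-k) \sigma_2 = \sigma_2 \overline{X(x,\bar{k})} \sigma_2, \qquad k \in (\bar{\mathbb{C}}_-, \bar{\mathbb{C}}_+) \setminus \{0\},$$ $$Y(x,k) = \sigma_2 Y(x,-k) \sigma_2 = \sigma_2 \overline{Y(x,\bar{k})} \sigma_2,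 \qquad k \in \mathbb{C} \setminus \{0\}.$$
   Context: Pauli matrices: $\sigma_1=\begin{pmatrix}0&1\\1&0\end{pmatrix}$, $\sigma_2=\begin{pmatrix}0&-i\\i&0\end{pmatrix}$, $\sigma_3=\begin{pmatrix}1&0\\0&-1\end{pmatrix}$. $\hat\sigma_3$ acts on a $2\times2$ matrix $A$ by $\hat\sigma_3A=[\sigma_3,A]$, so that $e^{\alpha\hat\sigma_3}A=e^{\alpha\sigma_3}Ae^{-\alpha\sigma_3}$ for $\alpha\in\mathbb{C}$. For a matrix $A$, $|A|^2=\sum_{i,j}|A_{ij}|^2$. For $k\in\mathbb{C}\setminus\{0\}$, $\theta_1=\theta_1(k)=\frac14\big(k-\frac1k\big)$, and $$\mathsf{U}(x,k)=-\frac{i(u_{0x}(x)+u_1(x))}{4}\sigma_2+\frac1k\Big(\frac{i\sin u_0(x)}{4}\sigma_1+\frac{i(\cos u_0(x)-1)}{4}\sigma_3\Big),$$ where $u_{0x}$ is the (weak) derivative of $u_0$, which is implicitly assumed to exist. $\mathbb{C}_\pm=\{k\in\mathbb{C}: \operatorname{Im}k\gtrless0\}$, with closures $\bar{\mathbb{C}}_\pm$. $D_1=\{\operatorname{Im}k>0,|k|>1\}$, $D_2=\{\operatorname{Im}k>0,|k|<1\}$, $D_3=\{\operatorname{Im}k<0,|k|<1\}$, $D_4=\{\operatorname{Im}k<0,|k|>1\}$; bars denote closures in $\mathbb{C}$. Column convention: for a statement about a $2\times2$ matrix, "$k\in(A,B)$" means that the statement holds for the first column when $k\in A$ and for the second column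 when $k\in B$; $(A,B)\setminus\{0\}$ means $(A\setminus\{0\},B\setminus\{0\})$. The integral equation for $X$ is likewise read columnwise. *)

theory Defs
  imports "HOL-Analysis.Analysis"
begin

type_synonym cmat = "complex^2^2"

definition smult_mat :: "complex \<Rightarrow> cmat \<Rightarrow> cmat"  (infixr "\<cdot>\<^sub>m" 75)
  where "c \<cdot>\<^sub>m A = (\<chi> i j. c * A $ i $ j)"

definition cnj_mat :: "cmat \<Rightarrow> cmat"
  where "cnj_mat A = (\<chi> i j. cnj (A $ i $ j))"

definition sigma1 :: cmat where "sigma1 = vector [vector [0, 1], vector [1, 0]]"
definition sigma2 :: cmat where "sigma2 = vector [vector [0, - \<i>], vector [\<i>, 0]]"
definition sigma3 :: cmat where "sigma3 = vector [vector [1, 0], vector [0, - 1]]"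

definition mexp :: "cmat \<Rightarrow> cmat"
  where "mexp A = (\<Sum>m. (1 / fact m) *\<^sub>R ((\<lambda>B. A ** B) ^^ m) (mat 1))"

text \<open>The operator exponential of \<open>\<alpha>\<close> times the commutator with \<open>sigma3\<close>.\<close>
definition ad_exp :: "complex \<Rightarrow> cmat \<Rightarrow> cmat"
  where "ad_exp \<alpha> A = mexp (\<alpha> \<cdot>\<^sub>m sigma3) ** A ** mexp ((- \<alpha>) \<cdot>\<^sub>m sigma3)"

definition theta1 :: "complex \<Rightarrow> complex"
  where "theta1 k = (k - 1 / k) / 4"

text \<open>The argument \<open>u0x\<close> stands for the weak derivative of \<open>u0\<close>.\<close>
definition Umat ::
    "(real \<Rightarrow> real) \<Rightarrow> (real \<Rightarrow> real) \<Rightarrow> (real \<Rightarrow> real) \<Rightarrow> real \<Rightarrow> complex \<Rightarrow> cmat"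
  where "Umat u0 u0x u1 x k =
    (- (\<i> * of_real (u0x x + u1 x) / 4)) \<cdot>\<^sub>m sigma2 +
    (1 / k) \<cdot>\<^sub>m ((\<i> * of_real (sin (u0 x)) / 4) \<cdot>\<^sub>m sigma1 +
                  (\<i> * of_real (cos (u0 x) - 1) / 4) \<cdot>\<^sub>m sigma3)"

definition C_plus :: "complex set" where "C_plus = {k. Im k > 0}"
definition C_minus :: "complex set" where "C_minus = {k. Im k < 0}"

definition D1 :: "complex set" where "D1 = {k. Im k > 0 \<and> norm k > 1}"
definition D4 :: "complex set" where "D4 = {k. Im k < 0 \<and> norm k > 1}"

text \<open>
  The column convention: a statement about a matrix for \<open>k \<in> (A, B)\<close> means the statement about
  \<open>column l\<close> for all \<open>k \<in> cols A B l\<close> and both values of \<open>l :: 2\<close>.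
\<close>
definition cols :: "complex set \<Rightarrow> complex set \<Rightarrow> 2 \<Rightarrow> complex set"
  where "cols A B l = (if l = 1 then A else B)"

definition test_function_on :: "real set \<Rightarrow> (real \<Rightarrow> real) \<Rightarrow> bool"
  where "test_function_on S \<phi> \<longleftrightarrow>
    (\<forall>m. (deriv ^^ m) \<phi> differentiable_on UNIV) \<and>
    compact (closure {x. \<phi> x \<noteq> 0}) \<and> closure {x. \<phi> x \<noteq> 0} \<subseteq> S"

definition locally_integrable_on :: "(real \<Rightarrow> 'a::euclidean_space) \<Rightarrow> real set \<Rightarrow> bool"
  where "locally_integrable_on f S \<longleftrightarrow> (\<forall>K. compact K \<and> K \<subseteq> S \<longrightarrow> f absolutely_integrable_on K)"

definition has_weak_derivative_on ::
    "(real \<Rightarrow> 'a::euclidean_space) \<Rightarrow> (real \<Rightarrow> 'a) \<Rightarrow> real set \<Rightarrow> bool"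
  where "has_weak_derivative_on f g S \<longleftrightarrow>
    locally_integrable_on f S \<and> locally_integrable_on g S \<and>
    (\<forall>\<phi>. test_function_on S \<phi> \<longrightarrow>
       (LINT x:S|lebesgue. deriv \<phi> x *\<^sub>R f x) = - (LINT x:S|lebesgue. \<phi> x *\<^sub>R g x))"

text \<open>
  The integral equations and the differential equation for column \<open>l\<close> at a fixed \<open>k\<close>.
  Column \<open>l\<close> of each side only involves column \<open>l\<close> of \<open>Z\<close>, since the factors multiplying
  \<open>Z\<close> from the right are diagonal. The integrals are required to exist as Lebesgue integrals.
\<close>
definition volterra_X_col ::
    "(real \<Rightarrow> complex \<Rightarrow> cmat) \<Rightarrow> complex \<Rightarrow> 2 \<Rightarrow> (real \<Rightarrow> cmat) \<Rightarrow> bool"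
  where "volterra_X_col U k l Z \<longleftrightarrow> (\<forall>x\<ge>0.
    interval_lebesgue_integrable lebesgue \<infinity> (ereal x)
      (\<lambda>x'. column l (ad_exp (\<i> * theta1 k * of_real (x' - x)) (U x' k ** Z x'))) \<and>
    column l (Z x) = column l (mat 1) +
      (LINT x'=\<infinity>..ereal x|lebesgue.
         column l (ad_exp (\<i> * theta1 k * of_real (x' - x)) (U x' k ** Z x'))))"

definition volterra_Y_col ::
    "(real \<Rightarrow> complex \<Rightarrow> cmat) \<Rightarrow> complex \<Rightarrow> 2 \<Rightarrow> (real \<Rightarrow> cmat) \<Rightarrow> bool"
  where "volterra_Y_col U k l Z \<longleftrightarrow> (\<forall>x\<ge>0.
    interval_lebesgue_integrable lebesgue (ereal 0) (ereal x)
      (\<lambda>x'. column l (ad_exp (\<i> * theta1 k * of_real (x' - x)) (U x' k ** Z x'))) \<and>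
    column l (Z x) = column l (mat 1) +
      (LINT x'=ereal 0..ereal x|lebesgue.
         column l (ad_exp (\<i> * theta1 k * of_real (x' - x)) (U x' k ** Z x'))))"

definition weak_ode_col ::
    "(real \<Rightarrow> complex \<Rightarrow> cmat) \<Rightarrow> complex \<Rightarrow> 2 \<Rightarrow> (real \<Rightarrow> cmat) \<Rightarrow> bool"
  where "weak_ode_col U k l Z \<longleftrightarrow> (\<exists>Zx :: real \<Rightarrow> cmat.
    has_weak_derivative_on (\<lambda>x. column l (Z x)) (\<lambda>x. column l (Zx x)) {0<..} \<and>
    (AE x in lebesgue. x > 0 \<longrightarrow>
       column l (Zx x + (\<i> * theta1 k) \<cdot>\<^sub>m (sigma3 ** Z x - Z x ** sigma3)) =
       column l (U x k ** Z x)))"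

definition kderiv :: "nat \<Rightarrow> (complex \<Rightarrow> cmat) \<Rightarrow> complex \<Rightarrow> cmat"
  where "kderiv j F k = (\<chi> i l. (deriv ^^ j) (\<lambda>k. F k $ i $ l) k)"

text \<open>
  The derivative together with its continuous extension: column \<open>l\<close> of \<open>F\<close> is meant to be
  analytic on the open set \<open>S l\<close>. On \<open>S l\<close> this is the \<open>j\<close>-th complex derivative; at boundary
  points of \<open>S l\<close> it is the limit from within \<open>S l\<close>, i.e. the value of the continuous extension.
\<close>
definition kderiv_ext :: "(2 \<Rightarrow> complex set) \<Rightarrow> nat \<Rightarrow> (complex \<Rightarrow> cmat) \<Rightarrow> complex \<Rightarrow> cmat"
  where "kderiv_ext S j F k =
    (\<chi> i l. if k \<in> S l then kderiv j F k $ i $ l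
            else Lim (at k within S l) (\<lambda>k. kderiv j F k $ i $ l))"

text \<open>Sanity checks: the matrix exponentials occurring above are the expected diagonal matrices.\<close>

lemma mexp_sigma3:
  "mexp (\<alpha> \<cdot>\<^sub>m sigma3) = vector [vector [exp \<alpha>, 0], vector [0, exp (- \<alpha>)]]"
proof -
  have pow: "((\<lambda>B. (\<alpha> \<cdot>\<^sub>m sigma3) ** B) ^^ m) (mat 1) =
      (vector [vector [\<alpha> ^ m, 0], vector [0, (- \<alpha>) ^ m]] :: cmat)" for m
    by (induction m)
      (simp_all add: vec_eq_iff forall_2 matrix_matrix_mult_def sum_2 smult_mat_def sigma3_def mat_def)
  have "(\<lambda>m. (1 / fact m) *\<^sub>R (vector [vector [\<alpha> ^ m, 0], vector [0, (- \<alpha>) ^ m]] :: cmat))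
      sums vector [vector [exp \<alpha>, 0], vector [0, exp (- \<alpha>)]]"
    unfolding sums_def
  proof (intro vec_tendstoI)
    fix i j :: 2
    have e: "(\<lambda>n. \<Sum>m<n. z ^ m /\<^sub>R fact m) \<longlonglongrightarrow> exp z" for z :: complex
      using exp_converges[of z] by (simp add: sums_def)
    show "(\<lambda>n. (\<Sum>m<n. (1 / fact m) *\<^sub>R
        (vector [vector [\<alpha> ^ m, 0], vector [0, (- \<alpha>) ^ m]] :: cmat)) $ i $ j)
      \<longlonglongrightarrow> (vector [vector [exp \<alpha>, 0], vector [0, exp (- \<alpha>)]] :: cmat) $ i $ j"
      using e[of \<alpha>] e[of "- \<alpha>"] exhaust_2[of i] exhaust_2[of j]
      by (auto simp: divide_inverse)
  qed
  then show ?thesis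
    unfolding mexp_def pow by (rule sums_unique[symmetric])
qed

lemma ad_exp_eq:
  "ad_exp \<alpha> A = vector [vector [A $ 1 $ 1, exp (2 * \<alpha>) * A $ 1 $ 2],
                        vector [exp (- 2 * \<alpha>) * A $ 2 $ 1, A $ 2 $ 2]]"
proof -
  have "exp (2 * \<alpha>) = exp \<alpha> * exp \<alpha>" "exp (- 2 * \<alpha>) = exp (- \<alpha>) * exp (- \<alpha>)"
    by (simp_all flip: exp_add)
  moreover have "exp \<alpha> * exp (- \<alpha>) = 1"
    by (simp flip: exp_add)
  ultimately show ?thesis
    unfolding ad_exp_def mexp_sigma3
    by (simp add: vec_eq_iff forall_2 matrix_matrix_mult_def sum_2 mult_ac)
qed

end

theory Submission
  imports Defs "HOL-Complex_Analysis.Complex_Analysis"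
begin

text \<open>
  Both equations are linear Volterra equations with an integrable potential, so their solutions are
  sums of Neumann series and are controlled by Gronwall's inequality; the content of the theorem
  lies in the dependence on \<open>k\<close> up to the boundary of the half-planes.

  The potential satisfies \<open>U(- k) = \<sigma>\<^sub>2 U(k) \<sigma>\<^sub>2\<close> and \<open>\<theta>\<^sub>1\<close> is odd. Hence the second column at \<open>k\<close>
  solves the equations of the first column at \<open>- k\<close> after an exchange of its entries and one change
  of sign, and only the scalar system for the first column is studied. For an integration from \<open>x\<close>
  to \<open>y\<close> its kernel carries the factor \<open>exp (- 2 i \<theta>\<^sub>1 (y - x))\<close>, which is bounded, uniformly in
  \<open>|k| \<ge> \<epsilon>\<close>, as soon as \<open>Im k (y - x)\<close> is bounded above (\<open>osc_bound\<close>).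

  This bound survives when \<open>k\<close> leaves the half-plane by a distance comparable to \<open>1 / (1 + x)\<close>.
  For \<open>Y\<close>, and for \<open>Y - I\<close> times \<open>exp (- 2 i \<theta>\<^sub>1 x \<sigma>\<^sub>3)\<close>, whose columns solve a Volterra equation of
  the same kind, Cauchy's inequality on discs of that radius converts the bound on the function
  into the factor \<open>(1 + x)\<^sup>j\<close> for the \<open>j\<close>-th derivative (\<open>vY_deriv_bound\<close>, \<open>vW_deriv_bound\<close>).

  For \<open>X\<close> the potential is truncated to \<open>y \<le> 2\<^sup>m - 1\<close>. The truncated solution is holomorphic and
  bounded, away from \<open>0\<close>, up to a distance comparable to \<open>2 powr - m\<close> beyond the real axis, and two consecutive
  truncations differ there by at most a constant times the integral of the potential over the
  dyadic shell between them (\<open>vX_diff\<close>). Cauchy's inequality costs a factor \<open>2\<^sup>m\<^sup>j\<close> for the \<open>j\<close>-th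
  derivative, and this factor is absorbed by the weight \<open>(1 + y)\<^sup>j\<close> on the shell
  (\<open>dX_deriv_bound\<close>). Since the \<open>n\<close>-th moment of the potential is finite, the telescoping series of
  truncations converges together with its first \<open>n\<close> derivatives, uniformly up to the real axis and
  away from \<open>0\<close>. This gives the continuous extensions of the derivatives (\<open>GX_continuous\<close>,
  \<open>GX_deriv\<close>) and their decay (\<open>GX_bound\<close>).

  Integration by parts for indefinite Lebesgue integrals, which is Fubini's theorem on a square cut
  along its diagonal (\<open>segment_integral_mult\<close>), yields the powers in Gronwall's inequality and in the
  Neumann series, the weak form of the differential equation (\<open>ode_weak_derivative\<close>), and the values
  of the determinants, the potential having trace zero (\<open>wronskian\<close>). Uniqueness is Gronwall's
  inequality; for \<open>X\<close> the growth of a solution has to be excluded first (\<open>solX_unique\<close>). The symmetry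
  in \<open>- k\<close> holds by the construction of the second column, and the symmetry under conjugation holds
  for each term of the Neumann series.
\<close>

section \<open>Integrals over initial segments\<close>

lemma sigma_finite_lebesgue: "sigma_finite_measure (lebesgue :: real measure)"
proof -
  obtain A :: "real set set" where A: "countable A" "A \<subseteq> sets lborel" "\<Union>A = space lborel"
      "\<forall>a\<in>A. emeasure lborel a \<noteq> \<infinity>"
    using sigma_finite_measure.sigma_finite_countable[OF sigma_finite_lborel] by blast
  show ?thesis
    by (rule sigma_finite_measure.intro) (use A in \<open>auto intro!: exI[of _ A]\<close>)
qed

interpretation lebesgue_pair: pair_sigma_finite "lebesgue :: real measure" "lebesgue :: real measure"
  by (simp add: pair_sigma_finite_def sigma_finite_lebesgue)

lemma AE_lebesgue_neq: "AE x in lebesgue. x \<noteq> (c::real)"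
  by (rule AE_completion[OF AE_lborel_singleton])

lemma id_borel_lebesgue [measurable]: "(\<lambda>x. x) \<in> lebesgue \<rightarrow>\<^sub>M (borel :: real measure)"
  by (simp add: measurable_completion)

lemma fst_borel_lebesgue_pair [measurable]:
  "fst \<in> (lebesgue :: real measure) \<Otimes>\<^sub>M (M :: 'b measure) \<rightarrow>\<^sub>M borel"
  by (rule measurable_compose[OF measurable_fst id_borel_lebesgue])

lemma snd_borel_lebesgue_pair [measurable]:
  "snd \<in> (M :: 'b measure) \<Otimes>\<^sub>M (lebesgue :: real measure) \<rightarrow>\<^sub>M borel"
  by (rule measurable_compose[OF measurable_snd id_borel_lebesgue])

lemma integrable_pair_mult:
  fixes f g :: "real \<Rightarrow> 'a::{real_normed_field,banach,second_countable_topology}"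
  assumes f: "integrable lebesgue f" and g: "integrable lebesgue g"
  shows "integrable (lebesgue \<Otimes>\<^sub>M lebesgue) (\<lambda>p. f (fst p) * g (snd p))"
proof (rule lebesgue_pair.Fubini_integrable)
  have [measurable]: "f \<in> borel_measurable lebesgue" "g \<in> borel_measurable lebesgue"
    using f g by auto
  show "(\<lambda>p. f (fst p) * g (snd p)) \<in> borel_measurable (lebesgue \<Otimes>\<^sub>M lebesgue)" by measurable
  show "integrable lebesgue (\<lambda>x. LINT y|lebesgue. norm (f (fst (x, y)) * g (snd (x, y))))"
    using f by (simp add: norm_mult)
  show "AE x in lebesgue. integrable lebesgue (\<lambda>y. f (fst (x, y)) * g (snd (x, y)))"
    using g by simp
qed

lemma set_integral_sum:
  fixes f :: "'b \<Rightarrow> real \<Rightarrow> 'a::{banach,second_countable_topology}"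
  assumes "\<And>l. l \<in> L \<Longrightarrow> set_integrable lebesgue A (f l)"
  shows "set_integrable lebesgue A (\<lambda>y. \<Sum>l\<in>L. f l y)"
    and "(LINT y:A|lebesgue. \<Sum>l\<in>L. f l y) = (\<Sum>l\<in>L. LINT y:A|lebesgue. f l y)"
  using assms by (simp_all add: set_integrable_def set_lebesgue_integral_def scaleR_sum_right)

text \<open>
  A strict linear order on a set \<open>D\<close> of reals, given by its initial segments \<open>J x\<close>. It covers
  integration from the left end point (\<open>J x = {0..<x}\<close>) and from infinity (\<open>J x = {x<..}\<close>).
\<close>
locale segments =
  fixes D :: "real set" and J :: "real \<Rightarrow> real set"
  assumes D_sets [measurable]: "D \<in> sets lebesgue"
    and J_meas [measurable]:
      "(\<lambda>p. indicator (J (fst p)) (snd p) :: real) \<in> borel_measurable (lebesgue \<Otimes>\<^sub>M lebesgue)"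
    and J_sub: "x \<in> D \<Longrightarrow> J x \<subseteq> D"
    and J_trans: "y \<in> J x \<Longrightarrow> z \<in> J y \<Longrightarrow> z \<in> J x"
    and J_total: "x \<in> D \<Longrightarrow> y \<in> D \<Longrightarrow> x \<noteq> y \<Longrightarrow> x \<in> J y \<or> y \<in> J x"
    and J_irrefl: "x \<notin> J x"
begin

lemma J_indicator_measurable [measurable]: "(\<lambda>y. indicator (J x) y :: real) \<in> borel_measurable lebesgue"
  using measurable_compose[OF measurable_Pair1' J_meas, of x] by simp

lemma J_sets [measurable]: "J x \<in> sets lebesgue"
  using J_indicator_measurable[of x] by (simp add: borel_measurable_indicator_iff)

lemma set_integrable_J:
  fixes f :: "real \<Rightarrow> 'a::{banach,second_countable_topology}"
  shows "set_integrable lebesgue D f \<Longrightarrow> x \<in> D \<Longrightarrow> set_integrable lebesgue (J x) f"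
  by (rule set_integrable_subset) (use J_sub in auto)

text \<open>
  Integration by parts for indefinite integrals. The product of the two integrals is an integral
  over the square of \<open>J x\<close>; up to a null set, every pair of points of \<open>J x\<close> is ordered one way or
  the other, and the two halves of the square give the two terms.
\<close>
lemma segment_integral_mult:
  fixes f g :: "real \<Rightarrow> 'a::{real_normed_field,banach,second_countable_topology}"
  assumes x: "x \<in> D" and f: "set_integrable lebesgue (J x) f" and g: "set_integrable lebesgue (J x) g"
  defines "F \<equiv> \<lambda>z. LINT y:J z|lebesgue. f y" and "G \<equiv> \<lambda>z. LINT y:J z|lebesgue. g y"
  shows "set_integrable lebesgue (J x) (\<lambda>y. f y * G y + F y * g y)"
    and "(LINT y:J x|lebesgue. f y * G y + F y * g y) = F x * G x"
proof -
  define f' g' where "f' = (\<lambda>y. indicator (J x) y *\<^sub>R f y)" and "g' = (\<lambda>y. indicator (J x) y *\<^sub>R g y)"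
  have f': "integrable lebesgue f'" and g': "integrable lebesgue g'"
    using f g by (simp_all add: f'_def g'_def set_integrable_def)
  have [measurable]: "f' \<in> borel_measurable lebesgue" "g' \<in> borel_measurable lebesgue"
    using f' g' by auto
  define H where "H = (\<lambda>s t. f' s * g' t)"
  have H: "integrable (lebesgue \<Otimes>\<^sub>M lebesgue) (case_prod H)"
    using integrable_pair_mult[OF f' g'] by (simp add: H_def case_prod_unfold)
  define H1 H2 where "H1 = (\<lambda>s t. indicator (J s) t *\<^sub>R H s t)"
    and "H2 = (\<lambda>s t. indicator (J t) s *\<^sub>R H s t)"
  have J_meas': "(\<lambda>p. indicator (J (snd p)) (fst p) :: real) \<in> borel_measurable (lebesgue \<Otimes>\<^sub>M lebesgue)"
    using measurable_compose[OF measurable_pair_swap' J_meas] by (simp add: case_prod_unfold)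
  have H1: "integrable (lebesgue \<Otimes>\<^sub>M lebesgue) (case_prod H1)"
    using H by (rule Bochner_Integration.integrable_bound)
      (use J_meas H in \<open>auto simp: H1_def H_def case_prod_unfold indicator_def\<close>)
  have H2: "integrable (lebesgue \<Otimes>\<^sub>M lebesgue) (case_prod H2)"
    using H by (rule Bochner_Integration.integrable_bound)
      (use J_meas' H in \<open>auto simp: H2_def H_def case_prod_unfold indicator_def\<close>)
  have Jxy: "indicator (J y) t * indicator (J x) t = (indicator (J y) t :: real)" if "y \<in> J x" for y t
    using J_trans[OF that, of t] by (auto simp: indicator_def)
  have H1_int: "(LINT t|lebesgue. H1 s t) = f' s * G s" for s
  proof (cases "s \<in> J x")
    case True
    have "(LINT t|lebesgue. H1 s t) = (LINT t|lebesgue. f' s * (indicator (J s) t *\<^sub>R g t))"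
      unfolding H1_def H_def g'_def by (simp add: Jxy[OF True] flip: mult_scaleR_right)
    then show ?thesis by (simp only: G_def set_lebesgue_integral_def integral_mult_right_zero)
  qed (simp add: f'_def H1_def H_def)
  have H2_int: "(LINT s|lebesgue. H2 s t) = F t * g' t" for t
  proof (cases "t \<in> J x")
    case True
    have "(LINT s|lebesgue. H2 s t) = (LINT s|lebesgue. (indicator (J t) s *\<^sub>R f s) * g' t)"
      unfolding H2_def H_def f'_def by (simp add: Jxy[OF True] flip: mult_scaleR_left)
    then show ?thesis by (simp only: F_def set_lebesgue_integral_def integral_mult_left_zero)
  qed (simp add: g'_def H2_def H_def)
  have i1: "integrable lebesgue (\<lambda>s. f' s * G s)"
    using lebesgue_pair.integrable_fst[OF H1] by (simp add: H1_int)
  have i2: "integrable lebesgue (\<lambda>s. F s * g' s)"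
    using lebesgue_pair.integrable_snd[OF H2] by (simp add: H2_int)
  have split: "(\<lambda>y. f' y * G y + F y * g' y) = (\<lambda>y. indicator (J x) y *\<^sub>R (f y * G y + F y * g y))"
    by (auto simp: f'_def g'_def algebra_simps)
  show "set_integrable lebesgue (J x) (\<lambda>y. f y * G y + F y * g y)"
    using Bochner_Integration.integrable_add[OF i1 i2] unfolding set_integrable_def split .
  have "(LINT y:J x|lebesgue. f y * G y + F y * g y)
      = (LINT s|lebesgue. LINT t|lebesgue. H1 s t) + (LINT t|lebesgue. LINT s|lebesgue. H2 s t)"
    unfolding H1_int H2_int set_lebesgue_integral_def split[symmetric]
    using i1 i2 by simp
  also have "\<dots> = (LINT s|lebesgue. LINT t|lebesgue. H1 s t) + (LINT s|lebesgue. LINT t|lebesgue. H2 s t)"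
    using lebesgue_pair.Fubini_integral[OF H2] by simp
  also have "\<dots> = (LINT s|lebesgue. (LINT t|lebesgue. H1 s t) + (LINT t|lebesgue. H2 s t))"
    using lebesgue_pair.integrable_fst[OF H1] lebesgue_pair.integrable_fst[OF H2] by simp
  also have "\<dots> = (LINT s|lebesgue. LINT t|lebesgue. H s t)"
  proof (rule integral_cong_AE)
    have "AE s in lebesgue. integrable lebesgue (H1 s)" "AE s in lebesgue. integrable lebesgue (H2 s)"
      using lebesgue_pair.AE_integrable_fst[OF H1] lebesgue_pair.AE_integrable_fst[OF H2] by simp_all
    then show "AE s in lebesgue. (LINT t|lebesgue. H1 s t) + (LINT t|lebesgue. H2 s t) = (LINT t|lebesgue. H s t)"
    proof eventually_elim
      case (elim s)
      have "(LINT t|lebesgue. H1 s t) + (LINT t|lebesgue. H2 s t) = (LINT t|lebesgue. H1 s t + H2 s t)"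
        using elim by simp
      also have "\<dots> = (LINT t|lebesgue. H s t)"
      proof (rule integral_cong_AE)
        show "AE t in lebesgue. H1 s t + H2 s t = H s t"
          using AE_lebesgue_neq[of s]
        proof eventually_elim
          case (elim t)
          show ?case
          proof (cases "s \<in> J x \<and> t \<in> J x")
            case True
            then have "s \<in> D" "t \<in> D" using J_sub[OF x] by auto
            then have "(s \<in> J t) \<noteq> (t \<in> J s)"
              using J_total[of s t] elim J_trans[of s t t] J_irrefl[of t] by blast
            then show ?thesis by (auto simp: H1_def H2_def indicator_def)
          qed (auto simp: H1_def H2_def H_def f'_def g'_def)
        qed
      qed (use elim in \<open>auto simp: H_def\<close>)
      finally show ?case .
    qed
  qed (use lebesgue_pair.integrable_fst[OF H1] lebesgue_pair.integrable_fst[OF H2]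
        lebesgue_pair.integrable_fst[OF H] in \<open>auto intro!: borel_measurable_integrable\<close>)
  also have "\<dots> = F x * G x"
    unfolding H_def F_def G_def set_lebesgue_integral_def f'_def[symmetric] g'_def[symmetric]
    by (simp only: integral_mult_right_zero integral_mult_left_zero)
  finally show "(LINT y:J x|lebesgue. f y * G y + F y * g y) = F x * G x" .
qed


text \<open>The powers of an indefinite integral \<open>G\<close> of \<open>w\<close> satisfy the rule \<open>G\<^sup>m\<^sup>+\<^sup>1 = (m + 1) \<integral> w G\<^sup>m\<close>.\<close>
lemma segment_integral_power:
  fixes w :: "real \<Rightarrow> real"
  assumes w: "set_integrable lebesgue D w" and x: "x \<in> D"
  defines "G \<equiv> \<lambda>z. LINT y:J z|lebesgue. w y"
  shows "set_integrable lebesgue (J x) (\<lambda>y. w y * G y ^ m)"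
    and "(LINT y:J x|lebesgue. w y * G y ^ m) = G x ^ Suc m / Suc m"
proof -
  have "x \<in> D \<Longrightarrow> set_integrable lebesgue (J x) (\<lambda>y. w y * G y ^ m) \<and>
      (LINT y:J x|lebesgue. w y * G y ^ m) = G x ^ Suc m / Suc m" for x
  proof (induction m arbitrary: x)
    case 0
    then show ?case using set_integrable_J[OF w 0] by (simp add: G_def)
  next
    case (Suc m)
    define g where "g = (\<lambda>y. Suc m * (w y * G y ^ m))"
    have G_int: "(LINT y:J z|lebesgue. g y) = G z ^ Suc m" if "z \<in> D" for z
      using Suc.IH[OF that] by (simp add: g_def)
    have gx: "set_integrable lebesgue (J x) g"
      using Suc by (simp add: g_def)
    let ?h = "\<lambda>y. w y * (LINT z:J y|lebesgue. g z) + G y * g y"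
    have eq: "?h y = (Suc m + 1) * (w y * G y ^ Suc m)" if "y \<in> J x" for y
      using that J_sub[OF Suc.prems] G_int[of y] by (auto simp: g_def algebra_simps)
    have h: "set_integrable lebesgue (J x) ?h" "(LINT y:J x|lebesgue. ?h y) = G x * G x ^ Suc m"
      using segment_integral_mult[OF Suc.prems set_integrable_J[OF w Suc.prems] gx] G_int[OF Suc.prems]
      by (simp_all add: G_def)
    have "set_integrable lebesgue (J x) (\<lambda>y. (Suc m + 1) * (w y * G y ^ Suc m))"
      using h(1) by (subst (asm) set_integrable_cong[OF refl refl eq]) auto
    moreover have "(LINT y:J x|lebesgue. (Suc m + 1) * (w y * G y ^ Suc m)) = G x * G x ^ Suc m"
      unfolding h(2)[symmetric] using eq by (intro set_lebesgue_integral_cong) auto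
    ultimately have "set_integrable lebesgue (J x) (\<lambda>y. w y * G y ^ Suc m)"
      "(Suc m + 1) * (LINT y:J x|lebesgue. w y * G y ^ Suc m) = G x * G x ^ Suc m"
      by (simp_all only: set_integral_mult_right) simp
    then show ?case by (simp add: field_simps del: power_Suc) simp
  qed
  then show "set_integrable lebesgue (J x) (\<lambda>y. w y * G y ^ m)"
    and "(LINT y:J x|lebesgue. w y * G y ^ m) = G x ^ Suc m / Suc m" using x by auto
qed

text \<open>
  Gronwall's inequality, for a bound \<open>\<beta>\<close> that is monotone for the order. It follows by iterating
  the hypothesis; boundedness of \<open>\<phi>\<close> makes the remainder of the iteration vanish.
\<close>
lemma gronwall:
  fixes w \<phi> \<beta> :: "real \<Rightarrow> real"
  assumes w: "set_integrable lebesgue D w" "\<And>y. y \<in> D \<Longrightarrow> 0 \<le> w y"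
    and \<phi>_meas: "set_borel_measurable lebesgue D \<phi>"
    and \<phi>_bd: "\<And>y. y \<in> D \<Longrightarrow> 0 \<le> \<phi> y \<and> \<phi> y \<le> M"
    and \<beta>: "\<And>x y. x \<in> D \<Longrightarrow> y \<in> J x \<Longrightarrow> \<beta> y \<le> \<beta> x"
    and ineq: "\<And>x. x \<in> D \<Longrightarrow> \<phi> x \<le> \<beta> x + (LINT y:J x|lebesgue. w y * \<phi> y)"
    and x: "x \<in> D"
  shows "\<phi> x \<le> \<beta> x * exp (LINT y:J x|lebesgue. w y)"
proof -
  define G where "G = (\<lambda>z. LINT y:J z|lebesgue. w y)"
  have G0: "0 \<le> G z" if "z \<in> D" for z
    unfolding G_def set_lebesgue_integral_def
    by (rule Bochner_Integration.integral_nonneg) (use J_sub[OF that] w in \<open>auto simp: indicator_def\<close>)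
  have pow: "set_integrable lebesgue (J x) (\<lambda>y. w y * G y ^ m)"
    "(LINT y:J x|lebesgue. w y * G y ^ m) = G x ^ Suc m / Suc m" if "x \<in> D" for x m
    using segment_integral_power[OF w(1) that] by (simp_all add: G_def)
  have iter: "\<phi> x \<le> \<beta> x * (\<Sum>l<m. G x ^ l / fact l) + M * (G x ^ m / fact m)" if "x \<in> D" for m x
    using that
  proof (induction m arbitrary: x)
    case 0
    then show ?case using \<phi>_bd by simp
  next
    case (Suc m)
    have J: "y \<in> D" if "y \<in> J x" for y using J_sub[OF Suc.prems] that by auto
    have int: "set_integrable lebesgue (J x) (\<lambda>y. (\<beta> x / fact l) * (w y * G y ^ l))" for l
      by (rule set_integrable_mult_right) (rule pow(1)[OF Suc.prems])
    have int': "set_integrable lebesgue (J x) (\<lambda>y. (M / fact m) * (w y * G y ^ m))"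
      by (rule set_integrable_mult_right) (rule pow(1)[OF Suc.prems])
    have le: "w y * \<phi> y \<le> (\<Sum>l<m. (\<beta> x / fact l) * (w y * G y ^ l)) + (M / fact m) * (w y * G y ^ m)"
      if "y \<in> J x" for y
    proof -
      have "\<phi> y \<le> \<beta> y * (\<Sum>l<m. G y ^ l / fact l) + M * (G y ^ m / fact m)"
        using Suc.IH[OF J[OF that]] .
      also have "\<dots> \<le> \<beta> x * (\<Sum>l<m. G y ^ l / fact l) + M * (G y ^ m / fact m)"
        using \<beta>[OF Suc.prems that] G0[OF J[OF that]]
        by (intro add_right_mono mult_right_mono sum_nonneg) auto
      finally have "w y * \<phi> y \<le> w y * (\<beta> x * (\<Sum>l<m. G y ^ l / fact l) + M * (G y ^ m / fact m))"
        using w(2)[OF J[OF that]] by (rule mult_left_mono)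
      then show ?thesis by (simp add: algebra_simps sum_distrib_left)
    qed
    have "(LINT y:J x|lebesgue. w y * \<phi> y)
        \<le> (LINT y:J x|lebesgue. (\<Sum>l<m. (\<beta> x / fact l) * (w y * G y ^ l)) + (M / fact m) * (w y * G y ^ m))"
    proof (rule set_integral_mono)
      show "set_integrable lebesgue (J x) (\<lambda>y. w y * \<phi> y)"
      proof (rule set_integrable_bound[where f = "\<lambda>y. M * w y"])
        show "set_integrable lebesgue (J x) (\<lambda>y. M * w y)"
          using set_integrable_J[OF w(1) Suc.prems] by simp
        have "(\<lambda>y. indicator (J x) y * ((indicator D y *\<^sub>R w y) * (indicator D y *\<^sub>R \<phi> y))) \<in> borel_measurable lebesgue"
          using w(1) \<phi>_meas unfolding set_integrable_def set_borel_measurable_def by measurable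
        also have "(\<lambda>y. indicator (J x) y * ((indicator D y *\<^sub>R w y) * (indicator D y *\<^sub>R \<phi> y)))
            = (\<lambda>y. indicator (J x) y *\<^sub>R (w y * \<phi> y))"
          using J by (auto simp: indicator_def fun_eq_iff)
        finally show "set_borel_measurable lebesgue (J x) (\<lambda>y. w y * \<phi> y)"
          by (simp add: set_borel_measurable_def)
        show "AE y in lebesgue. y \<in> J x \<longrightarrow> norm (w y * \<phi> y) \<le> norm (M * w y)"
        proof (intro AE_I2 impI)
          fix y assume "y \<in> J x"
          then have "0 \<le> w y" "0 \<le> \<phi> y" "\<phi> y \<le> M" using J \<phi>_bd w(2) by auto
          then show "norm (w y * \<phi> y) \<le> norm (M * w y)"
            by (simp add: abs_mult mult.commute[of _ "w y"] mult_left_mono)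
        qed
      qed
      show "set_integrable lebesgue (J x)
          (\<lambda>y. (\<Sum>l<m. (\<beta> x / fact l) * (w y * G y ^ l)) + (M / fact m) * (w y * G y ^ m))"
        using int int' by (intro set_integral_add set_integral_sum) auto
    qed (rule le)
    also have "\<dots> = (\<Sum>l<m. (\<beta> x / fact l) * (G x ^ Suc l / Suc l)) + (M / fact m) * (G x ^ Suc m / Suc m)"
      using int int' pow(2)[OF Suc.prems]
      by (subst set_integral_add(2)) (simp_all add: set_integral_sum mult.commute)
    also have "\<dots> = \<beta> x * (\<Sum>l<m. G x ^ Suc l / fact (Suc l)) + M * (G x ^ Suc m / fact (Suc m))"
      by (simp add: sum_distrib_left field_simps)
    finally have "\<phi> x \<le> \<beta> x + (\<beta> x * (\<Sum>l<m. G x ^ Suc l / fact (Suc l)) + M * (G x ^ Suc m / fact (Suc m)))"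
      using ineq[OF Suc.prems] by linarith
    moreover have "(\<Sum>l<Suc m. G x ^ l / fact l) = 1 + (\<Sum>l<m. G x ^ Suc l / fact (Suc l))"
      by (subst sum.lessThan_Suc_shift) simp
    ultimately show ?case by (simp add: algebra_simps)
  qed
  have exp: "(\<lambda>l. G x ^ l / fact l) sums exp (G x)"
    using exp_converges[of "G x"] by (simp add: divide_inverse mult.commute)
  have "(\<lambda>m. \<beta> x * (\<Sum>l<m. G x ^ l / fact l) + M * (G x ^ m / fact m)) \<longlonglongrightarrow> \<beta> x * exp (G x) + M * 0"
    using exp summable_LIMSEQ_zero[OF sums_summable[OF exp]]
    by (intro tendsto_intros) (auto simp: sums_def)
  then show ?thesis
    using iter[OF x] LIMSEQ_le_const[of _ "\<beta> x * exp (G x)" "\<phi> x"] by (auto simp: G_def)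
qed

end

section \<open>Volterra systems with a holomorphic parameter\<close>

lemma norm_integral_le:
  fixes f :: "'b \<Rightarrow> 'a::{banach,second_countable_topology}"
  assumes g: "integrable M g" and f: "f \<in> borel_measurable M"
    and le: "\<And>x. x \<in> space M \<Longrightarrow> norm (f x) \<le> g x"
  shows "integrable M f" and "norm (integral\<^sup>L M f) \<le> integral\<^sup>L M g"
proof -
  show i: "integrable M f"
    by (rule Bochner_Integration.integrable_bound[OF g f])
      (auto intro!: AE_I2 order_trans[OF le abs_ge_self])
  have "norm (integral\<^sup>L M f) \<le> (LINT x|M. norm (f x))" by (rule integral_norm_bound)
  also have "\<dots> \<le> integral\<^sup>L M g" by (intro integral_mono integrable_norm i g le)
  finally show "norm (integral\<^sup>L M f) \<le> integral\<^sup>L M g" .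
qed

text \<open>
  Differentiation under the integral sign needs no bound on the derivative of the integrand:
  Cauchy's inequality derives one from the bound on the integrand itself.
\<close>
lemma holomorphic_on_integral:
  fixes h :: "'b \<Rightarrow> complex \<Rightarrow> complex"
  assumes S: "open S" and hol: "\<And>y. y \<in> space M \<Longrightarrow> h y holomorphic_on S"
    and meas: "\<And>k. k \<in> S \<Longrightarrow> (\<lambda>y. h y k) \<in> borel_measurable M"
    and bd: "\<And>y k. y \<in> space M \<Longrightarrow> k \<in> S \<Longrightarrow> cmod (h y k) \<le> g y"
    and g: "integrable M g"
  shows "(\<lambda>k. LINT y|M. h y k) holomorphic_on S"
proof -
  have int: "integrable M (\<lambda>y. h y k)" if "k \<in> S" for k
    by (rule norm_integral_le(1)[OF g]) (auto intro: meas bd that)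
  have "\<exists>D. ((\<lambda>k. LINT y|M. h y k) has_field_derivative D) (at k)" if k: "k \<in> S" for k
  proof -
    obtain e where e: "e > 0" "cball k e \<subseteq> S" using open_contains_cball_eq[OF S] k by blast
    define r where "r = e / 2"
    have r: "r > 0" "cball k (2 * r) \<subseteq> S" using e by (simp_all add: r_def)
    have sub: "cball z r \<subseteq> S" if "z \<in> cball k r" for z
    proof
      fix u assume "u \<in> cball z r"
      then have "dist k u \<le> 2 * r" using that dist_triangle[of k u z] by simp
      then show "u \<in> S" using r(2) by auto
    qed
    have der: "(h y has_field_derivative deriv (h y) z) (at z)" if "y \<in> space M" "z \<in> S" for y z
      by (rule holomorphic_derivI[OF hol[OF that(1)] S that(2)])
    have dbd: "cmod (deriv (h y) z) \<le> g y / r" if y: "y \<in> space M" and z: "z \<in> cball k r" for y z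
    proof -
      have "cmod ((deriv ^^ 1) (h y) z) \<le> fact 1 * g y / r ^ 1"
      proof (rule Cauchy_inequality)
        show "h y holomorphic_on ball z r"
          by (rule holomorphic_on_subset[OF hol[OF y]]) (use sub[OF z] in auto)
        show "continuous_on (cball z r) (h y)"
          by (rule holomorphic_on_imp_continuous_on[OF holomorphic_on_subset[OF hol[OF y] sub[OF z]]])
        show "cmod (h y x) \<le> g y" if "cmod (z - x) = r" for x
          by (rule bd[OF y subsetD[OF sub[OF z]]]) (simp add: dist_norm that)
      qed (use r in auto)
      then show ?thesis by simp
    qed
    have quot: "cmod ((h y z - h y k) / (z - k)) \<le> g y / r"
      if y: "y \<in> space M" and z: "z \<in> cball k r" for y z
    proof -
      have d: "(h y has_field_derivative deriv (h y) u) (at u within cball k r)" if "u \<in> cball k r" for u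
      proof -
        have "u \<in> S" by (rule subsetD[OF sub[OF that]]) (use r(1) in simp)
        then show ?thesis by (rule has_field_derivative_at_within[OF der[OF y]])
      qed
      have k0: "k \<in> cball k r" using r(1) by simp
      have le: "cmod (h y z - h y k) \<le> g y / r * cmod (z - k)"
        by (rule field_differentiable_bound[OF convex_cball d dbd[OF y] z k0])
      have "0 \<le> g y" by (rule order_trans[OF norm_ge_zero bd[OF y k]])
      then have nonneg: "0 \<le> g y / r" using r(1) by (intro divide_nonneg_pos)
      show ?thesis
      proof (cases "z = k")
        case True
        then show ?thesis using nonneg by simp
      next
        case False
        then have "0 < cmod (z - k)" by simp
        then show ?thesis using le unfolding norm_divide by (rule pos_divide_le_eq[THEN iffD2])
      qed
    qed
    have "((\<lambda>z. ((LINT y|M. h y z) - (LINT y|M. h y k)) / (z - k)) \<longlongrightarrow> (LINT y|M. deriv (h y) k)) (at k)"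
    proof (subst LIMSEQ_SEQ_conv[symmetric], intro allI impI)
      fix \<xi> :: "nat \<Rightarrow> complex" assume \<xi>: "(\<forall>n. \<xi> n \<noteq> k) \<and> \<xi> \<longlonglongrightarrow> k"
      obtain N where N: "\<xi> (n + N) \<in> cball k r" for n
      proof -
        obtain N where "\<forall>n\<ge>N. dist (\<xi> n) k < r" using \<xi> r(1) metric_LIMSEQ_D by blast
        then have "dist (\<xi> (n + N)) k < r" for n by simp
        then have "\<xi> (n + N) \<in> cball k r" for n unfolding mem_cball dist_commute[of k] by (rule less_imp_le)
        then show thesis by (rule that)
      qed
      have NS: "\<xi> (n + N) \<in> S" for n by (rule subsetD[OF sub[OF N[of n]]]) (use r(1) in simp)
      define q where "q = (\<lambda>n y. (h y (\<xi> (n + N)) - h y k) / (\<xi> (n + N) - k))"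
      have q_meas [measurable]: "q n \<in> borel_measurable M" for n
        unfolding q_def using meas[OF NS] meas[OF k] by measurable
      have q_lim: "(\<lambda>n. q n y) \<longlonglongrightarrow> deriv (h y) k" if "y \<in> space M" for y
      proof -
        have "((\<lambda>z. (h y z - h y k) / (z - k)) \<longlongrightarrow> deriv (h y) k) (at k)"
          using der[OF that k] by (simp add: has_field_derivative_iff)
        then have "(\<lambda>n. (h y (\<xi> n) - h y k) / (\<xi> n - k)) \<longlonglongrightarrow> deriv (h y) k"
          using \<xi> LIMSEQ_SEQ_conv[of k "\<lambda>z. (h y z - h y k) / (z - k)" "deriv (h y) k"] by simp
        from LIMSEQ_ignore_initial_segment[OF this, of N] show ?thesis by (simp add: q_def)
      qed
      have q_eq: "(LINT y|M. q n y) = ((LINT y|M. h y (\<xi> (n + N))) - (LINT y|M. h y k)) / (\<xi> (n + N) - k)" for n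
        unfolding q_def
        by (subst Bochner_Integration.integral_diff[OF int[OF NS] int[OF k], symmetric]) (rule integral_divide_zero)
      have "(\<lambda>n. LINT y|M. q n y) \<longlonglongrightarrow> (LINT y|M. deriv (h y) k)"
      proof (rule integral_dominated_convergence[where w = "\<lambda>y. g y / r"])
        show "(\<lambda>y. deriv (h y) k) \<in> borel_measurable M"
          using q_meas q_lim by (rule borel_measurable_LIMSEQ_metric)
        show "AE y in M. (\<lambda>n. q n y) \<longlonglongrightarrow> deriv (h y) k" by (rule AE_I2) (rule q_lim)
        show "AE y in M. cmod (q n y) \<le> g y / r" for n
          unfolding q_def by (rule AE_I2) (rule quot[OF _ N])
      qed (use g in simp_all)
      then have lim: "(\<lambda>n. ((LINT y|M. h y (\<xi> (n + N))) - (LINT y|M. h y k)) / (\<xi> (n + N) - k))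
          \<longlonglongrightarrow> (LINT y|M. deriv (h y) k)" unfolding q_eq .
      show "(\<lambda>n. ((LINT y|M. h y (\<xi> n)) - (LINT y|M. h y k)) / (\<xi> n - k)) \<longlonglongrightarrow> (LINT y|M. deriv (h y) k)"
        using lim by (rule LIMSEQ_offset)
    qed
    then show ?thesis by (auto simp: has_field_derivative_iff)
  qed
  then show ?thesis
    by (subst holomorphic_on_open[OF S]) (rule ballI)
qed

text \<open>
  The terms of the Neumann series of \<open>v\<^sub>i(x) = c\<^sub>i + (\<integral>y. \<Sum>j. K\<^sub>i\<^sub>j(x,y) v\<^sub>j(y))\<close>. The integral is over
  the whole line: the range of integration is encoded in the kernel. Terms and sum are defined for
  every \<open>x\<close> and \<open>k\<close>, so that results proved on different domains concern the same function.
\<close>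
primrec neumann :: "('i::finite \<Rightarrow> 'i \<Rightarrow> real \<Rightarrow> real \<Rightarrow> complex \<Rightarrow> complex) \<Rightarrow> ('i \<Rightarrow> complex) \<Rightarrow>
    nat \<Rightarrow> 'i \<Rightarrow> real \<Rightarrow> complex \<Rightarrow> complex" where
  "neumann K c 0 = (\<lambda>i x k. c i)"
| "neumann K c (Suc m) = (\<lambda>i x k. LINT y|lebesgue. (\<Sum>j\<in>UNIV. K i j x y k * neumann K c m j y k))"

text \<open>The sum of the Neumann series; it carries information only where the series converges.\<close>
definition volterra_sol :: "('i::finite \<Rightarrow> 'i \<Rightarrow> real \<Rightarrow> real \<Rightarrow> complex \<Rightarrow> complex) \<Rightarrow> ('i \<Rightarrow> complex) \<Rightarrow>
    'i \<Rightarrow> real \<Rightarrow> complex \<Rightarrow> complex" where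
  "volterra_sol K c i x k = (\<Sum>m. neumann K c m i x k)"

text \<open>
  A linear system of Volterra equations whose kernel is supported on the initial segments and
  dominated there by an integrable function \<open>w\<close> of \<open>y\<close>, uniformly for \<open>k \<in> S\<close>. No regularity in \<open>k\<close>
  is assumed; holomorphy is an extra hypothesis where it is needed.
\<close>
locale volterra_system = segments D J for D J +
  fixes K :: "'i::finite \<Rightarrow> 'i \<Rightarrow> real \<Rightarrow> real \<Rightarrow> complex \<Rightarrow> complex" and c :: "'i \<Rightarrow> complex"
    and S :: "complex set" and w :: "real \<Rightarrow> real" and B :: real
  assumes K_meas: "k \<in> S \<Longrightarrow> (\<lambda>p. K i j (fst p) (snd p) k) \<in> borel_measurable (lebesgue \<Otimes>\<^sub>M lebesgue)"
    and K_zero: "x \<in> D \<Longrightarrow> y \<notin> J x \<Longrightarrow> k \<in> S \<Longrightarrow> K i j x y k = 0"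
    and K_bound: "x \<in> D \<Longrightarrow> y \<in> J x \<Longrightarrow> k \<in> S \<Longrightarrow> cmod (K i j x y k) \<le> w y"
    and w_int: "set_integrable lebesgue D w"
    and w_nonneg: "y \<in> D \<Longrightarrow> 0 \<le> w y"
    and c_bound: "cmod (c i) \<le> B"
begin

abbreviation "a \<equiv> neumann K c"
abbreviation "v \<equiv> volterra_sol K c"

text \<open>The mass of \<open>w\<close> on an initial segment, and its total mass.\<close>
definition G :: "real \<Rightarrow> real" where "G x = (LINT y:J x|lebesgue. w y)"
definition Gtot :: real where "Gtot = (LINT y:D|lebesgue. w y)"

lemma B_nonneg: "0 \<le> B"
  using c_bound by (meson norm_ge_zero order_trans)

lemma G_bounds: assumes "x \<in> D" shows "0 \<le> G x" "G x \<le> Gtot"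
proof -
  show "0 \<le> G x" unfolding G_def set_lebesgue_integral_def
    by (rule Bochner_Integration.integral_nonneg) (use J_sub[OF assms] w_nonneg in \<open>auto simp: indicator_def\<close>)
  show "G x \<le> Gtot" unfolding G_def Gtot_def set_lebesgue_integral_def
    using set_integrable_J[OF w_int assms] w_int J_sub[OF assms] w_nonneg
    by (intro integral_mono) (auto simp: set_integrable_def indicator_def)
qed

lemma K_meas_snd [measurable]: "k \<in> S \<Longrightarrow> (\<lambda>y. K i j x y k) \<in> borel_measurable lebesgue"
  using measurable_compose[OF measurable_Pair1' K_meas, of x] by simp

lemma kernel_sum_bound:
  assumes x: "x \<in> D" and k: "k \<in> S" and bd: "\<And>j. y \<in> J x \<Longrightarrow> cmod (u j) \<le> b"
  shows "cmod (\<Sum>j\<in>UNIV. K i j x y k * u j) \<le> real CARD('i) * (indicator (J x) y *\<^sub>R (w y * b))"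
proof (cases "y \<in> J x")
  case True
  have "cmod (K i j x y k * u j) \<le> w y * b" for j
    unfolding norm_mult using True J_sub[OF x] w_nonneg
    by (intro mult_mono K_bound[OF x _ k] bd) auto
  then have "cmod (\<Sum>j\<in>UNIV. K i j x y k * u j) \<le> (\<Sum>j\<in>(UNIV::'i set). w y * b)"
    by (intro order_trans[OF norm_sum] sum_mono)
  then show ?thesis using True by simp
qed (simp add: K_zero[OF x _ k])

text \<open>The integral operator with kernel \<open>K\<close> applied to a function bounded by \<open>b\<close>.\<close>
lemma kernel_integral:
  assumes x: "x \<in> D" and k: "k \<in> S" and v: "\<And>j. set_borel_measurable lebesgue D (u j)"
    and bd: "\<And>j y. y \<in> J x \<Longrightarrow> cmod (u j y) \<le> b y"
    and int: "set_integrable lebesgue (J x) (\<lambda>y. w y * b y)"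
  shows "integrable lebesgue (\<lambda>y. \<Sum>j\<in>UNIV. K i j x y k * u j y)"
    and "cmod (LINT y|lebesgue. (\<Sum>j\<in>UNIV. K i j x y k * u j y)) \<le> real CARD('i) * (LINT y:J x|lebesgue. w y * b y)"
proof -
  have g: "integrable lebesgue (\<lambda>y. real CARD('i) * (indicator (J x) y *\<^sub>R (w y * b y)))"
    using int by (simp add: set_integrable_def)
  have "(\<lambda>y. \<Sum>j\<in>UNIV. K i j x y k * (indicator D y *\<^sub>R u j y)) \<in> borel_measurable lebesgue"
    using v k unfolding set_borel_measurable_def by measurable
  moreover have "(\<lambda>y. \<Sum>j\<in>UNIV. K i j x y k * (indicator D y *\<^sub>R u j y)) = (\<lambda>y. \<Sum>j\<in>UNIV. K i j x y k * u j y)"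
    using J_sub[OF x] K_zero[OF x _ k] by (intro ext sum.cong refl) (auto simp: indicator_def)
  ultimately have m: "(\<lambda>y. \<Sum>j\<in>UNIV. K i j x y k * u j y) \<in> borel_measurable lebesgue" by simp
  have le: "cmod (\<Sum>j\<in>UNIV. K i j x y k * u j y) \<le> real CARD('i) * (indicator (J x) y *\<^sub>R (w y * b y))" for y
    by (rule kernel_sum_bound[OF x k bd])
  show "integrable lebesgue (\<lambda>y. \<Sum>j\<in>UNIV. K i j x y k * u j y)"
    using norm_integral_le(1)[OF g m] le by blast
  show "cmod (LINT y|lebesgue. (\<Sum>j\<in>UNIV. K i j x y k * u j y)) \<le> real CARD('i) * (LINT y:J x|lebesgue. w y * b y)"
    using norm_integral_le(2)[OF g m] le by (simp add: set_lebesgue_integral_def)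
qed

lemma neumann_measurable [measurable]: "k \<in> S \<Longrightarrow> (\<lambda>x. a m i x k) \<in> borel_measurable lebesgue"
proof (induction m arbitrary: i)
  case (Suc m)
  note [measurable] = Suc.IH[OF Suc.prems] K_meas[OF Suc.prems]
  have "(\<lambda>p. \<Sum>j\<in>UNIV. K i j (fst p) (snd p) k * a m j (snd p) k) \<in> borel_measurable (lebesgue \<Otimes>\<^sub>M lebesgue)"
    by measurable
  then show ?case
    using sigma_finite_measure.borel_measurable_lebesgue_integral[OF sigma_finite_lebesgue,
        of "\<lambda>x y. \<Sum>j\<in>UNIV. K i j x y k * a m j y k" lebesgue]
    by (simp add: case_prod_unfold)
qed simp

lemma neumann_set_measurable: "k \<in> S \<Longrightarrow> set_borel_measurable lebesgue D (\<lambda>x. a m i x k)"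
  unfolding set_borel_measurable_def by measurable

lemma neumann_bound:
  "x \<in> D \<Longrightarrow> k \<in> S \<Longrightarrow> cmod (a m i x k) \<le> B * real CARD('i) ^ m / fact m * G x ^ m"
proof (induction m arbitrary: i x)
  case 0
  then show ?case using c_bound by simp
next
  case (Suc m)
  have pow: "set_integrable lebesgue (J x) (\<lambda>y. w y * G y ^ m)"
    "(LINT y:J x|lebesgue. w y * G y ^ m) = G x ^ Suc m / Suc m"
    using segment_integral_power[OF w_int Suc.prems(1)] by (simp_all add: G_def)
  have eq: "w y * (B * real CARD('i) ^ m / fact m * G y ^ m) = (B * real CARD('i) ^ m / fact m) * (w y * G y ^ m)" for y
    by simp
  have "cmod (a (Suc m) i x k) \<le> real CARD('i) * (LINT y:J x|lebesgue. w y * (B * real CARD('i) ^ m / fact m * G y ^ m))"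
    unfolding neumann.simps
  proof (rule kernel_integral(2)[OF Suc.prems neumann_set_measurable[OF Suc.prems(2)]])
    show "set_integrable lebesgue (J x) (\<lambda>y. w y * (B * real CARD('i) ^ m / fact m * G y ^ m))"
      unfolding eq by (rule set_integrable_mult_right) (rule pow)
  qed (use Suc.IH Suc.prems J_sub in blast)
  also have "\<dots> = B * real CARD('i) ^ Suc m / fact (Suc m) * G x ^ Suc m"
    unfolding eq set_integral_mult_right pow by (simp add: field_simps)
  finally show ?case .
qed

lemma neumann_bound_uniform:
  assumes "x \<in> D" "k \<in> S"
  shows "cmod (a m i x k) \<le> B * ((real CARD('i) * Gtot) ^ m / fact m)"
proof -
  have "cmod (a m i x k) \<le> B * real CARD('i) ^ m / fact m * G x ^ m" by (rule neumann_bound[OF assms])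
  also have "\<dots> \<le> B * real CARD('i) ^ m / fact m * Gtot ^ m"
    using G_bounds[OF assms(1)] B_nonneg by (intro mult_left_mono power_mono) auto
  finally show ?thesis by (simp add: power_mult_distrib)
qed

lemma sums_bound: "(\<lambda>m. B * (t ^ m / fact m)) sums (B * exp t)" for t :: real
  using sums_mult[OF exp_converges[of t], of B] by (simp add: divide_inverse mult.commute)

lemma sol_sums: "x \<in> D \<Longrightarrow> k \<in> S \<Longrightarrow> (\<lambda>m. a m i x k) sums v i x k"
  unfolding volterra_sol_def
  by (intro summable_sums summable_comparison_test'[OF sums_summable[OF sums_bound]])
    (rule neumann_bound_uniform)

lemma partial_sum_bound:
  assumes "x \<in> D" "k \<in> S"
  shows "cmod (\<Sum>m<M. a m i x k) \<le> B * exp (real CARD('i) * Gtot)"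
proof -
  have "0 \<le> Gtot" using G_bounds[OF assms(1)] by linarith
  have "cmod (\<Sum>m<M. a m i x k) \<le> (\<Sum>m<M. B * ((real CARD('i) * Gtot) ^ m / fact m))"
    by (intro order_trans[OF norm_sum] sum_mono neumann_bound_uniform assms)
  also have "\<dots> \<le> B * exp (real CARD('i) * Gtot)"
    unfolding sums_unique[OF sums_bound, of "real CARD('i) * Gtot"]
    using B_nonneg \<open>0 \<le> Gtot\<close> by (intro sum_le_suminf sums_summable[OF sums_bound]) auto
  finally show ?thesis .
qed

lemma sol_bound:
  assumes "x \<in> D" "k \<in> S"
  shows "cmod (v i x k) \<le> B * exp (real CARD('i) * Gtot)"
  by (rule LIMSEQ_le_const2[OF tendsto_norm[OF sol_sums[OF assms, unfolded sums_def]]])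
    (use partial_sum_bound[OF assms] in auto)

lemma sol_measurable [measurable]: "k \<in> S \<Longrightarrow> (\<lambda>x. v i x k) \<in> borel_measurable lebesgue"
  unfolding volterra_sol_def by measurable

lemma sol_set_measurable: "k \<in> S \<Longrightarrow> set_borel_measurable lebesgue D (\<lambda>x. v i x k)"
  unfolding set_borel_measurable_def by measurable

lemma w_times_const: "x \<in> D \<Longrightarrow> set_integrable lebesgue (J x) (\<lambda>y. w y * b)"
  using set_integrable_J[OF w_int] by simp

lemma sol_equation:
  assumes x: "x \<in> D" and k: "k \<in> S"
  shows "integrable lebesgue (\<lambda>y. \<Sum>j\<in>UNIV. K i j x y k * v j y k)"
    and "v i x k = c i + (LINT y|lebesgue. (\<Sum>j\<in>UNIV. K i j x y k * v j y k))"
proof -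
  have J: "y \<in> D" if "y \<in> J x" for y using J_sub[OF x] that by auto
  show "integrable lebesgue (\<lambda>y. \<Sum>j\<in>UNIV. K i j x y k * v j y k)"
    by (rule kernel_integral(1)[OF x k sol_set_measurable[OF k] sol_bound w_times_const[OF x]]) (use J k in auto)
  define s where "s = (\<lambda>M i y. \<Sum>m<M. a m i y k)"
  have "s (Suc M) i x = c i + (LINT y|lebesgue. (\<Sum>j\<in>UNIV. K i j x y k * s M j y))" for M
  proof -
    have ia: "integrable lebesgue (\<lambda>y. \<Sum>j\<in>UNIV. K i j x y k * a m j y k)" for m
      by (rule kernel_integral(1)[OF x k neumann_set_measurable[OF k] neumann_bound_uniform w_times_const[OF x]])
        (use J k in auto)
    have "s (Suc M) i x = c i + (\<Sum>m<M. LINT y|lebesgue. (\<Sum>j\<in>UNIV. K i j x y k * a m j y k))"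
      unfolding s_def by (subst sum.lessThan_Suc_shift) simp
    also have "(\<Sum>m<M. LINT y|lebesgue. (\<Sum>j\<in>UNIV. K i j x y k * a m j y k))
        = (LINT y|lebesgue. (\<Sum>m<M. \<Sum>j\<in>UNIV. K i j x y k * a m j y k))"
      using ia by simp
    also have "\<dots> = (LINT y|lebesgue. (\<Sum>j\<in>UNIV. K i j x y k * s M j y))"
      unfolding s_def by (subst sum.swap) (simp add: sum_distrib_left)
    finally show ?thesis .
  qed
  moreover have "(\<lambda>M. s (Suc M) i x) \<longlonglongrightarrow> v i x k"
    using LIMSEQ_Suc[OF sol_sums[OF x k, unfolded sums_def]] by (simp add: s_def)
  moreover have "(\<lambda>M. LINT y|lebesgue. (\<Sum>j\<in>UNIV. K i j x y k * s M j y))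
      \<longlonglongrightarrow> (LINT y|lebesgue. (\<Sum>j\<in>UNIV. K i j x y k * v j y k))"
  proof (rule integral_dominated_convergence)
    show "integrable lebesgue (\<lambda>y. real CARD('i) * (indicator (J x) y *\<^sub>R (w y * (B * exp (real CARD('i) * Gtot)))))"
      using w_times_const[OF x] unfolding set_integrable_def by (rule integrable_mult_right)
    show "AE y in lebesgue. cmod (\<Sum>j\<in>UNIV. K i j x y k * s M j y)
        \<le> real CARD('i) * (indicator (J x) y *\<^sub>R (w y * (B * exp (real CARD('i) * Gtot))))" for M
      unfolding s_def by (intro AE_I2 kernel_sum_bound[OF x k] partial_sum_bound k J)
    show "AE y in lebesgue. (\<lambda>M. \<Sum>j\<in>UNIV. K i j x y k * s M j y) \<longlonglongrightarrow> (\<Sum>j\<in>UNIV. K i j x y k * v j y k)"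
    proof (intro AE_I2 tendsto_sum)
      fix y j
      show "(\<lambda>M. K i j x y k * s M j y) \<longlonglongrightarrow> K i j x y k * v j y k"
      proof (cases "y \<in> J x")
        case True
        then show ?thesis using sol_sums[OF J k, of y j] unfolding sums_def s_def by (intro tendsto_intros) auto
      qed (simp add: K_zero[OF x _ k])
    qed
  qed (use k in \<open>auto simp: s_def\<close>)
  ultimately show "v i x k = c i + (LINT y|lebesgue. (\<Sum>j\<in>UNIV. K i j x y k * v j y k))"
    by (intro LIMSEQ_unique[of "\<lambda>M. s (Suc M) i x"]) (auto intro: tendsto_add)
qed

lemma neumann_holomorphic:
  assumes S: "open S" and hol: "\<And>i j x y. x \<in> D \<Longrightarrow> y \<in> J x \<Longrightarrow> K i j x y holomorphic_on S"
    and x: "x \<in> D"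
  shows "a m i x holomorphic_on S"
  using x
proof (induction m arbitrary: i x)
  case (Suc m)
  have J: "y \<in> D" if "y \<in> J x" for y using J_sub[OF Suc.prems] that by auto
  have "(\<lambda>k. LINT y|lebesgue. (\<Sum>j\<in>UNIV. K i j x y k * a m j y k)) holomorphic_on S"
  proof (rule holomorphic_on_integral[OF S])
    let ?b = "B * ((real CARD('i) * Gtot) ^ m / fact m)"
    show "integrable lebesgue (\<lambda>y. real CARD('i) * (indicator (J x) y *\<^sub>R (w y * ?b)))"
      using w_times_const[OF Suc.prems] unfolding set_integrable_def by (rule integrable_mult_right)
    show "(\<lambda>k. \<Sum>j\<in>UNIV. K i j x y k * a m j y k) holomorphic_on S" for y
    proof (cases "y \<in> J x")
      case True
      then show ?thesis using hol[OF Suc.prems] Suc.IH[OF J] by (intro holomorphic_intros) auto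
    next
      case False
      have "(\<lambda>k. 0) holomorphic_on S" by simp
      then show ?thesis by (rule holomorphic_transform) (simp add: K_zero[OF Suc.prems False])
    qed
    show "(\<lambda>y. \<Sum>j\<in>UNIV. K i j x y k * a m j y k) \<in> borel_measurable lebesgue" if "k \<in> S" for k
      using that by measurable
    show "cmod (\<Sum>j\<in>UNIV. K i j x y k * a m j y k) \<le> real CARD('i) * (indicator (J x) y *\<^sub>R (w y * ?b))"
      if k: "k \<in> S" for y k
      by (intro kernel_sum_bound[OF Suc.prems k] neumann_bound_uniform k J)
  qed
  then show ?case by simp
qed simp

lemma sol_holomorphic:
  assumes S: "open S" and hol: "\<And>i j x y. x \<in> D \<Longrightarrow> y \<in> J x \<Longrightarrow> K i j x y holomorphic_on S"
    and x: "x \<in> D"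
  shows "v i x holomorphic_on S"
proof (rule holomorphic_uniform_sequence[OF S])
  show "(\<lambda>k. \<Sum>m<M. a m i x k) holomorphic_on S" for M
    by (intro holomorphic_intros neumann_holomorphic[OF S hol x])
  have u: "uniform_limit S (\<lambda>M k. \<Sum>m<M. a m i x k) (\<lambda>k. \<Sum>m. a m i x k) sequentially"
    by (rule Weierstrass_m_test[OF neumann_bound_uniform[OF x] sums_summable[OF sums_bound]])
  show "\<exists>d. 0 < d \<and> cball k d \<subseteq> S \<and> uniform_limit (cball k d) (\<lambda>M k. \<Sum>m<M. a m i x k) (v i x) sequentially"
    if "k \<in> S" for k
    using S that uniform_limit_on_subset[OF u] unfolding volterra_sol_def by (meson open_contains_cball)
qed

text \<open>
  Gronwall's inequality for the system, applied to the sum of the moduli of the components. It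
  serves for a priori bounds, for the comparison of two kernels, and, with \<open>\<beta> = 0\<close>, for uniqueness.
\<close>
lemma system_gronwall:
  assumes k: "k \<in> S" and u_meas: "\<And>j. set_borel_measurable lebesgue D (u j)"
    and u_bd: "\<And>j y. y \<in> D \<Longrightarrow> cmod (u j y) \<le> M"
    and \<beta>: "\<And>x. x \<in> D \<Longrightarrow> 0 \<le> \<beta> x" "\<And>x y. x \<in> D \<Longrightarrow> y \<in> J x \<Longrightarrow> \<beta> y \<le> \<beta> x"
    and ineq: "\<And>i x. x \<in> D \<Longrightarrow>
      cmod (u i x) \<le> \<beta> x + cmod (LINT y|lebesgue. (\<Sum>j\<in>UNIV. K i j x y k * u j y))"
    and x: "x \<in> D"
  shows "cmod (u i x) \<le> real CARD('i) * \<beta> x * exp (real CARD('i) ^ 2 * Gtot)"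
proof -
  let ?N = "real CARD('i)"
  define \<phi> where "\<phi> = (\<lambda>y. \<Sum>j\<in>UNIV. cmod (u j y))"
  have \<phi>_meas: "set_borel_measurable lebesgue D \<phi>"
  proof -
    have "(\<lambda>y. \<Sum>j\<in>UNIV. cmod (indicator D y *\<^sub>R u j y)) \<in> borel_measurable lebesgue"
      using u_meas unfolding set_borel_measurable_def by measurable
    moreover have "(\<lambda>y. \<Sum>j\<in>UNIV. cmod (indicator D y *\<^sub>R u j y)) = (\<lambda>y. indicator D y *\<^sub>R \<phi> y)"
      by (simp add: \<phi>_def sum_distrib_left)
    ultimately show ?thesis by (simp add: set_borel_measurable_def)
  qed
  have \<phi>_bd: "0 \<le> \<phi> y \<and> \<phi> y \<le> ?N * M" if "y \<in> D" for y
    using sum_mono[of UNIV "\<lambda>j. cmod (u j y)" "\<lambda>j. M"] u_bd[OF that] by (auto simp: \<phi>_def sum_nonneg)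
  have w\<phi>: "set_integrable lebesgue (J x) (\<lambda>y. w y * \<phi> y)" if "x \<in> D" for x
  proof (rule set_integrable_bound[OF w_times_const[OF that, of "?N * M"]])
    have "(\<lambda>y. indicator (J x) y * ((indicator D y *\<^sub>R w y) * (indicator D y *\<^sub>R \<phi> y))) \<in> borel_measurable lebesgue"
      using w_int \<phi>_meas unfolding set_integrable_def set_borel_measurable_def by measurable
    also have "(\<lambda>y. indicator (J x) y * ((indicator D y *\<^sub>R w y) * (indicator D y *\<^sub>R \<phi> y)))
        = (\<lambda>y. indicator (J x) y *\<^sub>R (w y * \<phi> y))"
      using J_sub[OF that] by (auto simp: indicator_def fun_eq_iff)
    finally show "set_borel_measurable lebesgue (J x) (\<lambda>y. w y * \<phi> y)" by (simp add: set_borel_measurable_def)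
    show "AE y in lebesgue. y \<in> J x \<longrightarrow> norm (w y * \<phi> y) \<le> norm (w y * (?N * M))"
    proof (intro AE_I2 impI)
      fix y assume "y \<in> J x"
      then have "y \<in> D" using J_sub[OF that] by auto
      then show "norm (w y * \<phi> y) \<le> norm (w y * (?N * M))"
        using mult_left_mono[of "\<phi> y" "?N * M" "w y"] \<phi>_bd[of y] w_nonneg[of y] by (simp add: abs_le_iff abs_of_nonneg)
    qed
  qed
  have bound: "cmod (u i x) \<le> \<beta> x + ?N * (LINT y:J x|lebesgue. w y * \<phi> y)" if "x \<in> D" for i x
  proof -
    have "cmod (u j y) \<le> \<phi> y" for j y
      unfolding \<phi>_def by (rule member_le_sum) auto
    then have "cmod (LINT y|lebesgue. (\<Sum>j\<in>UNIV. K i j x y k * u j y)) \<le> ?N * (LINT y:J x|lebesgue. w y * \<phi> y)"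
      by (intro kernel_integral(2)[OF that k u_meas _ w\<phi>[OF that]])
    then show ?thesis using ineq[OF that, of i] by linarith
  qed
  have "\<phi> x \<le> ?N * \<beta> x * exp (LINT y:J x|lebesgue. ?N ^ 2 * w y)"
  proof (rule gronwall[OF _ _ \<phi>_meas \<phi>_bd _ _ x])
    show "set_integrable lebesgue D (\<lambda>y. ?N ^ 2 * w y)" using w_int by simp
    show "\<phi> x \<le> ?N * \<beta> x + (LINT y:J x|lebesgue. ?N ^ 2 * w y * \<phi> y)" if "x \<in> D" for x
    proof -
      have "\<phi> x \<le> (\<Sum>i\<in>(UNIV::'i set). \<beta> x + ?N * (LINT y:J x|lebesgue. w y * \<phi> y))"
        unfolding \<phi>_def by (rule sum_mono) (use bound[OF that] in \<open>simp add: \<phi>_def\<close>)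
      also have "\<dots> = ?N * \<beta> x + ?N ^ 2 * (LINT y:J x|lebesgue. w y * \<phi> y)"
        by (simp add: algebra_simps power2_eq_square)
      finally show ?thesis by (simp only: mult.assoc set_integral_mult_right)
    qed
  qed (use w_nonneg \<beta> in \<open>auto intro: mult_left_mono\<close>)
  also have "(LINT y:J x|lebesgue. ?N ^ 2 * w y) = ?N ^ 2 * G x" by (simp add: G_def)
  also have "?N * \<beta> x * exp (?N ^ 2 * G x) \<le> ?N * \<beta> x * exp (?N ^ 2 * Gtot)"
    using G_bounds[OF x] \<beta>(1)[OF x] by (intro mult_left_mono) auto
  finally have "\<phi> x \<le> ?N * \<beta> x * exp (?N ^ 2 * Gtot)" .
  moreover have "cmod (u i x) \<le> \<phi> x" unfolding \<phi>_def by (rule member_le_sum) auto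
  ultimately show ?thesis by linarith
qed

end

section \<open>The Volterra equations of the first column\<close>

lemma borel_pair_imp_lebesgue_pair:
  fixes f :: "real \<times> real \<Rightarrow> 'a::topological_space"
  assumes "f \<in> borel_measurable (borel \<Otimes>\<^sub>M borel)"
  shows "f \<in> borel_measurable (lebesgue \<Otimes>\<^sub>M lebesgue)"
proof -
  have "(\<lambda>p. (fst p, snd p)) \<in> (lebesgue \<Otimes>\<^sub>M lebesgue) \<rightarrow>\<^sub>M (borel \<Otimes>\<^sub>M borel :: (real \<times> real) measure)"
    by (intro measurable_Pair fst_borel_lebesgue_pair snd_borel_lebesgue_pair)
  from measurable_compose[OF this assms] show ?thesis by simp
qed

lemma borel_imp_lebesgue_sets: "A \<in> sets borel \<Longrightarrow> (A :: real set) \<in> sets lebesgue"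
  by (simp add: sets_completionI_sets)

lemma indicator_pair_measurable:
  "(\<lambda>p :: real \<times> real. indicator {fst p<..} (snd p) :: real) \<in> borel_measurable (lebesgue \<Otimes>\<^sub>M lebesgue)"
  "(\<lambda>p :: real \<times> real. indicator {0..<fst p} (snd p) :: real) \<in> borel_measurable (lebesgue \<Otimes>\<^sub>M lebesgue)"
  "(\<lambda>p :: real \<times> real. indicator {0<..<fst p} (snd p) :: real) \<in> borel_measurable (lebesgue \<Otimes>\<^sub>M lebesgue)"
proof -
  have eq: "(\<lambda>p :: real \<times> real. indicator {fst p<..} (snd p) :: real) = (\<lambda>p. if fst p < snd p then 1 else 0)"
    "(\<lambda>p :: real \<times> real. indicator {0..<fst p} (snd p) :: real) = (\<lambda>p. if 0 \<le> snd p \<and> snd p < fst p then 1 else 0)"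
    "(\<lambda>p :: real \<times> real. indicator {0<..<fst p} (snd p) :: real) = (\<lambda>p. if 0 < snd p \<and> snd p < fst p then 1 else 0)"
    by (auto simp: indicator_def)
  show "(\<lambda>p :: real \<times> real. indicator {fst p<..} (snd p) :: real) \<in> borel_measurable (lebesgue \<Otimes>\<^sub>M lebesgue)"
    unfolding eq by (rule borel_pair_imp_lebesgue_pair) measurable
  show "(\<lambda>p :: real \<times> real. indicator {0..<fst p} (snd p) :: real) \<in> borel_measurable (lebesgue \<Otimes>\<^sub>M lebesgue)"
    unfolding eq by (rule borel_pair_imp_lebesgue_pair) measurable
  show "(\<lambda>p :: real \<times> real. indicator {0<..<fst p} (snd p) :: real) \<in> borel_measurable (lebesgue \<Otimes>\<^sub>M lebesgue)"
    unfolding eq by (rule borel_pair_imp_lebesgue_pair) measurable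
qed

lemma segments_right: "segments {0..} (\<lambda>x. {x<..})"
  by standard (auto simp: borel_imp_lebesgue_sets intro: indicator_pair_measurable)

lemma segments_left: "segments {0..R} (\<lambda>x. {0..<x})"
  by standard (auto simp: borel_imp_lebesgue_sets intro: indicator_pair_measurable)

lemma mult_le_of_endpoint:
  fixes a t R L :: real
  assumes "0 \<le> t" "t \<le> R" "a * R \<le> L" "0 \<le> L"
  shows "a * t \<le> L"
proof (cases "a \<le> 0")
  case True
  then have "a * t \<le> 0" using assms by (intro mult_nonpos_nonneg) auto
  then show ?thesis using assms by linarith
next
  case False
  then have "a * t \<le> a * R" using assms by (intro mult_left_mono) auto
  then show ?thesis using assms by linarith
qed

text \<open>
  The oscillatory factor in row \<open>i\<close> of the first column: conjugation by \<open>exp (i \<theta>\<^sub>1 t \<sigma>\<^sub>3)\<close> leaves the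
  first entry of this column unchanged and multiplies the second one by \<open>exp (- 2 i \<theta>\<^sub>1 t)\<close>.
\<close>
definition osc :: "2 \<Rightarrow> real \<Rightarrow> complex \<Rightarrow> complex" where
  "osc i t k = (if i = 1 then 1 else exp (- (2 * \<i> * theta1 k * of_real t)))"

text \<open>The first column of the identity matrix.\<close>
definition e1 :: "2 \<Rightarrow> complex" where "e1 i = (if i = 1 then 1 else 0)"

lemma Im_theta1: "Im (theta1 k) = Im k * (1 + 1 / cmod k ^ 2) / 4"
  by (simp add: theta1_def Im_divide_numeral Im_divide cmod_power2 field_simps)

lemma norm_osc_2: "cmod (exp (- (2 * \<i> * theta1 k * of_real t))) = exp (Im k * t * (1 + 1 / cmod k ^ 2) / 2)"
  by (simp add: Im_theta1)

text \<open>
  The imaginary part of \<open>\<theta>\<^sub>1\<close> is \<open>Im k\<close> times a positive factor that is bounded for \<open>|k| \<ge> \<epsilon>\<close>. The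
  bound \<open>L\<close> need not be \<open>0\<close>, which leaves room for \<open>k\<close> to cross the real axis.
\<close>
lemma osc_bound:
  assumes "Im k * t \<le> L" "0 \<le> L" "0 < \<epsilon>" "\<epsilon> \<le> cmod k"
  shows "cmod (osc i t k) \<le> exp (L * (1 + 1 / \<epsilon> ^ 2) / 2)"
proof (cases "i = 1")
  case True
  then show ?thesis using assms(2) by (simp add: osc_def zero_le_mult_iff add_nonneg_nonneg)
next
  case False
  have "Im k * t * (1 + 1 / cmod k ^ 2) \<le> L * (1 + 1 / cmod k ^ 2)"
    using assms(1) by (intro mult_right_mono) auto
  also have "\<dots> \<le> L * (1 + 1 / \<epsilon> ^ 2)"
    using assms by (intro mult_left_mono add_left_mono divide_left_mono power_mono mult_pos_pos) auto
  finally show ?thesis using False by (simp add: osc_def norm_osc_2 del: norm_exp_eq_Re)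
qed

lemma osc_holomorphic: "osc i t holomorphic_on - {0}"
proof (cases "i = 1")
  case True
  then show ?thesis by (simp add: osc_def[abs_def])
next
  case False
  have "(\<lambda>k. exp (- (2 * \<i> * theta1 k * of_real t))) holomorphic_on - {0}"
    unfolding theta1_def by (intro holomorphic_intros) auto
  then show ?thesis using False by (simp add: osc_def[abs_def])
qed

lemma osc_measurable [measurable]:
  assumes [measurable]: "f \<in> borel_measurable M"
  shows "(\<lambda>p. osc i (f p) k) \<in> borel_measurable M"
  unfolding osc_def by measurable

text \<open>
  The properties of the potential that are used: integrability of its \<open>n\<close>-th moment, locally
  uniformly in \<open>k \<noteq> 0\<close>, holomorphy in \<open>k\<close>, trace zero, and its two symmetries.
\<close>
locale lax_potential =
  fixes P :: "2 \<Rightarrow> 2 \<Rightarrow> real \<Rightarrow> complex \<Rightarrow> complex" and w0 :: "real \<Rightarrow> real" and n :: nat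
  assumes P_meas [measurable]: "(\<lambda>y. P i j y k) \<in> borel_measurable lebesgue"
    and P_bound: "k \<noteq> 0 \<Longrightarrow> cmod (P i j y k) \<le> (1 + 1 / cmod k) * w0 y"
    and P_hol: "P i j y holomorphic_on - {0}"
    and P_trace: "P 2 2 y k = - P 1 1 y k"
    and P_reflect: "P 1 1 y (- k) = - P 1 1 y k" "P 1 2 y (- k) = - P 2 1 y k"
    and P_cnj: "P i j y (- cnj k) = cnj (P i j y k)"
    and w0_meas [measurable]: "w0 \<in> borel_measurable lebesgue"
    and w0_nonneg: "0 \<le> w0 y"
    and w0_moment: "set_integrable lebesgue {0..} (\<lambda>y. (1 + y) ^ n * w0 y)"
begin

text \<open>
  The kernels of the two equations for the first column. In \<open>KX\<close> the potential is restricted to a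
  set \<open>T\<close>; the equation for \<open>X\<close> is the case \<open>T = UNIV\<close>, and the sign comes from the reversed
  direction of integration.
\<close>
definition KX :: "real set \<Rightarrow> 2 \<Rightarrow> 2 \<Rightarrow> real \<Rightarrow> real \<Rightarrow> complex \<Rightarrow> complex" where
  "KX T i j x y k = - (of_real (indicator {x<..} y * indicator T y) * (osc i (y - x) k * P i j y k))"

definition KY :: "2 \<Rightarrow> 2 \<Rightarrow> real \<Rightarrow> real \<Rightarrow> complex \<Rightarrow> complex" where
  "KY i j x y k = of_real (indicator {0<..<x} y) * (osc i (y - x) k * P i j y k)"

text \<open>The constant in the bound of the kernels by \<open>w0\<close> for \<open>|k| \<ge> \<epsilon>\<close>.\<close>
definition Ccoef :: "real \<Rightarrow> real \<Rightarrow> real" where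
  "Ccoef L \<epsilon> = exp (L * (1 + 1 / \<epsilon> ^ 2) / 2) * (1 + 1 / \<epsilon>)"

lemma Ccoef_pos: "\<epsilon> > 0 \<Longrightarrow> 0 < Ccoef L \<epsilon>"
  by (auto simp: Ccoef_def intro!: mult_pos_pos add_pos_pos)

lemma kernel_bound:
  assumes "Im k * t \<le> L" "0 \<le> L" "0 < \<epsilon>" "\<epsilon> \<le> cmod k"
  shows "cmod (osc i t k * P i j y k) \<le> Ccoef L \<epsilon> * w0 y"
proof -
  have "k \<noteq> 0" using assms by auto
  have "cmod (P i j y k) \<le> (1 + 1 / cmod k) * w0 y" by (rule P_bound[OF \<open>k \<noteq> 0\<close>])
  also have "\<dots> \<le> (1 + 1 / \<epsilon>) * w0 y"
    using assms by (intro mult_right_mono w0_nonneg add_left_mono divide_left_mono mult_pos_pos) (use \<open>k \<noteq> 0\<close> in auto)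
  finally have "cmod (osc i t k * P i j y k) \<le> exp (L * (1 + 1 / \<epsilon> ^ 2) / 2) * ((1 + 1 / \<epsilon>) * w0 y)"
    unfolding norm_mult by (intro mult_mono osc_bound assms) auto
  then show ?thesis by (simp add: Ccoef_def mult.assoc)
qed

lemma moment:
  assumes "j \<le> n" "A \<in> sets lebesgue" "A \<subseteq> {0..}"
  shows "set_integrable lebesgue A (\<lambda>y. (1 + y) ^ j * w0 y)"
proof (rule set_integrable_bound[OF set_integrable_subset[OF w0_moment assms(2,3)]])
  show "set_borel_measurable lebesgue A (\<lambda>y. (1 + y) ^ j * w0 y)"
    unfolding set_borel_measurable_def using assms(2) by measurable
  show "AE y in lebesgue. y \<in> A \<longrightarrow> norm ((1 + y) ^ j * w0 y) \<le> norm ((1 + y) ^ n * w0 y)"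
  proof (intro AE_I2 impI)
    fix y assume "y \<in> A"
    then have "0 \<le> y" using assms by auto
    then show "norm ((1 + y) ^ j * w0 y) \<le> norm ((1 + y) ^ n * w0 y)"
      using assms(1) w0_nonneg[of y] by (auto simp: abs_mult intro!: mult_right_mono power_increasing)
  qed
qed

lemma w0_int: "A \<in> sets lebesgue \<Longrightarrow> A \<subseteq> {0..} \<Longrightarrow> set_integrable lebesgue A w0"
  using moment[of 0 A] by simp

text \<open>
  Parameter sets \<open>S\<close>, away from \<open>0\<close>, for which the oscillatory factor in the equation truncated to
  \<open>T\<close> is bounded. If \<open>T\<close> is bounded above by \<open>R\<close>, then \<open>S\<close> may reach a distance \<open>1 / R\<close> beyond the real axis.
\<close>
definition admissible :: "real \<Rightarrow> real set \<Rightarrow> complex set \<Rightarrow> bool" where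
  "admissible \<epsilon> T S \<longleftrightarrow> 0 < \<epsilon> \<and> T \<in> sets lebesgue \<and>
    (\<forall>k\<in>S. \<epsilon> \<le> cmod k \<and> (\<forall>y\<in>T. 0 \<le> y \<longrightarrow> Im k * y \<le> 1))"

lemma kernel_pair_measurable:
  "(\<lambda>p. osc i (snd p - fst p) k * P i j (snd p) k) \<in> borel_measurable (lebesgue \<Otimes>\<^sub>M lebesgue)"
proof (rule borel_measurable_times)
  show "(\<lambda>p. osc i (snd p - fst p) k) \<in> borel_measurable (lebesgue \<Otimes>\<^sub>M lebesgue)"
    by (rule borel_pair_imp_lebesgue_pair) measurable
qed (rule measurable_compose[OF measurable_snd P_meas])

lemma system_X:
  assumes "admissible \<epsilon> T S"
  shows "volterra_system {0..} (\<lambda>x. {x<..}) (KX T) e1 S (\<lambda>y. Ccoef 1 \<epsilon> * (indicator T y * w0 y)) 1"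
proof (intro volterra_system.intro segments_right volterra_system_axioms.intro)
  have T [measurable]: "T \<in> sets lebesgue" and \<epsilon>: "0 < \<epsilon>" using assms by (auto simp: admissible_def)
  show "(\<lambda>p. KX T i j (fst p) (snd p) k) \<in> borel_measurable (lebesgue \<Otimes>\<^sub>M lebesgue)" for i j k
  proof -
    note [measurable] = indicator_pair_measurable(1) kernel_pair_measurable
    have [measurable]: "(\<lambda>p. indicator T (snd p) :: real) \<in> borel_measurable (lebesgue \<Otimes>\<^sub>M lebesgue)"
      using measurable_compose[OF measurable_snd borel_measurable_indicator[OF T]] .
    show ?thesis unfolding KX_def by measurable
  qed
  show "KX T i j x y k = 0" if "y \<notin> {x<..}" for i j x y k
    using that by (simp add: KX_def)
  show "cmod (KX T i j x y k) \<le> Ccoef 1 \<epsilon> * (indicator T y * w0 y)"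
    if "x \<in> {0..}" "y \<in> {x<..}" "k \<in> S" for i j x y k
  proof (cases "y \<in> T")
    case True
    have "Im k * (y - x) \<le> 1"
      by (rule mult_le_of_endpoint[of _ y]) (use assms that True in \<open>auto simp: admissible_def\<close>)
    then show ?thesis using kernel_bound[of k "y - x" 1 \<epsilon> i j y] assms that True
      by (simp add: KX_def admissible_def)
  qed (simp add: KX_def)
  show "set_integrable lebesgue {0..} (\<lambda>y. Ccoef 1 \<epsilon> * (indicator T y * w0 y))"
  proof (rule set_integrable_mult_right)
    have "(\<lambda>y. indicator ({0..} \<inter> T) y *\<^sub>R w0 y) = (\<lambda>y. indicator {0..} y *\<^sub>R (indicator T y * w0 y))"
      by (auto simp: indicator_def)
    then show "set_integrable lebesgue {0..} (\<lambda>y. indicator T y * w0 y)"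
      using w0_int[of "{0..} \<inter> T"] by (simp add: set_integrable_def)
  qed
  show "0 \<le> Ccoef 1 \<epsilon> * (indicator T y * w0 y)" for y
    using Ccoef_pos[OF \<epsilon>, of 1] w0_nonneg[of y] by (intro mult_nonneg_nonneg) auto
qed (auto simp: e1_def)

lemma system_Y:
  assumes "0 < \<epsilon>" "0 \<le> L" "\<And>k. k \<in> S \<Longrightarrow> \<epsilon> \<le> cmod k \<and> - Im k * R \<le> L"
  shows "volterra_system {0..R} (\<lambda>x. {0..<x}) KY e1 S (\<lambda>y. Ccoef L \<epsilon> * w0 y) 1"
proof (intro volterra_system.intro segments_left volterra_system_axioms.intro)
  show "(\<lambda>p. KY i j (fst p) (snd p) k) \<in> borel_measurable (lebesgue \<Otimes>\<^sub>M lebesgue)" for i j k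
  proof -
    note [measurable] = indicator_pair_measurable(3) kernel_pair_measurable
    show ?thesis unfolding KY_def by measurable
  qed
  show "KY i j x y k = 0" if "y \<notin> {0..<x}" for i j x y k
    using that by (auto simp: KY_def)
  show "cmod (KY i j x y k) \<le> Ccoef L \<epsilon> * w0 y"
    if "x \<in> {0..R}" "y \<in> {0..<x}" "k \<in> S" for i j x y k
  proof -
    have "- Im k * (x - y) \<le> L"
      by (rule mult_le_of_endpoint[of _ R]) (use assms that in auto)
    then have "Im k * (y - x) \<le> L" by (simp add: algebra_simps)
    then have *: "cmod (osc i (y - x) k * P i j y k) \<le> Ccoef L \<epsilon> * w0 y"
      using assms that by (intro kernel_bound) auto
    have "cmod (KY i j x y k) \<le> cmod (osc i (y - x) k * P i j y k)"
      by (auto simp: KY_def indicator_def)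
    then show ?thesis using * by linarith
  qed
  show "set_integrable lebesgue {0..R} (\<lambda>y. Ccoef L \<epsilon> * w0 y)"
    using w0_int[of "{0..R}"] by simp
  show "0 \<le> Ccoef L \<epsilon> * w0 y" for y
    using Ccoef_pos[OF assms(1), of L] w0_nonneg[of y] by simp
qed (auto simp: e1_def)

lemma KX_holomorphic: "0 \<notin> S \<Longrightarrow> KX T i j x y holomorphic_on S"
  unfolding KX_def[abs_def]
  by (intro holomorphic_intros holomorphic_on_subset[OF osc_holomorphic] holomorphic_on_subset[OF P_hol]) auto

lemma KY_holomorphic: "0 \<notin> S \<Longrightarrow> KY i j x y holomorphic_on S"
  unfolding KY_def[abs_def]
  by (intro holomorphic_intros holomorphic_on_subset[OF osc_holomorphic] holomorphic_on_subset[OF P_hol]) auto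

text \<open>The first columns of \<open>X\<close>, with truncated potential, and of \<open>Y\<close>.\<close>
abbreviation "vX T \<equiv> volterra_sol (KX T) e1"
abbreviation "vY \<equiv> volterra_sol KY e1"

lemma vX_holomorphic:
  assumes "admissible \<epsilon> T S" "open S" "0 \<le> x"
  shows "vX T i x holomorphic_on S"
proof -
  have "0 \<notin> S" using assms(1) by (force simp: admissible_def)
  then show ?thesis
    using volterra_system.sol_holomorphic[OF system_X[OF assms(1)] assms(2) KX_holomorphic] assms(3) by simp
qed

lemma vY_holomorphic:
  assumes "0 \<le> x" shows "vY i x holomorphic_on - {0}"
proof -
  have "vY i x holomorphic_on (\<Union>\<epsilon>\<in>{0<..}. \<Union>L\<in>{0<..}. {k. \<epsilon> < cmod k \<and> - Im k * x < L})"
  proof (intro holomorphic_on_UN_open ballI)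
    \<comment> \<open>On each of these sets the oscillatory factor is bounded on \<open>{0..x}\<close>.\<close>
    fix \<epsilon> L :: real assume pos: "\<epsilon> \<in> {0<..}" "L \<in> {0<..}"
    have o: "open {k. \<epsilon> < cmod k \<and> - Im k * x < L}"
      by (intro open_Collect_conj open_Collect_less continuous_intros)
    then show "open {k. \<epsilon> < cmod k \<and> - Im k * x < L}" .
    have sys: "volterra_system {0..x} (\<lambda>x. {0..<x}) KY e1 {k. \<epsilon> < cmod k \<and> - Im k * x < L}
        (\<lambda>y. Ccoef L \<epsilon> * w0 y) 1"
      using pos by (intro system_Y) auto
    show "vY i x holomorphic_on {k. \<epsilon> < cmod k \<and> - Im k * x < L}"
      using volterra_system.sol_holomorphic[OF sys o KY_holomorphic] pos assms by auto
  qed (auto intro!: open_UN open_Collect_conj open_Collect_less continuous_intros)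
  moreover have "- {0} \<subseteq> (\<Union>\<epsilon>\<in>{0<..}. \<Union>L\<in>{0<..}. {k. \<epsilon> < cmod k \<and> - Im k * x < L})"
  proof
    fix k :: complex assume "k \<in> - {0}"
    then have "k \<in> {k'. cmod k / 2 < cmod k' \<and> - Im k' * x < \<bar>- Im k * x\<bar> + 1}" "cmod k / 2 \<in> {0<..}"
      "\<bar>- Im k * x\<bar> + 1 \<in> {0<..}" by auto
    then show "k \<in> (\<Union>\<epsilon>\<in>{0<..}. \<Union>L\<in>{0<..}. {k. \<epsilon> < cmod k \<and> - Im k * x < L})" by blast
  qed
  ultimately show ?thesis by (rule holomorphic_on_subset)
qed

end

section \<open>Dyadic truncation of the equation at infinity\<close>

lemma set_integrable_indicator_mult:
  fixes f :: "real \<Rightarrow> real"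
  assumes T: "T \<in> sets lebesgue" and f: "set_integrable lebesgue A f"
  shows "set_integrable lebesgue A (\<lambda>y. indicator T y * f y)"
proof -
  have "integrable lebesgue (\<lambda>y. indicator T y *\<^sub>R (indicator A y *\<^sub>R f y))"
    using integrable_mult_indicator[OF T] f unfolding set_integrable_def by blast
  then show ?thesis unfolding set_integrable_def by (simp add: mult.left_commute)
qed

lemma set_integral_mono_nonneg:
  fixes f g :: "real \<Rightarrow> real"
  assumes "set_integrable lebesgue A f" "set_integrable lebesgue B g" "A \<subseteq> B"
    and "\<And>y. y \<in> A \<Longrightarrow> f y \<le> g y" "\<And>y. y \<in> B \<Longrightarrow> 0 \<le> g y"
  shows "(LINT y:A|lebesgue. f y) \<le> (LINT y:B|lebesgue. g y)"
  unfolding set_lebesgue_integral_def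
  using assms by (intro integral_mono) (auto simp: set_integrable_def indicator_def)

lemma set_integral_nonneg':
  fixes f :: "real \<Rightarrow> real"
  assumes "\<And>y. y \<in> A \<Longrightarrow> 0 \<le> f y"
  shows "0 \<le> (LINT y:A|lebesgue. f y)"
  unfolding set_lebesgue_integral_def
  using assms by (intro Bochner_Integration.integral_nonneg) (auto simp: indicator_def)

lemma higher_deriv_sum_lessThan:
  assumes "open A" "k \<in> A" "\<And>m. f m holomorphic_on A"
  shows "(deriv ^^ j) (\<lambda>k. \<Sum>m<M. f m k) k = (\<Sum>m<(M::nat). (deriv ^^ j) (f m) k)"
proof (induction M)
  case (Suc M)
  have "(deriv ^^ j) (\<lambda>k. (\<Sum>m<M. f m k) + f M k) k = (deriv ^^ j) (\<lambda>k. \<Sum>m<M. f m k) k + (deriv ^^ j) (f M) k"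
    by (rule higher_deriv_add[OF _ _ assms(1,2)]) (auto intro!: holomorphic_intros assms(3))
  then show ?case using Suc by simp
qed (simp add: higher_deriv_const)

context lax_potential
begin

text \<open>
  The total mass of the dominating function, and, for \<open>|k| \<ge> \<epsilon>\<close>, the bound of the solutions and the constant
  in the comparison of two truncations.
\<close>
definition W0 :: real where "W0 = (LINT y:{0..}|lebesgue. w0 y)"

definition Vbound :: "real \<Rightarrow> real" where "Vbound \<epsilon> = exp (2 * (Ccoef 1 \<epsilon> * W0))"

definition Cdiff :: "real \<Rightarrow> real" where
  "Cdiff \<epsilon> = 4 * Ccoef 1 \<epsilon> * Vbound \<epsilon> * exp (4 * (Ccoef 1 \<epsilon> * W0))"

lemma W0_nonneg: "0 \<le> W0"
  unfolding W0_def by (intro set_integral_nonneg' w0_nonneg)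

lemma w0_int_right: "0 \<le> x \<Longrightarrow> set_integrable lebesgue {x<..} w0"
  by (intro w0_int) (auto simp: borel_imp_lebesgue_sets)

lemma Gtot_X:
  assumes "admissible \<epsilon> T S"
  shows "volterra_system.Gtot {0..} (\<lambda>y. Ccoef 1 \<epsilon> * (indicator T y * w0 y)) \<le> Ccoef 1 \<epsilon> * W0"
proof -
  have T: "T \<in> sets lebesgue" and \<epsilon>: "0 < \<epsilon>" using assms by (auto simp: admissible_def)
  have "(LINT y:{0..}|lebesgue. indicator T y * w0 y) \<le> W0"
    unfolding W0_def
    by (rule set_integral_mono_nonneg)
      (auto intro!: set_integrable_indicator_mult[OF T] w0_int mult_left_le_one_le
        simp: w0_nonneg borel_imp_lebesgue_sets)
  then show ?thesis
    unfolding volterra_system.Gtot_def[OF system_X[OF assms]] set_integral_mult_right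
    using Ccoef_pos[OF \<epsilon>, of 1] by (intro mult_left_mono) auto
qed

lemma admissible_mono: "admissible \<epsilon> T' S' \<Longrightarrow> T \<subseteq> T' \<Longrightarrow> T \<in> sets lebesgue \<Longrightarrow> S \<subseteq> S' \<Longrightarrow> admissible \<epsilon> T S"
  unfolding admissible_def by blast

lemma vX_bound:
  assumes "admissible \<epsilon> T S" "k \<in> S" "0 \<le> x"
  shows "cmod (vX T i x k) \<le> Vbound \<epsilon>"
proof -
  have "cmod (vX T i x k) \<le> 1 * exp (real CARD(2) * volterra_system.Gtot {0..} (\<lambda>y. Ccoef 1 \<epsilon> * (indicator T y * w0 y)))"
    by (rule volterra_system.sol_bound[OF system_X[OF assms(1)]]) (use assms in auto)
  also have "\<dots> \<le> Vbound \<epsilon>"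
    unfolding Vbound_def using Gtot_X[OF assms(1)] by simp
  finally show ?thesis .
qed

text \<open>
  Two truncations differ by at most a constant times the mass of \<open>w0\<close> on the set where they disagree. The
  difference solves the larger equation with the integral of the smaller solution over that set
  as its source.
\<close>
lemma vX_diff:
  assumes T': "admissible \<epsilon> T' S" and T: "T \<subseteq> T'" "T \<in> sets lebesgue" and k: "k \<in> S" and x: "0 \<le> x"
  shows "cmod (vX T' i x k - vX T i x k) \<le> Cdiff \<epsilon> * (LINT y:{x<..}|lebesgue. indicator (T' - T) y * w0 y)"
proof -
  have adm: "admissible \<epsilon> T S" "admissible \<epsilon> (T' - T) S" and \<epsilon>: "0 < \<epsilon>" and T's: "T' - T \<in> sets lebesgue"
    using T' T by (auto intro: admissible_mono simp: admissible_def)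
  interpret A: volterra_system "{0..}" "\<lambda>x. {x<..}" "KX T'" e1 S "\<lambda>y. Ccoef 1 \<epsilon> * (indicator T' y * w0 y)" 1
    by (rule system_X[OF T'])
  interpret B: volterra_system "{0..}" "\<lambda>x. {x<..}" "KX T" e1 S "\<lambda>y. Ccoef 1 \<epsilon> * (indicator T y * w0 y)" 1
    by (rule system_X[OF adm(1)])
  interpret E: volterra_system "{0..}" "\<lambda>x. {x<..}" "KX (T' - T)" e1 S
    "\<lambda>y. Ccoef 1 \<epsilon> * (indicator (T' - T) y * w0 y)" 1
    by (rule system_X[OF adm(2)])
  define V where "V = Vbound \<epsilon>"
  have C: "0 < Ccoef 1 \<epsilon>" by (rule Ccoef_pos[OF \<epsilon>])
  have V0: "0 < V" by (simp add: V_def Vbound_def)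
  define h where "h = (\<lambda>x. LINT y:{x<..}|lebesgue. indicator (T' - T) y * w0 y)"
  define u where "u = (\<lambda>j y. vX T' j y k - vX T j y k)"
  define \<beta> where "\<beta> = (\<lambda>x. 2 * (Ccoef 1 \<epsilon> * h x * V))"
  have h0: "0 \<le> h x" for x
    unfolding h_def by (intro set_integral_nonneg' mult_nonneg_nonneg w0_nonneg) auto
  have h_int: "set_integrable lebesgue {x<..} (\<lambda>y. indicator (T' - T) y * w0 y)" if "0 \<le> x" for x
    by (rule set_integrable_indicator_mult[OF T's w0_int_right[OF that]])
  have h_mono: "h y \<le> h x" if "0 \<le> x" "x < y" for x y
    unfolding h_def using that w0_nonneg by (intro set_integral_mono_nonneg h_int) auto
  have "cmod (u i x) \<le> real CARD(2) * \<beta> x * exp (real CARD(2) ^ 2 * A.Gtot)"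
  proof (rule A.system_gronwall[OF k, where u = u and \<beta> = \<beta> and M = "V + V" and x = x and i = i])
    show "set_borel_measurable lebesgue {0..} (u j)" for j
    proof -
      have "(\<lambda>y. indicator {0..} y *\<^sub>R vX T' j y k - indicator {0..} y *\<^sub>R vX T j y k) \<in> borel_measurable lebesgue"
        using A.sol_set_measurable[OF k] B.sol_set_measurable[OF k] unfolding set_borel_measurable_def
        by (rule borel_measurable_diff)
      then show ?thesis unfolding u_def set_borel_measurable_def scaleR_diff_right .
    qed
    show "cmod (u j y) \<le> V + V" if "y \<in> {0..}" for j y
      unfolding u_def V_def
      by (rule order_trans[OF norm_triangle_ineq4])
        (intro add_mono vX_bound[OF T' k] vX_bound[OF adm(1) k], use that in auto)
    show "0 \<le> \<beta> x" for x using h0[of x] C V0 by (simp add: \<beta>_def)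
    show "\<beta> y \<le> \<beta> x" if "x \<in> {0..}" "y \<in> {x<..}" for x y
      unfolding \<beta>_def using h_mono[of x y] that C V0 by (intro mult_left_mono mult_right_mono) auto
    fix i x assume xD: "x \<in> {0::real..}"
    have eA: "integrable lebesgue (\<lambda>y. \<Sum>j\<in>UNIV. KX T' i j x y k * vX T' j y k)"
      "vX T' i x k = e1 i + (LINT y|lebesgue. (\<Sum>j\<in>UNIV. KX T' i j x y k * vX T' j y k))"
      by (rule A.sol_equation[OF xD k])+
    have eB: "integrable lebesgue (\<lambda>y. \<Sum>j\<in>UNIV. KX T i j x y k * vX T j y k)"
      "vX T i x k = e1 i + (LINT y|lebesgue. (\<Sum>j\<in>UNIV. KX T i j x y k * vX T j y k))"
      by (rule B.sol_equation[OF xD k])+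
    have VD: "cmod (vX T j y k) \<le> V" if "y \<in> {x<..}" for j y
      unfolding V_def by (rule vX_bound[OF adm(1) k]) (use that xD in auto)
    have EI: "integrable lebesgue (\<lambda>y. \<Sum>j\<in>UNIV. KX (T' - T) i j x y k * vX T j y k)"
      "cmod (LINT y|lebesgue. (\<Sum>j\<in>UNIV. KX (T' - T) i j x y k * vX T j y k))
        \<le> real CARD(2) * (LINT y:{x<..}|lebesgue. Ccoef 1 \<epsilon> * (indicator (T' - T) y * w0 y) * V)"
      by (rule E.kernel_integral[OF xD k B.sol_set_measurable[OF k] VD E.w_times_const[OF xD]], assumption)+
    have split: "(\<Sum>j\<in>UNIV. KX T' i j x y k * u j y) =
        (\<Sum>j\<in>UNIV. KX T' i j x y k * vX T' j y k) - (\<Sum>j\<in>UNIV. KX T i j x y k * vX T j y k)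
        - (\<Sum>j\<in>UNIV. KX (T' - T) i j x y k * vX T j y k)" for y
      unfolding sum_subtractf[symmetric]
    proof (rule sum.cong[OF refl])
      fix j
      have "KX T' i j x y k = KX T i j x y k + KX (T' - T) i j x y k"
        using T(1) by (auto simp: KX_def indicator_def)
      then show "KX T' i j x y k * u j y = KX T' i j x y k * vX T' j y k - KX T i j x y k * vX T j y k
          - KX (T' - T) i j x y k * vX T j y k"
        by (simp add: u_def algebra_simps)
    qed
    have "u i x = (LINT y|lebesgue. (\<Sum>j\<in>UNIV. KX T' i j x y k * u j y))
        + (LINT y|lebesgue. (\<Sum>j\<in>UNIV. KX (T' - T) i j x y k * vX T j y k))"
    proof -
      have "(LINT y|lebesgue. (\<Sum>j\<in>UNIV. KX T' i j x y k * u j y)) =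
        (LINT y|lebesgue. (\<Sum>j\<in>UNIV. KX T' i j x y k * vX T' j y k))
        - (LINT y|lebesgue. (\<Sum>j\<in>UNIV. KX T i j x y k * vX T j y k))
        - (LINT y|lebesgue. (\<Sum>j\<in>UNIV. KX (T' - T) i j x y k * vX T j y k))"
        unfolding split Bochner_Integration.integral_diff[OF Bochner_Integration.integrable_diff[OF eA(1) eB(1)] EI(1)]
          Bochner_Integration.integral_diff[OF eA(1) eB(1)] ..
      moreover have "u i x = vX T' i x k - vX T i x k" by (simp add: u_def)
      ultimately show ?thesis using eA(2) eB(2) by simp
    qed
    then have "cmod (u i x) \<le> cmod (LINT y|lebesgue. (\<Sum>j\<in>UNIV. KX T' i j x y k * u j y))
        + cmod (LINT y|lebesgue. (\<Sum>j\<in>UNIV. KX (T' - T) i j x y k * vX T j y k))"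
      by (simp only: norm_triangle_ineq)
    moreover have "cmod (LINT y|lebesgue. (\<Sum>j\<in>UNIV. KX (T' - T) i j x y k * vX T j y k)) \<le> \<beta> x"
      using EI(2) by (simp add: \<beta>_def h_def)
    ultimately show "cmod (u i x) \<le> \<beta> x + cmod (LINT y|lebesgue. (\<Sum>j\<in>UNIV. KX T' i j x y k * u j y))"
      by linarith
  qed (use x in auto)
  also have "\<dots> \<le> real CARD(2) * \<beta> x * exp (4 * (Ccoef 1 \<epsilon> * W0))"
    using Gtot_X[OF T'] h0[of x] C V0 by (intro mult_left_mono) (auto simp: \<beta>_def)
  also have "\<dots> = Cdiff \<epsilon> * h x" by (simp add: Cdiff_def \<beta>_def V_def)
  finally show ?thesis by (simp add: u_def h_def)
qed

text \<open>The dyadic truncations, and the strips on which they are admissible.\<close>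
definition Tm :: "nat \<Rightarrow> real set" where "Tm m = {..2 ^ m - 1}"

definition Sm :: "nat \<Rightarrow> real \<Rightarrow> complex set" where "Sm m \<epsilon> = {k. \<epsilon> < cmod k \<and> Im k * 2 ^ m < 1}"

lemma Tm_sets: "Tm m \<in> sets lebesgue" by (simp add: Tm_def borel_imp_lebesgue_sets)

lemma Tm_Suc: "Tm m \<subseteq> Tm (Suc m)" by (auto simp: Tm_def)

lemma open_Sm: "open (Sm m \<epsilon>)"
  unfolding Sm_def by (intro open_Collect_conj open_Collect_less continuous_intros)

lemma admissible_Tm: "0 < \<epsilon> \<Longrightarrow> admissible \<epsilon> (Tm m) (Sm m \<epsilon>)"
  unfolding admissible_def
proof (intro conjI ballI impI Tm_sets)
  show "\<epsilon> \<le> cmod k" if "k \<in> Sm m \<epsilon>" for k using that by (simp add: Sm_def)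
  fix k y assume k: "k \<in> Sm m \<epsilon>" and y: "y \<in> Tm m" "0 \<le> y"
  show "Im k * y \<le> 1"
    by (rule mult_le_of_endpoint[of _ "2 ^ m"]) (use k y in \<open>auto simp: Sm_def Tm_def\<close>)
qed

lemma admissible_UNIV: "0 < \<epsilon> \<Longrightarrow> admissible \<epsilon> UNIV {k. Im k \<le> 0 \<and> \<epsilon> \<le> cmod k}"
  unfolding admissible_def
  by (auto intro: order_trans[OF mult_nonpos_nonneg])

text \<open>The difference of two consecutive truncations.\<close>
definition dX :: "nat \<Rightarrow> 2 \<Rightarrow> real \<Rightarrow> complex \<Rightarrow> complex" where
  "dX m i x k = vX (Tm (Suc m)) i x k - vX (Tm m) i x k"

text \<open>The \<open>j\<close>-th moment of the potential on the part of a dyadic shell beyond \<open>x\<close>.\<close>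
definition shell :: "nat \<Rightarrow> nat \<Rightarrow> real \<Rightarrow> real" where
  "shell j m x = (LINT y:{x<..}|lebesgue. indicator (Tm (Suc m) - Tm m) y * ((1 + y) ^ j * w0 y))"

lemma dX_holomorphic: "0 < \<epsilon> \<Longrightarrow> 0 \<le> x \<Longrightarrow> dX m i x holomorphic_on Sm (Suc m) \<epsilon>"
  unfolding dX_def[abs_def]
  by (intro holomorphic_on_diff vX_holomorphic[OF _ open_Sm, where \<epsilon> = \<epsilon>] admissible_Tm
      admissible_mono[OF admissible_Tm[of \<epsilon> "Suc m"] Tm_Suc Tm_sets order.refl])

lemma shell_int: "j \<le> n \<Longrightarrow> 0 \<le> x \<Longrightarrow>
    set_integrable lebesgue {x<..} (\<lambda>y. indicator (Tm (Suc m) - Tm m) y * ((1 + y) ^ j * w0 y))"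
  by (intro set_integrable_indicator_mult moment) (auto simp: Tm_sets borel_imp_lebesgue_sets)

text \<open>
  Cauchy's inequality on a disc of radius comparable to \<open>2 powr - m\<close>, which fits into the strip of the
  larger truncation. On the shell, \<open>2\<^sup>m < 1 + y\<close>, so the loss is absorbed by the weight.
\<close>
lemma dX_deriv_bound:
  assumes \<epsilon>: "0 < \<epsilon>" "\<epsilon> \<le> 1" and k: "2 * \<epsilon> \<le> cmod k" "Im k \<le> 0" and x: "0 \<le> x" and j: "j \<le> n"
  shows "cmod ((deriv ^^ j) (dX m i x) k) \<le> fact j * Cdiff \<epsilon> * (4 / \<epsilon>) ^ j * shell j m x"
proof -
  \<comment> \<open>Small enough for \<open>|z| > \<epsilon>\<close> and for \<open>Im z 2\<^sup>m\<^sup>+\<^sup>1 < 1\<close> on the disc.\<close>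
  define r where "r = \<epsilon> / 2 ^ (m + 2)"
  have r0: "0 < r" using \<epsilon> by (simp add: r_def)
  have r\<epsilon>: "r < \<epsilon>"
  proof -
    have "(1::real) < 2 ^ (m + 2)" by (rule one_less_power) auto
    then show ?thesis using \<epsilon>(1) by (simp add: r_def divide_less_eq)
  qed
  have r2: "r * 2 ^ Suc m < 1" using \<epsilon> by (simp add: r_def)
  have sub: "cball k r \<subseteq> Sm (Suc m) \<epsilon>"
  proof
    fix z assume "z \<in> cball k r"
    then have d: "cmod (z - k) \<le> r" by (simp add: dist_norm norm_minus_commute)
    have "cmod k \<le> cmod z + cmod (z - k)"
      using norm_triangle_ineq4[of z "z - k"] by simp
    then have "\<epsilon> < cmod z" using d r\<epsilon> k by linarith
    moreover have "Im z \<le> r" using abs_Im_le_cmod[of "z - k"] d k by auto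
    then have "Im z * 2 ^ Suc m \<le> r * 2 ^ Suc m" by (intro mult_right_mono) auto
    then have "Im z * 2 ^ Suc m < 1" using r2 by linarith
    ultimately show "z \<in> Sm (Suc m) \<epsilon>" by (simp add: Sm_def)
  qed
  define B where "B = Cdiff \<epsilon> * shell 0 m x"
  have bound: "cmod (dX m i x z) \<le> B" if "z \<in> Sm (Suc m) \<epsilon>" for z
    using vX_diff[OF admissible_Tm[OF \<epsilon>(1)] Tm_Suc Tm_sets that x, of i] by (simp add: dX_def B_def shell_def)
  have "cmod ((deriv ^^ j) (dX m i x) k) \<le> fact j * B / r ^ j"
  proof (rule Cauchy_inequality[OF _ _ r0])
    have hol: "dX m i x holomorphic_on cball k r"
      by (rule holomorphic_on_subset[OF dX_holomorphic[OF \<epsilon>(1) x] sub])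
    show "dX m i x holomorphic_on ball k r" by (rule holomorphic_on_subset[OF hol ball_subset_cball])
    show "continuous_on (cball k r) (dX m i x)" by (rule holomorphic_on_imp_continuous_on[OF hol])
    show "cmod (dX m i x z) \<le> B" if "cmod (k - z) = r" for z
      by (rule bound[OF subsetD[OF sub]]) (simp add: dist_norm that)
  qed
  also have "\<dots> = fact j * Cdiff \<epsilon> * (4 / \<epsilon>) ^ j * ((2 ^ m) ^ j * shell 0 m x)"
    using \<epsilon> by (simp add: B_def r_def power_add power_divide power_mult_distrib field_simps)
  also have "\<dots> \<le> fact j * Cdiff \<epsilon> * (4 / \<epsilon>) ^ j * shell j m x"
  proof (rule mult_left_mono)
    have "(2 ^ m) ^ j * shell 0 m x
        = (LINT y:{x<..}|lebesgue. (2 ^ m) ^ j * (indicator (Tm (Suc m) - Tm m) y * ((1 + y) ^ 0 * w0 y)))"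
      unfolding shell_def by (simp only: set_integral_mult_right)
    also have "\<dots> \<le> shell j m x"
      unfolding shell_def
    proof (rule set_integral_mono_nonneg)
      show "set_integrable lebesgue {x<..} (\<lambda>y. (2 ^ m) ^ j * (indicator (Tm (Suc m) - Tm m) y * ((1 + y) ^ 0 * w0 y)))"
        by (intro set_integrable_mult_right shell_int x) simp
      show "set_integrable lebesgue {x<..} (\<lambda>y. indicator (Tm (Suc m) - Tm m) y * ((1 + y) ^ j * w0 y))"
        by (rule shell_int[OF j x])
      fix y assume y: "y \<in> {x<..}"
      show "(2 ^ m) ^ j * (indicator (Tm (Suc m) - Tm m) y * ((1 + y) ^ 0 * w0 y))
          \<le> indicator (Tm (Suc m) - Tm m) y * ((1 + y) ^ j * w0 y)"
      proof (cases "y \<in> Tm (Suc m) - Tm m")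
        case True
        then have "(2 ^ m) ^ j \<le> (1 + y) ^ j" by (intro power_mono) (auto simp: Tm_def)
        then show ?thesis using True w0_nonneg[of y] by (simp add: mult_right_mono)
      qed simp
      show "0 \<le> indicator (Tm (Suc m) - Tm m) y * ((1 + y) ^ j * w0 y)"
        using y x w0_nonneg[of y] by (intro mult_nonneg_nonneg) auto
    qed simp
    finally show "(2 ^ m) ^ j * shell 0 m x \<le> shell j m x" .
    show "0 \<le> fact j * Cdiff \<epsilon> * (4 / \<epsilon>) ^ j"
      using \<epsilon> Ccoef_pos[OF \<epsilon>(1), of 1] by (simp add: Cdiff_def Vbound_def)
  qed
  finally show ?thesis .
qed

lemma shell_nonneg: "0 \<le> x \<Longrightarrow> 0 \<le> shell j m x"
  unfolding shell_def by (intro set_integral_nonneg' mult_nonneg_nonneg w0_nonneg) auto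

text \<open>The \<open>j\<close>-th moment of the potential beyond \<open>x\<close>.\<close>
definition tail :: "nat \<Rightarrow> real \<Rightarrow> real" where
  "tail j x = (LINT y:{x<..}|lebesgue. (1 + y) ^ j * w0 y)"

lemma shell_sum:
  assumes j: "j \<le> n" and x: "0 \<le> x"
  shows "(\<Sum>m<M. shell j m x) \<le> tail j x"
proof -
  have ind: "(\<Sum>m<M. indicator (Tm (Suc m) - Tm m) y) = (indicator (Tm M - Tm 0) y :: real)" for y
  proof (induction M)
    case (Suc M)
    have "Tm 0 \<subseteq> Tm M" by (auto simp: Tm_def intro: order_trans)
    then show ?case using Suc Tm_Suc[of M] by (auto simp: indicator_def)
  qed simp
  have "(\<Sum>m<M. shell j m x) =
      (LINT y:{x<..}|lebesgue. (\<Sum>m<M. indicator (Tm (Suc m) - Tm m) y * ((1 + y) ^ j * w0 y)))"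
    unfolding shell_def
    by (rule set_integral_sum(2)[symmetric]) (rule shell_int[OF j x])
  also have "\<dots> = (LINT y:{x<..}|lebesgue. indicator (Tm M - Tm 0) y * ((1 + y) ^ j * w0 y))"
    unfolding ind[symmetric] by (simp add: sum_distrib_right)
  also have "\<dots> \<le> tail j x"
    unfolding tail_def using x w0_nonneg j
    by (intro set_integral_mono_nonneg set_integrable_indicator_mult moment)
      (auto simp: Tm_sets borel_imp_lebesgue_sets indicator_def)
  finally show ?thesis .
qed

lemma shell_summable: "j \<le> n \<Longrightarrow> 0 \<le> x \<Longrightarrow> summable (\<lambda>m. shell j m x)"
  by (rule summableI_nonneg_bounded[OF shell_nonneg shell_sum])

lemma tail_bound:
  assumes j: "j \<le> n" and x: "0 \<le> x"
  shows "tail j x \<le> tail n 0 / (1 + x) ^ (n - j)"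
proof -
  have "(1 + x) ^ (n - j) * tail j x = (LINT y:{x<..}|lebesgue. (1 + x) ^ (n - j) * ((1 + y) ^ j * w0 y))"
    unfolding tail_def by (simp only: set_integral_mult_right)
  also have "\<dots> \<le> tail n 0"
    unfolding tail_def
  proof (rule set_integral_mono_nonneg)
    show "set_integrable lebesgue {x<..} (\<lambda>y. (1 + x) ^ (n - j) * ((1 + y) ^ j * w0 y))"
      using x j by (intro set_integrable_mult_right moment) (auto simp: borel_imp_lebesgue_sets)
    show "set_integrable lebesgue {0<..} (\<lambda>y. (1 + y) ^ n * w0 y)"
      by (intro moment) (auto simp: borel_imp_lebesgue_sets)
    fix y assume y: "y \<in> {x<..}"
    have "(1 + x) ^ (n - j) * (1 + y) ^ j \<le> (1 + y) ^ (n - j) * (1 + y) ^ j"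
      using x y by (intro mult_right_mono power_mono) auto
    also have "\<dots> = (1 + y) ^ n" using j by (simp flip: power_add)
    finally show "(1 + x) ^ (n - j) * ((1 + y) ^ j * w0 y) \<le> (1 + y) ^ n * w0 y"
      using w0_nonneg[of y] by (simp flip: mult.assoc add: mult_right_mono)
  qed (use x w0_nonneg in auto)
  finally have "(1 + x) ^ (n - j) * tail j x \<le> tail n 0" .
  moreover have "0 < (1 + x) ^ (n - j)" using x by simp
  ultimately show ?thesis by (simp add: pos_le_divide_eq mult.commute)
qed

text \<open>The truncation to \<open>y \<le> 0\<close> removes the potential from the half-line.\<close>
lemma vX_Tm_0:
  assumes "0 \<le> x" "k \<noteq> 0" "Im k \<le> 0"
  shows "vX (Tm 0) i x k = e1 i"
proof -
  have adm: "admissible (cmod k) (Tm 0) {k}"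
    using assms Tm_sets[of 0] by (auto simp: admissible_def Tm_def)
  have "KX (Tm 0) i j x y k = 0" for j y
    using assms by (auto simp: KX_def Tm_def indicator_def)
  then show ?thesis
    using volterra_system.sol_equation(2)[OF system_X[OF adm], of x k i] assms by simp
qed

lemma dX_sums:
  assumes x: "0 \<le> x" and k: "k \<noteq> 0" "Im k \<le> 0"
  shows "(\<lambda>m. dX m i x k) sums (vX UNIV i x k - e1 i)"
proof -
  define \<epsilon> where "\<epsilon> = cmod k"
  have \<epsilon>: "0 < \<epsilon>" using k by (simp add: \<epsilon>_def)
  have adm: "admissible \<epsilon> UNIV {k. Im k \<le> 0 \<and> \<epsilon> \<le> cmod k}" by (rule admissible_UNIV[OF \<epsilon>])
  have partial: "(\<Sum>m<M. dX m i x k) = vX (Tm M) i x k - e1 i" for M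
    using vX_Tm_0[OF x k, of i] by (induction M) (auto simp: dX_def)
  have "(\<lambda>M. vX UNIV i x k - vX (Tm M) i x k) \<longlonglongrightarrow> 0"
  proof (rule Lim_null_comparison)
    show "\<forall>\<^sub>F M in sequentially. cmod (vX UNIV i x k - vX (Tm M) i x k)
        \<le> Cdiff \<epsilon> * (LINT y:{x<..}|lebesgue. indicator (UNIV - Tm M) y * w0 y)"
      using vX_diff[OF adm subset_UNIV Tm_sets _ x, of k i] k by (auto simp: \<epsilon>_def)
    have "(\<lambda>M. LINT y|lebesgue. indicator {x<..} y *\<^sub>R (indicator (UNIV - Tm M) y * w0 y)) \<longlonglongrightarrow> (LINT y|(lebesgue::real measure). 0)"
    proof (rule integral_dominated_convergence)
      show "integrable lebesgue (\<lambda>y. indicator {x<..} y *\<^sub>R w0 y)"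
        using w0_int_right[OF x] by (simp add: set_integrable_def)
      show "(\<lambda>y. indicator {x<..} y *\<^sub>R (indicator (UNIV - Tm M) y * w0 y)) \<in> borel_measurable lebesgue" for M
        using set_integrable_indicator_mult[OF _ w0_int_right[OF x], of "UNIV - Tm M"] Tm_sets[of M]
        by (simp add: set_integrable_def)
      show "AE y in lebesgue. (\<lambda>M. indicator {x<..} y *\<^sub>R (indicator (UNIV - Tm M) y * w0 y)) \<longlonglongrightarrow> 0"
      proof (rule AE_I2)
        fix y :: real
        obtain M where M: "y + 1 \<le> 2 ^ M" using real_arch_pow[of 2 "y + 1"] by (auto intro: less_imp_le)
        have "y \<in> Tm M'" if "M \<le> M'" for M'
        proof -
          have "(2::real) ^ M \<le> 2 ^ M'" using that by (intro power_increasing) auto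
          then show ?thesis using M unfolding Tm_def atMost_iff by linarith
        qed
        then have "\<forall>\<^sub>F M in sequentially. indicator {x<..} y *\<^sub>R (indicator (UNIV - Tm M) y * w0 y) = 0"
          by (auto simp: eventually_sequentially intro!: exI[of _ M])
        then show "(\<lambda>M. indicator {x<..} y *\<^sub>R (indicator (UNIV - Tm M) y * w0 y)) \<longlonglongrightarrow> 0"
          by (rule tendsto_eventually)
      qed
      show "AE y in lebesgue. norm (indicator {x<..} y *\<^sub>R (indicator (UNIV - Tm M) y * w0 y))
          \<le> indicator {x<..} y *\<^sub>R w0 y" for M
        using w0_nonneg by (intro AE_I2) (auto simp: indicator_def)
    qed simp
    then show "(\<lambda>M. Cdiff \<epsilon> * (LINT y:{x<..}|lebesgue. indicator (UNIV - Tm M) y * w0 y)) \<longlonglongrightarrow> 0"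
      unfolding set_lebesgue_integral_def by (intro tendsto_mult_right_zero) simp
  qed
  from tendsto_diff[OF tendsto_const[of "vX UNIV i x k - e1 i"] this]
  show ?thesis by (simp add: sums_def partial)
qed

text \<open>
  The \<open>j\<close>-th derivative of the first column of \<open>X - I\<close>, as a function on the closed half-plane
  without \<open>0\<close>: the series of the derivatives of the differences, each of which is holomorphic
  across the real axis.
\<close>
definition GX :: "nat \<Rightarrow> 2 \<Rightarrow> real \<Rightarrow> complex \<Rightarrow> complex" where
  "GX j i x k = (\<Sum>m. (deriv ^^ j) (dX m i x) k)"

lemma GX_0: "0 \<le> x \<Longrightarrow> k \<noteq> 0 \<Longrightarrow> Im k \<le> 0 \<Longrightarrow> GX 0 i x k = vX UNIV i x k - e1 i"
  using sums_unique[OF dX_sums[of x k i]] by (simp add: GX_def)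

lemma GX_uniform:
  assumes "0 < \<epsilon>" "\<epsilon> \<le> 1" "0 \<le> x" "j \<le> n"
  shows "uniform_limit {k. 2 * \<epsilon> \<le> cmod k \<and> Im k \<le> 0}
    (\<lambda>M k. \<Sum>m<M. (deriv ^^ j) (dX m i x) k) (GX j i x) sequentially"
  unfolding GX_def[abs_def]
  by (rule Weierstrass_m_test[OF dX_deriv_bound summable_mult[OF shell_summable]]) (use assms in auto)

lemma GX_bound:
  assumes "0 \<le> x" "j \<le> n" "1 \<le> cmod k" "Im k \<le> 0"
  shows "cmod (GX j i x k) \<le> fact j * Cdiff (1/2) * 8 ^ j * tail n 0 / (1 + x) ^ (n - j)"
proof -
  let ?C = "fact j * Cdiff (1/2) * 8 ^ j"
  have C0: "0 \<le> ?C" using Ccoef_pos[of "1/2" 1] by (simp add: Cdiff_def Vbound_def)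
  have le: "cmod ((deriv ^^ j) (dX m i x) k) \<le> ?C * shell j m x" for m
    using dX_deriv_bound[of "1/2" k x j m i] assms by simp
  have "cmod (GX j i x k) \<le> (\<Sum>m. ?C * shell j m x)"
    unfolding GX_def
    by (rule norm_suminf_le[OF le summable_mult[OF shell_summable[OF assms(2,1)]]])
  also have "\<dots> = ?C * (\<Sum>m. shell j m x)"
    by (rule suminf_mult[OF shell_summable[OF assms(2,1)]])
  also have "\<dots> \<le> ?C * tail j x"
    using C0 suminf_le_const[OF shell_summable[OF assms(2,1)] shell_sum[OF assms(2,1)]]
    by (rule mult_left_mono[rotated])
  also have "\<dots> \<le> ?C * (tail n 0 / (1 + x) ^ (n - j))"
    using C0 tail_bound[OF assms(2,1)] by (rule mult_left_mono[rotated])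
  finally show ?thesis by simp
qed

lemma lower_half_local:
  assumes "k \<noteq> 0" "Im k \<le> 0"
  obtains \<epsilon> where "0 < \<epsilon>" "\<epsilon> \<le> 1" "2 * \<epsilon> < cmod k"
proof
  show "0 < min 1 (cmod k / 4)" "min 1 (cmod k / 4) \<le> 1" "2 * min 1 (cmod k / 4) < cmod k"
    using assms by (auto simp: min_def)
qed

lemma dX_deriv_continuous:
  assumes "0 < \<epsilon>" "0 \<le> x"
  shows "continuous_on {k. 2 * \<epsilon> \<le> cmod k \<and> Im k \<le> 0} ((deriv ^^ j) (dX m i x))"
proof (rule continuous_on_subset[OF holomorphic_on_imp_continuous_on])
  show "(deriv ^^ j) (dX m i x) holomorphic_on Sm (Suc m) \<epsilon>"
    by (rule holomorphic_higher_deriv[OF dX_holomorphic[OF assms] open_Sm])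
  show "{k. 2 * \<epsilon> \<le> cmod k \<and> Im k \<le> 0} \<subseteq> Sm (Suc m) \<epsilon>"
    using assms(1) by (auto simp: Sm_def intro: le_less_trans[OF mult_nonpos_nonneg])
qed

lemma GX_continuous:
  assumes x: "0 \<le> x" and j: "j \<le> n"
  shows "continuous_on {k. k \<noteq> 0 \<and> Im k \<le> 0} (GX j i x)"
  unfolding continuous_on_def
proof
  fix k assume k: "k \<in> {k. k \<noteq> 0 \<and> Im k \<le> 0}"
  then obtain \<epsilon> where \<epsilon>: "0 < \<epsilon>" "\<epsilon> \<le> 1" "2 * \<epsilon> < cmod k" using lower_half_local by blast
  let ?A = "{k. 2 * \<epsilon> \<le> cmod k \<and> Im k \<le> 0}"
  have "continuous_on ?A (GX j i x)"
    by (rule uniform_limit_theorem[OF always_eventually GX_uniform[OF \<epsilon>(1,2) x j]])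
      (auto intro!: continuous_on_sum dX_deriv_continuous \<epsilon> x)
  then have "(GX j i x \<longlongrightarrow> GX j i x k) (at k within ?A)"
    using k \<epsilon> by (auto simp: continuous_on_def)
  moreover have "at k within ?A = at k within {k. k \<noteq> 0 \<and> Im k \<le> 0}"
  proof (rule at_within_nhd[of _ "{k. 2 * \<epsilon> < cmod k}"])
    show "open {k::complex. 2 * \<epsilon> < cmod k}" by (intro open_Collect_less continuous_intros)
  qed (use \<epsilon> in auto)
  ultimately show "(GX j i x \<longlongrightarrow> GX j i x k) (at k within {k. k \<noteq> 0 \<and> Im k \<le> 0})" by simp
qed

lemma GX_deriv:
  assumes x: "0 \<le> x" and j: "j \<le> n" and k: "Im k < 0"
  shows "(deriv ^^ j) (\<lambda>k. vX UNIV i x k - e1 i) k = GX j i x k"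
    and "(\<lambda>k. vX UNIV i x k - e1 i) holomorphic_on {k. Im k < 0}"
proof -
  have lim: "(deriv ^^ j) (\<lambda>k. vX UNIV i x k - e1 i) k = GX j i x k \<and>
     (\<lambda>k. vX UNIV i x k - e1 i) field_differentiable (at k)" if k: "Im k < 0" for k
  proof -
    have "k \<noteq> 0" using k by auto
    then obtain \<epsilon> where \<epsilon>: "0 < \<epsilon>" "\<epsilon> \<le> 1" "2 * \<epsilon> < cmod k" using lower_half_local k by (metis less_imp_le)
    let ?A = "{k. 2 * \<epsilon> < cmod k \<and> Im k < 0}"
    have A: "open ?A" "k \<in> ?A"
      using \<epsilon> k by (auto intro!: open_Collect_conj open_Collect_less continuous_intros)
    have dhol: "dX m i x holomorphic_on ?A" for m
      by (rule holomorphic_on_subset[OF dX_holomorphic[OF \<epsilon>(1) x]])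
        (use \<epsilon> in \<open>auto simp: Sm_def intro: less_trans[OF mult_neg_pos]\<close>)
    have "uniform_limit ?A (\<lambda>M k. \<Sum>m<M. (deriv ^^ 0) (dX m i x) k) (GX 0 i x) sequentially"
      by (rule uniform_limit_on_subset[OF GX_uniform[OF \<epsilon>(1,2) x]]) (use \<epsilon> in auto)
    moreover have "GX 0 i x k' = vX UNIV i x k' - e1 i" if "k' \<in> ?A" for k'
      by (rule GX_0[OF x]) (use that \<epsilon> in auto)
    ultimately have u: "uniform_limit ?A (\<lambda>M k. \<Sum>m<M. dX m i x k) (\<lambda>k. vX UNIV i x k - e1 i) sequentially"
      by (subst uniform_limit_cong'[symmetric, where f = "\<lambda>M k. \<Sum>m<M. (deriv ^^ 0) (dX m i x) k" and h = "GX 0 i x"]) auto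
    have phol: "(\<lambda>k. \<Sum>m<M. dX m i x k) holomorphic_on ?A" for M
      by (intro holomorphic_intros dhol)
    have "(\<lambda>M. (deriv ^^ j) (\<lambda>k. \<Sum>m<M. dX m i x k) k) \<longlonglongrightarrow> (deriv ^^ j) (\<lambda>k. vX UNIV i x k - e1 i) k"
      by (rule higher_deriv_complex_uniform_limit[OF u always_eventually _ A]) (use phol in auto)
    moreover have "(\<lambda>M. (deriv ^^ j) (\<lambda>k. \<Sum>m<M. dX m i x k) k) \<longlonglongrightarrow> GX j i x k"
      unfolding higher_deriv_sum_lessThan[OF A dhol]
      by (rule tendsto_uniform_limitI[OF GX_uniform[OF \<epsilon>(1,2) x j]]) (use \<epsilon> k in auto)
    ultimately have "(deriv ^^ j) (\<lambda>k. vX UNIV i x k - e1 i) k = GX j i x k" by (rule LIMSEQ_unique)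
    moreover have "(\<lambda>k. vX UNIV i x k - e1 i) holomorphic_on ?A"
    proof (rule holomorphic_uniform_sequence[OF A(1) phol])
      fix z assume "z \<in> ?A"
      then obtain d where "0 < d" "cball z d \<subseteq> ?A" using A(1) by (meson open_contains_cball)
      then show "\<exists>d>0. cball z d \<subseteq> ?A \<and> uniform_limit (cball z d) (\<lambda>M k. \<Sum>m<M. dX m i x k)
          (\<lambda>k. vX UNIV i x k - e1 i) sequentially"
        using uniform_limit_on_subset[OF u] by blast
    qed
    ultimately show ?thesis using A holomorphic_on_imp_differentiable_at by blast
  qed
  show "(deriv ^^ j) (\<lambda>k. vX UNIV i x k - e1 i) k = GX j i x k" using lim[OF k] by simp
  show "(\<lambda>k. vX UNIV i x k - e1 i) holomorphic_on {k. Im k < 0}"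
    unfolding holomorphic_on_def using lim by (auto intro: field_differentiable_at_within)
qed

end

section \<open>Estimates for the solution normalized at the origin\<close>

lemma theta1_minus: "theta1 (- k) = - theta1 k"
  by (cases "k = 0") (simp_all add: theta1_def field_simps)

lemma theta1_cnj: "theta1 (cnj k) = cnj (theta1 k)"
  by (simp add: theta1_def)

lemma osc_minus: "osc i t (- k) = osc i (- t) k"
  by (simp add: osc_def theta1_minus)

lemma osc_cnj: "osc i t (- cnj k) = cnj (osc i t k)"
  by (simp add: osc_def theta1_minus theta1_cnj exp_cnj)

lemma osc_add: "osc i s k * osc i t k = osc i (s + t) k"
  by (simp add: osc_def algebra_simps flip: exp_add)

lemma osc_0 [simp]: "osc i 0 k = 1"
  by (simp add: osc_def)

lemma osc_inverse: "osc i (- t) k * osc i t k = 1" "osc i t k * osc i (- t) k = 1"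
  by (simp_all add: osc_add)

lemma osc_nonzero: "osc i t k \<noteq> 0"
  by (simp add: osc_def)

lemma osc_e1: "osc i t k * e1 i = e1 i"
  by (simp add: osc_def e1_def)

lemma neumann_cnj:
  assumes "\<And>i j x y. K i j x y (- cnj k) = cnj (K i j x y k)" "\<And>i. cnj (c i) = c i"
  shows "neumann K c m i x (- cnj k) = cnj (neumann K c m i x k)"
proof (induction m arbitrary: i x)
  case (Suc m)
  have "neumann K c (Suc m) i x (- cnj k)
      = (LINT y|lebesgue. cnj (\<Sum>j\<in>UNIV. K i j x y k * neumann K c m j y k))"
    by (simp add: assms(1) Suc)
  also have "\<dots> = cnj (LINT y|lebesgue. (\<Sum>j\<in>UNIV. K i j x y k * neumann K c m j y k))"
    by (rule Bochner_Integration.integral_cnj)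
  finally show ?case by simp
qed (simp add: assms(2))

text \<open>
  A disc of radius \<open>1 / (2 (1 + x))\<close> costs a factor \<open>(1 + x)\<^sup>j\<close> in Cauchy's inequality, and on it the
  oscillatory factors over an interval of length \<open>x\<close> stay bounded, by \<open>Im_disc\<close>.
\<close>
lemma deriv_bound_from_disc:
  assumes x: "0 \<le> x" and k: "1 \<le> cmod k" and f: "f holomorphic_on - {0}"
    and bd: "\<And>z. 1 / 2 \<le> cmod z \<Longrightarrow> cmod (z - k) \<le> 1 / (2 * (1 + x)) \<Longrightarrow> cmod (f z) \<le> B"
  shows "cmod ((deriv ^^ j) f k) \<le> fact j * B * 2 ^ j * (1 + x) ^ j"
proof -
  define r where "r = 1 / (2 * (1 + x))"
  have r: "0 < r" "r \<le> 1 / 2" using x by (auto simp: r_def field_simps)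
  have half: "1 / 2 \<le> cmod z" if "cmod (z - k) \<le> r" for z
    using norm_triangle_ineq4[of z "z - k"] that r k by simp
  have sub: "cball k r \<subseteq> - {0}"
  proof
    fix z assume "z \<in> cball k r"
    then have "1 / 2 \<le> cmod z" by (intro half) (simp add: dist_norm norm_minus_commute)
    then show "z \<in> - {0}" by auto
  qed
  have "cmod ((deriv ^^ j) f k) \<le> fact j * B / r ^ j"
  proof (rule Cauchy_inequality[OF _ _ r(1)])
    have hol: "f holomorphic_on cball k r" by (rule holomorphic_on_subset[OF f sub])
    show "f holomorphic_on ball k r" by (rule holomorphic_on_subset[OF hol ball_subset_cball])
    show "continuous_on (cball k r) f" by (rule holomorphic_on_imp_continuous_on[OF hol])
    show "cmod (f z) \<le> B" if "cmod (k - z) = r" for z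
      using half[of z] bd[of z] that by (simp add: norm_minus_commute r_def)
  qed
  also have "\<dots> = fact j * B * 2 ^ j * (1 + x) ^ j"
    unfolding r_def power_divide power_mult_distrib by simp
  finally show ?thesis .
qed

lemma Im_disc:
  assumes "0 \<le> x" "cmod (z - k) \<le> 1 / (2 * (1 + x))"
  shows "0 \<le> Im k \<Longrightarrow> - Im z * x \<le> 1" "Im k \<le> 0 \<Longrightarrow> Im z * x \<le> 1"
proof -
  have le: "\<bar>Im z - Im k\<bar> \<le> 1 / (2 * (1 + x))" using abs_Im_le_cmod[of "z - k"] assms(2) by simp
  have x1: "1 / (2 * (1 + x)) * x \<le> 1" using assms(1) by (simp add: field_simps)
  show "- Im z * x \<le> 1" if "0 \<le> Im k"
    using mult_right_mono[of "- Im z" "1 / (2 * (1 + x))" x] le that x1 assms(1) by linarith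
  show "Im z * x \<le> 1" if "Im k \<le> 0"
    using mult_right_mono[of "Im z" "1 / (2 * (1 + x))" x] le that x1 assms(1) by linarith
qed

context lax_potential
begin

lemma vX_cnj:
  assumes "0 \<le> x" "k \<noteq> 0" "Im k \<le> 0"
  shows "vX UNIV i x (- cnj k) = cnj (vX UNIV i x k)"
proof -
  have adm: "admissible (cmod k) UNIV {k'. Im k' \<le> 0 \<and> cmod k \<le> cmod k'}"
    using admissible_UNIV[of "cmod k"] assms by auto
  have sums: "(\<lambda>m. neumann (KX UNIV) e1 m i x k') sums vX UNIV i x k'" if "Im k' \<le> 0" "cmod k \<le> cmod k'" for k'
    by (rule volterra_system.sol_sums[OF system_X[OF adm]]) (use that assms in auto)
  have "neumann (KX UNIV) e1 m i x (- cnj k) = cnj (neumann (KX UNIV) e1 m i x k)" for m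
    by (rule neumann_cnj) (simp_all add: KX_def osc_cnj P_cnj e1_def)
  then have "(\<lambda>m. cnj (neumann (KX UNIV) e1 m i x k)) sums vX UNIV i x (- cnj k)"
    using sums[of "- cnj k"] assms by simp
  moreover have "(\<lambda>m. cnj (neumann (KX UNIV) e1 m i x k)) sums cnj (vX UNIV i x k)"
    using sums[of k] assms by (simp add: sums_cnj)
  ultimately show ?thesis by (rule sums_unique2)
qed

text \<open>The equation on a bounded interval, at an arbitrary \<open>k \<noteq> 0\<close>.\<close>
lemma system_Y_at:
  assumes "k \<noteq> 0"
  shows "volterra_system {0..R} (\<lambda>x. {0..<x}) KY e1 {k} (\<lambda>y. Ccoef \<bar>Im k * R\<bar> (cmod k) * w0 y) 1"
  using assms by (intro system_Y) auto

lemma vY_cnj: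
  assumes "0 \<le> x" "k \<noteq> 0"
  shows "vY i x (- cnj k) = cnj (vY i x k)"
proof -
  have sums: "(\<lambda>m. neumann KY e1 m i x k') sums vY i x k'" if "k' \<noteq> 0" for k'
    by (rule volterra_system.sol_sums[OF system_Y_at[OF that, of x]]) (use assms in auto)
  have "neumann KY e1 m i x (- cnj k) = cnj (neumann KY e1 m i x k)" for m
    by (rule neumann_cnj) (simp_all add: KY_def osc_cnj P_cnj e1_def)
  then have "(\<lambda>m. cnj (neumann KY e1 m i x k)) sums vY i x (- cnj k)"
    using sums[of "- cnj k"] assms by simp
  moreover have "(\<lambda>m. cnj (neumann KY e1 m i x k)) sums cnj (vY i x k)"
    using sums[of k] assms by (simp add: sums_cnj)
  ultimately show ?thesis by (rule sums_unique2)
qed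

lemma w0_le_W0: "A \<in> sets lebesgue \<Longrightarrow> A \<subseteq> {0..} \<Longrightarrow> (LINT y:A|lebesgue. w0 y) \<le> W0"
  unfolding W0_def
  by (rule set_integral_mono_nonneg) (auto intro!: w0_int w0_nonneg simp: borel_imp_lebesgue_sets)

lemma vY_bound:
  assumes "0 \<le> x" "1 / 2 \<le> cmod k" "- Im k * x \<le> 1"
  shows "cmod (vY i x k) \<le> Vbound (1 / 2)"
proof -
  have sys: "volterra_system {0..x} (\<lambda>x. {0..<x}) KY e1 {k} (\<lambda>y. Ccoef 1 (1 / 2) * w0 y) 1"
    using assms by (intro system_Y) auto
  have "cmod (vY i x k) \<le> 1 * exp (real CARD(2) * volterra_system.Gtot {0..x} (\<lambda>y. Ccoef 1 (1 / 2) * w0 y))"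
    by (rule volterra_system.sol_bound[OF sys]) (use assms in auto)
  also have "\<dots> \<le> Vbound (1 / 2)"
    using w0_le_W0[of "{0..x}"] Ccoef_pos[of "1/2" 1]
    by (simp add: Vbound_def volterra_system.Gtot_def[OF sys] borel_imp_lebesgue_sets)
  finally show ?thesis .
qed

lemma vY_deriv_bound:
  assumes x: "0 \<le> x" and k: "1 \<le> cmod k" "0 \<le> Im k"
  shows "cmod ((deriv ^^ j) (\<lambda>k. vY i x k - e1 i) k) \<le> fact j * (Vbound (1 / 2) + 1) * 2 ^ j * (1 + x) ^ j"
proof (rule deriv_bound_from_disc[OF x k(1)])
  show "(\<lambda>k. vY i x k - e1 i) holomorphic_on - {0}"
    by (intro holomorphic_intros vY_holomorphic x)
  show "cmod (vY i x z - e1 i) \<le> Vbound (1 / 2) + 1"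
    if "1 / 2 \<le> cmod z" "cmod (z - k) \<le> 1 / (2 * (1 + x))" for z
  proof -
    have "cmod (vY i x z) \<le> Vbound (1 / 2)"
      by (rule vY_bound[OF x that(1) Im_disc(1)[OF x that(2) k(2)]])
    moreover have "cmod (e1 i) \<le> 1" by (simp add: e1_def)
    ultimately show ?thesis using norm_triangle_ineq4[of "vY i x z" "e1 i"] by linarith
  qed
qed

text \<open>
  The kernel of the equation for the first column of \<open>Y - I\<close> times \<open>exp (- 2 i \<theta>\<^sub>1 x)\<close>. The additional
  factor moves the oscillation from the second row to the first and makes the kernel bounded in
  the lower half-plane.
\<close>
definition KW :: "2 \<Rightarrow> 2 \<Rightarrow> real \<Rightarrow> real \<Rightarrow> complex \<Rightarrow> complex" where
  "KW i j x y k = osc 2 (x - y) k * KY i j x y k"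

lemma osc_2_mult_bound:
  assumes "Im k * s \<le> 1" "Im k * (s + t) \<le> 1" "1 / 2 \<le> cmod k"
  shows "cmod (osc 2 s k * osc i t k * P i' j y k) \<le> Ccoef 1 (1 / 2) * w0 y"
proof -
  define t' where "t' = (if i = 1 then s else s + t)"
  have eq: "osc 2 s k * osc i t k = osc 2 t' k"
  proof (cases "i = 1")
    case False
    then have "i = 2" using exhaust_2 by auto
    then show ?thesis by (simp add: osc_add t'_def)
  qed (simp add: t'_def osc_def)
  have "Im k * t' \<le> 1" using assms by (simp add: t'_def)
  then have "cmod (osc 2 t' k) \<le> exp (1 * (1 + 1 / (1 / 2) ^ 2) / 2)"
    by (intro osc_bound) (use assms in auto)
  moreover have "k \<noteq> 0" using assms by auto
  then have "cmod (P i' j y k) \<le> (1 + 1 / cmod k) * w0 y" by (rule P_bound)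
  moreover have "(1 + 1 / cmod k) * w0 y \<le> (1 + 1 / (1 / 2)) * w0 y"
    using assms(3) \<open>k \<noteq> 0\<close> by (intro mult_right_mono w0_nonneg add_left_mono divide_left_mono mult_pos_pos) auto
  ultimately have "cmod (osc 2 t' k) * cmod (P i' j y k)
      \<le> exp (1 * (1 + 1 / (1 / 2) ^ 2) / 2) * ((1 + 1 / (1 / 2)) * w0 y)"
    by (intro mult_mono) auto
  then show ?thesis by (simp only: eq norm_mult Ccoef_def mult.assoc)
qed

lemma system_W:
  assumes "1 / 2 \<le> cmod k" "Im k * R \<le> 1"
  shows "volterra_system {0..R} (\<lambda>x. {0..<x}) KW e1 {k} (\<lambda>y. Ccoef 1 (1 / 2) * w0 y) 1"
proof -
  have k: "k \<noteq> 0" using assms by auto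
  interpret Y: volterra_system "{0..R}" "\<lambda>x. {0..<x}" KY e1 "{k}" "\<lambda>y. Ccoef \<bar>Im k * R\<bar> (cmod k) * w0 y" 1
    by (rule system_Y_at[OF k])
  show ?thesis
  proof (intro volterra_system.intro segments_left volterra_system_axioms.intro)
    show "(\<lambda>p. KW i j (fst p) (snd p) k') \<in> borel_measurable (lebesgue \<Otimes>\<^sub>M lebesgue)" if "k' \<in> {k}" for i j k'
    proof -
      have [measurable]: "(\<lambda>p. osc 2 (fst p - snd p) k') \<in> borel_measurable (lebesgue \<Otimes>\<^sub>M lebesgue)"
        by (rule borel_pair_imp_lebesgue_pair) measurable
      show ?thesis unfolding KW_def using Y.K_meas[OF that] by (intro borel_measurable_times) auto
    qed
    show "KW i j x y k' = 0" if "x \<in> {0..R}" "y \<notin> {0..<x}" "k' \<in> {k}" for i j x y k'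
      using Y.K_zero[OF that] by (simp add: KW_def)
    show "cmod (KW i j x y k') \<le> Ccoef 1 (1 / 2) * w0 y"
      if "x \<in> {0..R}" "y \<in> {0..<x}" "k' \<in> {k}" for i j x y k'
    proof -
      have "Im k * (x - y) \<le> 1"
        by (rule mult_le_of_endpoint[of _ R]) (use assms that in auto)
      then have *: "cmod (osc 2 (x - y) k * osc i (y - x) k * P i j y k) \<le> Ccoef 1 (1 / 2) * w0 y"
        using assms by (intro osc_2_mult_bound) auto
      have "cmod (KW i j x y k) \<le> cmod (osc 2 (x - y) k * osc i (y - x) k * P i j y k)"
        by (auto simp: KW_def KY_def indicator_def mult.assoc)
      then show ?thesis using * that by simp
    qed
    show "set_integrable lebesgue {0..R} (\<lambda>y. Ccoef 1 (1 / 2) * w0 y)"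
      using w0_int[of "{0..R}"] by (simp add: borel_imp_lebesgue_sets)
    show "0 \<le> Ccoef 1 (1 / 2) * w0 y" for y
      using Ccoef_pos[of "1/2" 1] w0_nonneg[of y] by simp
  qed (auto simp: e1_def)
qed

text \<open>The bound of the first column of \<open>(Y - I) exp (- 2 i \<theta>\<^sub>1 x)\<close> for \<open>|k| \<ge> 1 / 2\<close> and \<open>Im k x \<le> 1\<close>.\<close>
definition Wbound :: real where
  "Wbound = 2 * (Ccoef 1 (1 / 2) * W0) * exp (4 * (Ccoef 1 (1 / 2) * W0))"

lemma vW_bound:
  assumes x: "0 \<le> x" and k: "1 / 2 \<le> cmod k" "Im k * x \<le> 1"
  shows "cmod ((vY i x k - e1 i) * osc 2 x k) \<le> Wbound"
proof -
  have k0: "k \<noteq> 0" using k by auto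
  interpret Y: volterra_system "{0..x}" "\<lambda>x. {0..<x}" KY e1 "{k}" "\<lambda>y. Ccoef \<bar>Im k * x\<bar> (cmod k) * w0 y" 1
    by (rule system_Y_at[OF k0])
  interpret W: volterra_system "{0..x}" "\<lambda>x. {0..<x}" KW e1 "{k}" "\<lambda>y. Ccoef 1 (1 / 2) * w0 y" 1
    by (rule system_W[OF k])
  define C where "C = Ccoef 1 (1 / 2)"
  have C: "0 < C" by (simp add: C_def Ccoef_pos)
  define u where "u = (\<lambda>i x. (vY i x k - e1 i) * osc 2 x k)"
  define V where "V = 1 * exp (real CARD(2) * Y.Gtot)"
  have Imk: "Im k * y \<le> 1" if "y \<in> {0..x}" for y
    by (rule mult_le_of_endpoint[of _ x]) (use k that in auto)
  have "cmod (u i x) \<le> real CARD(2) * (C * W0) * exp (real CARD(2) ^ 2 * W.Gtot)"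
  proof (rule W.system_gronwall[where u = u and \<beta> = "\<lambda>x. C * W0"
        and M = "(V + 1) * exp (1 * (1 + 1 / (1 / 2) ^ 2) / 2)" and k = k and x = x and i = i])
    show "set_borel_measurable lebesgue {0..x} (u j)" for j
    proof -
      have [measurable]: "(\<lambda>x. vY j x k) \<in> borel_measurable lebesgue" by (rule Y.sol_measurable) simp
      have [measurable]: "(\<lambda>x. osc 2 x k) \<in> borel_measurable lebesgue" by measurable
      have "u j \<in> borel_measurable lebesgue" unfolding u_def by measurable
      then show ?thesis unfolding set_borel_measurable_def by (intro borel_measurable_scaleR) auto
    qed
    show "cmod (u j y) \<le> (V + 1) * exp (1 * (1 + 1 / (1 / 2) ^ 2) / 2)" if "y \<in> {0..x}" for j y
    proof -
      have "cmod (vY j y k) \<le> V" unfolding V_def by (rule Y.sol_bound[OF that]) simp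
      moreover have "cmod (e1 j) \<le> 1" by (simp add: e1_def)
      ultimately have "cmod (vY j y k - e1 j) \<le> V + 1" using norm_triangle_ineq4[of "vY j y k" "e1 j"] by linarith
      moreover have "cmod (osc 2 y k) \<le> exp (1 * (1 + 1 / (1 / 2) ^ 2) / 2)"
        by (rule osc_bound[OF Imk[OF that]]) (use k in auto)
      ultimately show ?thesis unfolding u_def norm_mult
        using order_trans[OF norm_ge_zero \<open>cmod (vY j y k - e1 j) \<le> V + 1\<close>] by (intro mult_mono) auto
    qed
    show "0 \<le> C * W0" using C W0_nonneg by simp
    fix i x' assume x': "x' \<in> {0..x}"
    have eq: "integrable lebesgue (\<lambda>y. \<Sum>j\<in>UNIV. KY i j x' y k * vY j y k)"
      "vY i x' k = e1 i + (LINT y|lebesgue. (\<Sum>j\<in>UNIV. KY i j x' y k * vY j y k))"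
      by (rule Y.sol_equation[OF x'], simp)+
    \<comment> \<open>The source of the equation: the part of the integrand that comes from \<open>I\<close>.\<close>
    define f where "f = (\<lambda>y. osc 2 x' k * KY i 1 x' y k)"
    have f_le: "cmod (f y) \<le> indicator {0..<x'} y *\<^sub>R (C * w0 y)" for y
    proof (cases "y \<in> {0<..<x'}")
      case True
      then have "cmod (osc 2 x' k * osc i (y - x') k * P i 1 y k) \<le> C * w0 y"
        unfolding C_def using Imk[OF x'] Imk[of y] x' k by (intro osc_2_mult_bound) auto
      then show ?thesis using True by (simp add: f_def KY_def mult.assoc)
    next
      case False
      then show ?thesis using C w0_nonneg[of y] by (simp add: f_def KY_def)
    qed
    have Cw: "integrable lebesgue (\<lambda>y. indicator {0..<x'} y *\<^sub>R (C * w0 y))"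
    proof -
      have "set_integrable lebesgue {0..<x'} (\<lambda>y. C * w0 y)"
        by (intro set_integrable_mult_right w0_int) (auto simp: borel_imp_lebesgue_sets)
      then show ?thesis by (simp only: set_integrable_def)
    qed
    have f_meas: "f \<in> borel_measurable lebesgue"
      unfolding f_def using Y.K_meas_snd[of k i 1 x'] by (intro borel_measurable_times) auto
    note f_int = norm_integral_le[OF Cw f_meas f_le]
    have "cmod (LINT y|lebesgue. f y) \<le> C * (LINT y:{0..<x'}|lebesgue. w0 y)"
      using f_int(2) unfolding set_lebesgue_integral_def[symmetric] by simp
    also have "\<dots> \<le> C * W0"
      using C by (intro mult_left_mono w0_le_W0) (auto simp: borel_imp_lebesgue_sets)
    finally have f_bd: "cmod (LINT y|lebesgue. f y) \<le> C * W0" .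
    have split: "(\<Sum>j\<in>UNIV. KW i j x' y k * u j y) = osc 2 x' k * (\<Sum>j\<in>UNIV. KY i j x' y k * vY j y k) - f y" for y
    proof -
      have "osc 2 (x' - y) k * osc 2 y k = osc 2 x' k" by (simp add: osc_add)
      then have "KW i j x' y k * u j y = osc 2 x' k * (KY i j x' y k * (vY j y k - e1 j))" for j
        by (simp add: KW_def u_def mult_ac)
      then show ?thesis by (simp only: sum_2) (simp add: f_def e1_def algebra_simps)
    qed
    have "u i x' = osc 2 x' k * (LINT y|lebesgue. (\<Sum>j\<in>UNIV. KY i j x' y k * vY j y k))"
      using eq(2) by (simp add: u_def)
    also have "\<dots> = (LINT y|lebesgue. osc 2 x' k * (\<Sum>j\<in>UNIV. KY i j x' y k * vY j y k))"
      by (rule integral_mult_right_zero[symmetric])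
    also have "\<dots> = (LINT y|lebesgue. (\<Sum>j\<in>UNIV. KW i j x' y k * u j y)) + (LINT y|lebesgue. f y)"
      unfolding split
      by (subst Bochner_Integration.integral_diff[OF integrable_mult_right[OF eq(1)] f_int(1)]) simp
    finally show "cmod (u i x') \<le> C * W0 + cmod (LINT y|lebesgue. (\<Sum>j\<in>UNIV. KW i j x' y k * u j y))"
      using f_bd norm_triangle_ineq[of "LINT y|lebesgue. (\<Sum>j\<in>UNIV. KW i j x' y k * u j y)" "LINT y|lebesgue. f y"]
      by simp
  qed (use x in auto)
  also have "\<dots> \<le> real CARD(2) * (C * W0) * exp (real CARD(2) ^ 2 * (C * W0))"
  proof -
    have "W.Gtot \<le> C * W0"
      using w0_le_W0[of "{0..x}"] C by (simp add: W.Gtot_def C_def borel_imp_lebesgue_sets)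
    then show ?thesis using C W0_nonneg by (intro mult_left_mono) auto
  qed
  finally show ?thesis by (simp add: u_def Wbound_def C_def)
qed

lemma vW_deriv_bound:
  assumes x: "0 \<le> x" and k: "1 \<le> cmod k" "Im k \<le> 0"
  shows "cmod ((deriv ^^ j) (\<lambda>k. (vY i x k - e1 i) * osc 2 x k) k) \<le> fact j * Wbound * 2 ^ j * (1 + x) ^ j"
proof (rule deriv_bound_from_disc[OF x k(1)])
  show "(\<lambda>k. (vY i x k - e1 i) * osc 2 x k) holomorphic_on - {0}"
    by (intro holomorphic_intros vY_holomorphic osc_holomorphic x)
  show "cmod ((vY i x z - e1 i) * osc 2 x z) \<le> Wbound"
    if "1 / 2 \<le> cmod z" "cmod (z - k) \<le> 1 / (2 * (1 + x))" for z
    by (rule vW_bound[OF x that(1) Im_disc(2)[OF x that(2) k(2)]])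
qed

end

section \<open>Uniqueness and the differential equation\<close>

lemma set_integral_null_difference:
  fixes f :: "real \<Rightarrow> 'a::{banach,second_countable_topology}"
  assumes "finite F" "\<And>y. y \<notin> F \<Longrightarrow> y \<in> A \<longleftrightarrow> y \<in> B"
  shows "set_integrable lebesgue A f \<longleftrightarrow> set_integrable lebesgue B f"
    and "(LINT y:A|lebesgue. f y) = (LINT y:B|lebesgue. f y)"
proof -
  have eq: "indicator A y *\<^sub>R f y = indicator B y *\<^sub>R f y" if "y \<notin> F" for y
    using assms(2)[OF that] by (simp add: indicator_def)
  show "set_integrable lebesgue A f \<longleftrightarrow> set_integrable lebesgue B f"
    unfolding set_integrable_def
    by (rule integrable_discrete_difference[of F]) (use assms eq in \<open>auto simp: countable_finite\<close>)
  show "(LINT y:A|lebesgue. f y) = (LINT y:B|lebesgue. f y)"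
    unfolding set_lebesgue_integral_def
    by (rule integral_discrete_difference[of F]) (use assms eq in \<open>auto simp: countable_finite\<close>)
qed

lemma set_integral_family_measurable:
  fixes g :: "real \<Rightarrow> complex"
  assumes A: "(\<lambda>p. indicator (A (fst p)) (snd p) :: real) \<in> borel_measurable (lebesgue \<Otimes>\<^sub>M lebesgue)"
    and D: "D \<in> sets lebesgue" and sub: "\<And>x. x \<in> D \<Longrightarrow> A x \<subseteq> E" and g: "set_integrable lebesgue E g"
  shows "set_borel_measurable lebesgue D (\<lambda>x. LINT y:A x|lebesgue. g y)"
proof -
  define g' where "g' = (\<lambda>y. indicator E y *\<^sub>R g y)"
  have g': "g' \<in> borel_measurable lebesgue" using g by (auto simp: g'_def set_integrable_def)
  have "(\<lambda>p. indicator (A (fst p)) (snd p) *\<^sub>R g' (snd p)) \<in> borel_measurable (lebesgue \<Otimes>\<^sub>M lebesgue)"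
    using A measurable_compose[OF measurable_snd g'] by (rule borel_measurable_scaleR)
  then have "(\<lambda>x. LINT y|lebesgue. indicator (A x) y *\<^sub>R g' y) \<in> borel_measurable lebesgue"
    using sigma_finite_measure.borel_measurable_lebesgue_integral[OF sigma_finite_lebesgue,
        of "\<lambda>x y. indicator (A x) y *\<^sub>R g' y" lebesgue] by (simp add: case_prod_unfold)
  then have "(\<lambda>x. indicator D x *\<^sub>R (LINT y|lebesgue. indicator (A x) y *\<^sub>R g' y)) \<in> borel_measurable lebesgue"
    using D by (intro borel_measurable_scaleR) auto
  moreover have "indicator D x *\<^sub>R (LINT y|lebesgue. indicator (A x) y *\<^sub>R g' y)
      = indicator D x *\<^sub>R (LINT y:A x|lebesgue. g y)" for x
  proof (cases "x \<in> D")
    case True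
    have "indicator (A x) y *\<^sub>R g' y = indicator (A x) y *\<^sub>R g y" for y
      using sub[OF True] by (auto simp: g'_def indicator_def)
    then show ?thesis by (simp only: set_lebesgue_integral_def)
  qed simp
  ultimately show ?thesis by (simp only: set_borel_measurable_def)
qed

lemma norm_set_integral_le:
  fixes g :: "real \<Rightarrow> complex"
  assumes g: "set_integrable lebesgue B g" and A: "A \<subseteq> B" "A \<in> sets lebesgue"
  shows "cmod (LINT y:A|lebesgue. g y) \<le> (LINT y:B|lebesgue. cmod (g y))"
proof -
  have gA: "set_integrable lebesgue A g" by (rule set_integrable_subset[OF g A(2,1)])
  have "cmod (LINT y:A|lebesgue. g y) \<le> (LINT y|lebesgue. cmod (indicator A y *\<^sub>R g y))"
    unfolding set_lebesgue_integral_def by (rule integral_norm_bound)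
  also have "\<dots> \<le> (LINT y|lebesgue. cmod (indicator B y *\<^sub>R g y))"
    using gA g A(1) unfolding set_integrable_def by (intro integral_mono integrable_norm) (auto simp: indicator_def)
  finally show ?thesis by (simp add: set_lebesgue_integral_def)
qed

lemma set_integrable_bounded_mult:
  fixes b g :: "real \<Rightarrow> complex"
  assumes g: "set_integrable lebesgue A g" and b: "b \<in> borel_measurable lebesgue"
    and bd: "\<And>y. y \<in> A \<Longrightarrow> cmod (b y) \<le> B"
  shows "set_integrable lebesgue A (\<lambda>y. b y * g y)"
proof (rule set_integrable_bound[where f = "\<lambda>y. of_real B * g y"])
  show "set_integrable lebesgue A (\<lambda>y. of_real B * g y)" using g by simp
  have "(\<lambda>y. b y * (indicator A y *\<^sub>R g y)) \<in> borel_measurable lebesgue"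
    using b g unfolding set_integrable_def by (intro borel_measurable_times) auto
  then show "set_borel_measurable lebesgue A (\<lambda>y. b y * g y)" by (simp add: set_borel_measurable_def)
  show "AE y in lebesgue. y \<in> A \<longrightarrow> norm (b y * g y) \<le> norm (of_real B * g y)"
  proof (intro AE_I2 impI)
    fix y assume "y \<in> A"
    then have "cmod (b y) \<le> \<bar>B\<bar>" using bd by fastforce
    then show "norm (b y * g y) \<le> norm (of_real B * g y)" by (simp add: norm_mult mult_right_mono)
  qed
qed

lemma (in segments) segment_integral_mult_const:
  fixes f g :: "real \<Rightarrow> complex"
  assumes x: "x \<in> D" and f: "set_integrable lebesgue (J x) f" and g: "set_integrable lebesgue (J x) g"
    and F: "\<And>y. y \<in> D \<Longrightarrow> F y = a + (LINT z:J y|lebesgue. f z)"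
    and G: "\<And>y. y \<in> D \<Longrightarrow> G y = b + (LINT z:J y|lebesgue. g z)"
  shows "set_integrable lebesgue (J x) (\<lambda>y. f y * G y + F y * g y)"
    and "(LINT y:J x|lebesgue. f y * G y + F y * g y) = F x * G x - a * b"
proof -
  note m = segment_integral_mult[OF x f g]
  let ?h = "\<lambda>y. (f y * (LINT z:J y|lebesgue. g z) + (LINT z:J y|lebesgue. f z) * g y) + (b * f y + a * g y)"
  have eq: "f y * G y + F y * g y = ?h y" if "y \<in> J x" for y
    using F[of y] G[of y] J_sub[OF x] that by (auto simp: algebra_simps)
  have lin: "set_integrable lebesgue (J x) (\<lambda>y. b * f y + a * g y)"
    using f g by (intro set_integral_add) auto
  have "set_integrable lebesgue (J x) ?h" by (rule set_integral_add(1)[OF m(1) lin])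
  then show "set_integrable lebesgue (J x) (\<lambda>y. f y * G y + F y * g y)"
    by (subst set_integrable_cong[OF refl refl eq])
  have "(LINT y:J x|lebesgue. f y * G y + F y * g y) = (LINT y:J x|lebesgue. ?h y)"
    by (rule set_lebesgue_integral_cong) (use eq in auto)
  also have "\<dots> = (LINT z:J x|lebesgue. f z) * (LINT z:J x|lebesgue. g z)
      + (b * (LINT z:J x|lebesgue. f z) + a * (LINT z:J x|lebesgue. g z))"
    by (subst set_integral_add(2)[OF m(1) lin]) (use f g in \<open>simp add: m(2) set_integral_add\<close>)
  finally show "(LINT y:J x|lebesgue. f y * G y + F y * g y) = F x * G x - a * b"
    using F[OF x] G[OF x] by (simp add: algebra_simps)
qed

lemma osc_bound_abs:
  assumes "k \<noteq> 0" "\<bar>t\<bar> \<le> R"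
  shows "cmod (osc i t k) \<le> exp (\<bar>Im k\<bar> * R * (1 + 1 / cmod k ^ 2) / 2)"
proof (rule osc_bound)
  have "Im k * t \<le> \<bar>Im k\<bar> * \<bar>t\<bar>" by (simp flip: abs_mult)
  also have "\<dots> \<le> \<bar>Im k\<bar> * R" using assms by (intro mult_left_mono) auto
  finally show "Im k * t \<le> \<bar>Im k\<bar> * R" .
qed (use assms in auto)

context lax_potential
begin

text \<open>The right-hand side \<open>U z\<close> for a column \<open>z\<close>.\<close>
definition rhs :: "(2 \<Rightarrow> real \<Rightarrow> complex) \<Rightarrow> complex \<Rightarrow> 2 \<Rightarrow> real \<Rightarrow> complex" where
  "rhs z k i y = (\<Sum>j\<in>UNIV. P i j y k * z j y)"

text \<open>
  The two Volterra equations for a column \<open>z\<close>, with the integrability they require; \<open>z\<close> itself is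
  neither assumed measurable nor bounded.
\<close>
definition solX :: "complex \<Rightarrow> (2 \<Rightarrow> real \<Rightarrow> complex) \<Rightarrow> bool" where
  "solX k z \<longleftrightarrow> (\<forall>x\<ge>0. \<forall>i. set_integrable lebesgue {x<..} (\<lambda>y. osc i (y - x) k * rhs z k i y) \<and>
    z i x = e1 i - (LINT y:{x<..}|lebesgue. osc i (y - x) k * rhs z k i y))"

definition solY :: "complex \<Rightarrow> (2 \<Rightarrow> real \<Rightarrow> complex) \<Rightarrow> bool" where
  "solY k z \<longleftrightarrow> (\<forall>x\<ge>0. \<forall>i. set_integrable lebesgue {0<..<x} (\<lambda>y. osc i (y - x) k * rhs z k i y) \<and>
    z i x = e1 i + (LINT y:{0<..<x}|lebesgue. osc i (y - x) k * rhs z k i y))"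

text \<open>
  The differential equation in integrated form, for the column multiplied by the oscillatory
  factor. Every solution of either Volterra equation satisfies it.
\<close>
definition ode :: "complex \<Rightarrow> (2 \<Rightarrow> real \<Rightarrow> complex) \<Rightarrow> bool" where
  "ode k z \<longleftrightarrow> (\<forall>x\<ge>0. \<forall>i. set_integrable lebesgue {0..<x} (\<lambda>y. osc i y k * rhs z k i y) \<and>
    osc i x k * z i x = z i 0 + (LINT y:{0..<x}|lebesgue. osc i y k * rhs z k i y))"

lemma osc_shift: "osc i (y - x) k * r = osc i (- x) k * (osc i y k * r)"
  using osc_add[of i "- x" k y] by (simp flip: mult.assoc)

lemma solX_unfold:
  assumes "solX k z" "0 \<le> x"
  shows "set_integrable lebesgue {x<..} (\<lambda>y. osc i y k * rhs z k i y)"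
    and "osc i x k * z i x = e1 i - (LINT y:{x<..}|lebesgue. osc i y k * rhs z k i y)"
proof -
  have "set_integrable lebesgue {x<..} (\<lambda>y. osc i (- x) k * (osc i y k * rhs z k i y))"
    and z: "z i x = e1 i - (LINT y:{x<..}|lebesgue. osc i (- x) k * (osc i y k * rhs z k i y))"
    using assms by (simp_all only: solX_def osc_shift)
  then show "set_integrable lebesgue {x<..} (\<lambda>y. osc i y k * rhs z k i y)"
    using osc_nonzero set_integrable_mult_right_iff by blast
  have "osc i x k * z i x = osc i x k * e1 i - osc i x k * osc i (- x) k * (LINT y:{x<..}|lebesgue. osc i y k * rhs z k i y)"
    unfolding z set_integral_mult_right by (simp add: right_diff_distrib)
  then show "osc i x k * z i x = e1 i - (LINT y:{x<..}|lebesgue. osc i y k * rhs z k i y)"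
    by (simp add: osc_inverse osc_e1)
qed

lemma solY_unfold:
  assumes "solY k z" "0 \<le> x"
  shows "set_integrable lebesgue {0..<x} (\<lambda>y. osc i y k * rhs z k i y)"
    and "osc i x k * z i x = e1 i + (LINT y:{0..<x}|lebesgue. osc i y k * rhs z k i y)"
proof -
  have "set_integrable lebesgue {0<..<x} (\<lambda>y. osc i (- x) k * (osc i y k * rhs z k i y))"
    and z: "z i x = e1 i + (LINT y:{0<..<x}|lebesgue. osc i (- x) k * (osc i y k * rhs z k i y))"
    using assms by (simp_all only: solY_def osc_shift)
  then have "set_integrable lebesgue {0<..<x} (\<lambda>y. osc i y k * rhs z k i y)"
    using osc_nonzero set_integrable_mult_right_iff by blast
  then show "set_integrable lebesgue {0..<x} (\<lambda>y. osc i y k * rhs z k i y)"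
    by (subst set_integral_null_difference(1)[of "{0}" _ "{0<..<x}"]) auto
  have "osc i x k * z i x = osc i x k * e1 i + osc i x k * osc i (- x) k * (LINT y:{0<..<x}|lebesgue. osc i y k * rhs z k i y)"
    unfolding z set_integral_mult_right by (simp add: distrib_left)
  also have "(LINT y:{0<..<x}|lebesgue. osc i y k * rhs z k i y) = (LINT y:{0..<x}|lebesgue. osc i y k * rhs z k i y)"
    by (rule set_integral_null_difference(2)[of "{0}"]) auto
  finally show "osc i x k * z i x = e1 i + (LINT y:{0..<x}|lebesgue. osc i y k * rhs z k i y)"
    by (simp add: osc_inverse osc_e1)
qed

lemma KX_rhs: "(\<Sum>j\<in>UNIV. KX UNIV i j x y k * z j y) = - (indicator {x<..} y *\<^sub>R (osc i (y - x) k * rhs z k i y))"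
  by (simp add: KX_def rhs_def sum_2 indicator_def algebra_simps)

lemma KY_rhs: "(\<Sum>j\<in>UNIV. KY i j x y k * z j y) = indicator {0<..<x} y *\<^sub>R (osc i (y - x) k * rhs z k i y)"
  by (simp add: KY_def rhs_def sum_2 indicator_def algebra_simps)

lemma vX_solX: assumes "k \<noteq> 0" "Im k \<le> 0" shows "solX k (\<lambda>i x. vX UNIV i x k)"
  unfolding solX_def
proof (intro allI impI)
  fix x :: real and i assume x: "0 \<le> x"
  have adm: "admissible (cmod k) UNIV {k'. Im k' \<le> 0 \<and> cmod k \<le> cmod k'}"
    using admissible_UNIV[of "cmod k"] assms by simp
  have "integrable lebesgue (\<lambda>y. - (indicator {x<..} y *\<^sub>R (osc i (y - x) k * rhs (\<lambda>i x. vX UNIV i x k) k i y)))"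
    "vX UNIV i x k = e1 i + (LINT y|lebesgue. - (indicator {x<..} y *\<^sub>R (osc i (y - x) k * rhs (\<lambda>i x. vX UNIV i x k) k i y)))"
    using volterra_system.sol_equation[OF system_X[OF adm], of x k i] x assms by (simp_all add: KX_rhs[where z = "\<lambda>i x. vX UNIV i x k"])
  then show "set_integrable lebesgue {x<..} (\<lambda>y. osc i (y - x) k * rhs (\<lambda>i x. vX UNIV i x k) k i y) \<and>
    vX UNIV i x k = e1 i - (LINT y:{x<..}|lebesgue. osc i (y - x) k * rhs (\<lambda>i x. vX UNIV i x k) k i y)"
    by (simp add: set_integrable_def set_lebesgue_integral_def)
qed

lemma vY_solY: assumes "k \<noteq> 0" shows "solY k (\<lambda>i x. vY i x k)"
  unfolding solY_def
proof (intro allI impI)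
  fix x :: real and i assume x: "0 \<le> x"
  show "set_integrable lebesgue {0<..<x} (\<lambda>y. osc i (y - x) k * rhs (\<lambda>i x. vY i x k) k i y) \<and>
    vY i x k = e1 i + (LINT y:{0<..<x}|lebesgue. osc i (y - x) k * rhs (\<lambda>i x. vY i x k) k i y)"
    using volterra_system.sol_equation[OF system_Y_at[OF assms, of x], of x k i] x
    by (simp add: KY_rhs[where z = "\<lambda>i x. vY i x k"] set_integrable_def set_lebesgue_integral_def)
qed

lemma rhs_diff: "rhs (\<lambda>i x. z i x - z' i x) k i y = rhs z k i y - rhs z' k i y"
  by (simp add: rhs_def sum_2 algebra_simps)

lemma solY_unique:
  assumes k: "k \<noteq> 0" and z: "solY k z" and x: "0 \<le> x"
  shows "z i x = vY i x k"
proof -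
  interpret Y: volterra_system "{0..x}" "\<lambda>x. {0..<x}" KY e1 "{k}" "\<lambda>y. Ccoef \<bar>Im k * x\<bar> (cmod k) * w0 y" 1
    by (rule system_Y_at[OF k])
  define u where "u = (\<lambda>i x. z i x - vY i x k)"
  define f where "f = (\<lambda>i y. osc i y k * rhs u k i y)"
  have f_eq: "f i = (\<lambda>y. osc i y k * rhs z k i y - osc i y k * rhs (\<lambda>i x. vY i x k) k i y)" for i
    by (simp add: f_def u_def rhs_diff right_diff_distrib)
  have f_int: "set_integrable lebesgue {0..<x'} (f i)" if "0 \<le> x'" for i x'
    unfolding f_eq by (intro set_integral_diff solY_unfold(1) z vY_solY k that)
  have u_eq: "osc i x' k * u i x' = (LINT y:{0..<x'}|lebesgue. f i y)" if "0 \<le> x'" for i x'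
    unfolding f_eq
    by (subst set_integral_diff(2)[OF solY_unfold(1)[OF z that] solY_unfold(1)[OF vY_solY[OF k] that]])
      (use solY_unfold(2)[OF z that, of i] solY_unfold(2)[OF vY_solY[OF k] that, of i]
        in \<open>simp add: u_def right_diff_distrib\<close>)
  have u_eq': "u i x' = osc i (- x') k * (LINT y:{0..<x'}|lebesgue. f i y)" if "0 \<le> x'" for i x'
    unfolding u_eq[OF that, symmetric] by (simp flip: mult.assoc add: osc_inverse)
  define E where "E = exp (\<bar>Im k\<bar> * x * (1 + 1 / cmod k ^ 2) / 2)"
  define M where "M = (\<Sum>i\<in>UNIV. LINT y:{0..<x}|lebesgue. cmod (f i y))"
  have "cmod (u i x) \<le> real CARD(2) * 0 * exp (real CARD(2) ^ 2 * Y.Gtot)"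
  proof (rule Y.system_gronwall[where u = u and \<beta> = "\<lambda>x. 0" and M = "E * M" and k = k and x = x and i = i])
    show "set_borel_measurable lebesgue {0..x} (u j)" for j
    proof -
      have "set_borel_measurable lebesgue {0..x} (\<lambda>x. LINT y:{0..<x}|lebesgue. f j y)"
        by (rule set_integral_family_measurable[OF indicator_pair_measurable(2) _ _ f_int[OF x]])
          (auto simp: borel_imp_lebesgue_sets)
      then have "(\<lambda>x'. osc j (- x') k * (indicator {0..x} x' *\<^sub>R (LINT y:{0..<x'}|lebesgue. f j y))) \<in> borel_measurable lebesgue"
        unfolding set_borel_measurable_def by measurable
      moreover have "osc j (- x') k * (indicator {0..x} x' *\<^sub>R (LINT y:{0..<x'}|lebesgue. f j y)) = indicator {0..x} x' *\<^sub>R u j x'" for x'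
        by (simp add: u_eq' indicator_def)
      ultimately show ?thesis by (simp only: set_borel_measurable_def)
    qed
    show "cmod (u j y) \<le> E * M" if "y \<in> {0..x}" for j y
    proof -
      have "cmod (LINT y:{0..<y}|lebesgue. f j y) \<le> (LINT y:{0..<x}|lebesgue. cmod (f j y))"
        by (rule norm_set_integral_le[OF f_int[OF x]]) (use that in \<open>auto simp: borel_imp_lebesgue_sets\<close>)
      also have "\<dots> \<le> M"
        unfolding M_def by (rule member_le_sum) (auto intro!: set_integral_nonneg')
      finally have "cmod (LINT y:{0..<y}|lebesgue. f j y) \<le> M" .
      moreover have "cmod (osc j (- y) k) \<le> E"
        unfolding E_def by (rule osc_bound_abs[OF k]) (use that in auto)
      ultimately show ?thesis using that by (subst u_eq') (auto simp: norm_mult E_def intro!: mult_mono)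
    qed
    fix i x' assume "x' \<in> {0..x}"
    then have x': "0 \<le> x'" by simp
    have "(LINT y|lebesgue. (\<Sum>j\<in>UNIV. KY i j x' y k * u j y)) = (LINT y:{0<..<x'}|lebesgue. osc i (- x') k * f i y)"
      unfolding KY_rhs osc_shift f_def set_lebesgue_integral_def ..
    also have "\<dots> = osc i (- x') k * (LINT y:{0..<x'}|lebesgue. f i y)"
      unfolding set_integral_mult_right by (subst set_integral_null_difference(2)[of "{0}" _ "{0..<x'}"]) auto
    finally show "cmod (u i x') \<le> 0 + cmod (LINT y|lebesgue. (\<Sum>j\<in>UNIV. KY i j x' y k * u j y))"
      using u_eq'[OF x'] by simp
  qed (use x in auto)
  then show ?thesis by (simp add: u_def)
qed

text \<open>
  A solution is not assumed bounded, and its second component may a priori grow like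
  \<open>exp (2 |Im \<theta>| x)\<close>. A first application of Gronwall's inequality, to the second component with
  its oscillatory factor, excludes this growth.
\<close>
lemma solX_unique:
  assumes k: "k \<noteq> 0" "Im k \<le> 0" and z: "solX k z" and x: "0 \<le> x"
  shows "z i x = vX UNIV i x k"
proof -
  have adm: "admissible (cmod k) UNIV {k}"
    using admissible_mono[OF admissible_UNIV[of "cmod k"]] k by simp
  interpret X: volterra_system "{0..}" "\<lambda>x. {x<..}" "KX UNIV" e1 "{k}" "\<lambda>y. Ccoef 1 (cmod k) * (indicator UNIV y * w0 y)" 1
    by (rule system_X[OF adm])
  define u where "u = (\<lambda>i x. z i x - vX UNIV i x k)"
  define f where "f = (\<lambda>i y. osc i y k * rhs u k i y)"
  note v = vX_solX[OF k]
  have f_eq: "f i = (\<lambda>y. osc i y k * rhs z k i y - osc i y k * rhs (\<lambda>i x. vX UNIV i x k) k i y)" for i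
    by (simp add: f_def u_def rhs_diff right_diff_distrib)
  have f_int: "set_integrable lebesgue {x<..} (f i)" if "0 \<le> x" for i x
    unfolding f_eq by (intro set_integral_diff solX_unfold(1) z v that)
  have u_eq: "osc i x k * u i x = - (LINT y:{x<..}|lebesgue. f i y)" if "0 \<le> x" for i x
    unfolding f_eq
    by (subst set_integral_diff(2)[OF solX_unfold(1)[OF z that] solX_unfold(1)[OF v that]])
      (use solX_unfold(2)[OF z that, of i] solX_unfold(2)[OF v that, of i]
        in \<open>simp add: u_def right_diff_distrib\<close>)
  have u_eq': "u i x = - (osc i (- x) k * (LINT y:{x<..}|lebesgue. f i y))" if "0 \<le> x" for i x
  proof -
    have "u i x = osc i (- x) k * (osc i x k * u i x)" by (simp flip: mult.assoc add: osc_inverse)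
    then show ?thesis unfolding u_eq[OF that] by simp
  qed
  define M where "M = (\<lambda>i. LINT y:{0<..}|lebesgue. cmod (f i y))"
  have M0: "0 \<le> M i" for i unfolding M_def by (rule set_integral_nonneg') auto
  have F_bd: "cmod (LINT y:{x<..}|lebesgue. f i y) \<le> M i" if "0 \<le> x" for i x
    unfolding M_def
    by (rule norm_set_integral_le[OF f_int[OF order.refl]]) (use that in \<open>auto simp: borel_imp_lebesgue_sets\<close>)
  have F_meas: "set_borel_measurable lebesgue {0..} (\<lambda>x. LINT y:{x<..}|lebesgue. f i y)" for i
    by (rule set_integral_family_measurable[OF indicator_pair_measurable(1) _ _ f_int[OF order.refl]])
      (auto simp: borel_imp_lebesgue_sets)
  have u1: "cmod (u 1 x) \<le> M 1" if "0 \<le> x" for x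
    using u_eq[OF that, of 1] F_bd[OF that, of 1] by (simp add: osc_def)
  define C where "C = 1 + 1 / cmod k"
  have C: "0 < C" unfolding C_def by (intro add_pos_nonneg) auto
  have PC: "cmod (P i j y k) \<le> C * w0 y" for i j y using P_bound[OF k(1)] by (simp add: C_def)
  \<comment> \<open>The modulus of the second component with its oscillatory factor.\<close>
  define \<phi> where "\<phi> = (\<lambda>x. cmod (LINT y:{x<..}|lebesgue. f 2 y))"
  have \<phi>_eq: "\<phi> x = cmod (osc 2 x k * u 2 x)" if "0 \<le> x" for x using u_eq[OF that, of 2] by (simp add: \<phi>_def)
  have \<phi>_meas: "set_borel_measurable lebesgue {0..} \<phi>"
  proof -
    have "(\<lambda>x. cmod (indicator {0..} x *\<^sub>R (LINT y:{x<..}|lebesgue. f 2 y))) \<in> borel_measurable lebesgue"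
      using F_meas[of 2] unfolding set_borel_measurable_def by measurable
    then show ?thesis by (simp add: set_borel_measurable_def \<phi>_def)
  qed
  have osc_mono: "cmod (osc 2 y k) \<le> cmod (osc 2 x k)" if "x \<le> y" for x y
  proof -
    have "Im k * y * (1 + 1 / cmod k ^ 2) \<le> Im k * x * (1 + 1 / cmod k ^ 2)"
      using that k(2) by (intro mult_right_mono mult_left_mono_neg) auto
    then show ?thesis by (simp add: osc_def norm_osc_2 del: norm_exp_eq_Re)
  qed
  \<comment> \<open>The bound decays like the oscillatory factor, so dividing by that factor bounds the component.\<close>
  define \<beta> where "\<beta> = (\<lambda>x. cmod (osc 2 x k) * (M 1 * (C * W0)))"
  have \<phi>_le: "\<phi> x \<le> \<beta> x * exp (LINT y:{x<..}|lebesgue. C * w0 y)" if x: "0 \<le> x" for x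
  proof (rule segments.gronwall[OF segments_right _ _ \<phi>_meas, where M = "M 2"])
    show "set_integrable lebesgue {0..} (\<lambda>y. C * w0 y)"
      using w0_int[of "{0..}"] by (simp add: borel_imp_lebesgue_sets)
    show "0 \<le> C * w0 y" for y using C w0_nonneg[of y] by simp
    show "0 \<le> \<phi> y \<and> \<phi> y \<le> M 2" if "y \<in> {0..}" for y using F_bd[of y 2] that by (simp add: \<phi>_def)
    show "\<beta> y \<le> \<beta> x" if "x \<in> {0..}" "y \<in> {x<..}" for x y
      unfolding \<beta>_def using that C M0[of 1] W0_nonneg by (intro mult_right_mono osc_mono) auto
    show "x \<in> {0..}" using x by simp
    fix x :: real assume "x \<in> {0..}"
    then have x: "0 \<le> x" by simp
    have w\<phi>: "set_integrable lebesgue {x<..} (\<lambda>y. C * w0 y * \<phi> y)"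
    proof (rule set_integrable_bound[where f = "\<lambda>y. C * M 2 * w0 y"])
      show "set_integrable lebesgue {x<..} (\<lambda>y. C * M 2 * w0 y)"
        by (rule set_integrable_mult_right) (rule w0_int_right[OF x])
      have "(\<lambda>y. indicator {x<..} y * (C * w0 y * (indicator {0..} y *\<^sub>R \<phi> y))) \<in> borel_measurable lebesgue"
        using \<phi>_meas unfolding set_borel_measurable_def
        by (intro borel_measurable_times borel_measurable_const w0_meas)
          (auto simp: borel_imp_lebesgue_sets)
      also have "(\<lambda>y. indicator {x<..} y * (C * w0 y * (indicator {0..} y *\<^sub>R \<phi> y))) = (\<lambda>y. indicator {x<..} y *\<^sub>R (C * w0 y * \<phi> y))"
        using x by (auto simp: indicator_def)
      finally show "set_borel_measurable lebesgue {x<..} (\<lambda>y. C * w0 y * \<phi> y)" by (simp add: set_borel_measurable_def)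
      show "AE y in lebesgue. y \<in> {x<..} \<longrightarrow> norm (C * w0 y * \<phi> y) \<le> norm (C * M 2 * w0 y)"
      proof (intro AE_I2 impI)
        fix y assume "y \<in> {x<..}"
        then have "\<phi> y \<le> M 2" using x F_bd[of y 2] by (simp add: \<phi>_def)
        then have "(C * w0 y) * \<phi> y \<le> (C * w0 y) * M 2"
          using C w0_nonneg[of y] by (intro mult_left_mono) auto
        moreover have "0 \<le> (C * w0 y) * \<phi> y" using C w0_nonneg[of y] by (simp add: \<phi>_def)
        ultimately show "norm (C * w0 y * \<phi> y) \<le> norm (C * M 2 * w0 y)" by (simp add: mult_ac)
      qed
    qed
    have int1: "set_integrable lebesgue {x<..} (\<lambda>y. cmod (osc 2 x k) * M 1 * (C * w0 y))"
      by (intro set_integrable_mult_right w0_int_right[OF x])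
    have "\<phi> x \<le> (LINT y:{x<..}|lebesgue. cmod (f 2 y))"
      unfolding \<phi>_def by (rule norm_set_integral_le[OF f_int[OF x]]) (auto simp: borel_imp_lebesgue_sets)
    also have "\<dots> \<le> (LINT y:{x<..}|lebesgue. cmod (osc 2 x k) * M 1 * (C * w0 y) + C * w0 y * \<phi> y)"
    proof (rule set_integral_mono)
      show "set_integrable lebesgue {x<..} (\<lambda>y. cmod (f 2 y))"
        using f_int[OF x] by (rule set_integrable_norm)
      show "set_integrable lebesgue {x<..} (\<lambda>y. cmod (osc 2 x k) * M 1 * (C * w0 y) + C * w0 y * \<phi> y)"
        by (rule set_integral_add(1)[OF int1 w\<phi>])
      fix y assume y: "y \<in> {x<..}"
      then have y0: "0 \<le> y" using x by simp
      have "f 2 y = osc 2 y k * u 1 y * P 2 1 y k + osc 2 y k * u 2 y * P 2 2 y k"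
        by (simp add: f_def rhs_def sum_2 algebra_simps)
      then have "cmod (f 2 y) \<le> cmod (osc 2 y k * u 1 y) * cmod (P 2 1 y k) + cmod (osc 2 y k * u 2 y) * cmod (P 2 2 y k)"
        using norm_triangle_ineq[of "osc 2 y k * u 1 y * P 2 1 y k" "osc 2 y k * u 2 y * P 2 2 y k"] by (simp add: norm_mult)
      also have "\<dots> \<le> (cmod (osc 2 x k) * M 1) * (C * w0 y) + \<phi> y * (C * w0 y)"
        unfolding \<phi>_eq[OF y0, symmetric] norm_mult[of "osc 2 y k" "u 1 y"]
        using y u1[OF y0] osc_mono[of x y] M0[of 1]
        by (intro add_mono mult_mono PC) (auto simp: \<phi>_def)
      finally show "cmod (f 2 y) \<le> cmod (osc 2 x k) * M 1 * (C * w0 y) + C * w0 y * \<phi> y" by (simp add: mult_ac)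
    qed
    also have "\<dots> = cmod (osc 2 x k) * M 1 * (C * (LINT y:{x<..}|lebesgue. w0 y)) + (LINT y:{x<..}|lebesgue. C * w0 y * \<phi> y)"
      by (subst set_integral_add(2)[OF int1 w\<phi>]) (simp only: set_integral_mult_right)
    also have "cmod (osc 2 x k) * M 1 * (C * (LINT y:{x<..}|lebesgue. w0 y)) \<le> \<beta> x"
      unfolding \<beta>_def mult.assoc using C M0[of 1] x
      by (intro mult_left_mono w0_le_W0) (auto simp: borel_imp_lebesgue_sets)
    finally show "\<phi> x \<le> \<beta> x + (LINT y:{x<..}|lebesgue. C * w0 y * \<phi> y)" by simp
  qed
  define M2 where "M2 = M 1 * (C * W0) * exp (C * W0)"
  have u2: "cmod (u 2 x) \<le> M2" if x: "0 \<le> x" for x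
  proof -
    have pos: "0 < cmod (osc 2 x k)" by (simp add: osc_nonzero)
    have "(LINT y:{x<..}|lebesgue. C * w0 y) \<le> C * W0"
      unfolding set_integral_mult_right using C x by (intro mult_left_mono w0_le_W0) (auto simp: borel_imp_lebesgue_sets)
    then have "\<beta> x * exp (LINT y:{x<..}|lebesgue. C * w0 y) \<le> \<beta> x * exp (C * W0)"
      using C M0[of 1] W0_nonneg by (intro mult_left_mono) (auto simp: \<beta>_def)
    then have "cmod (osc 2 x k) * cmod (u 2 x) \<le> cmod (osc 2 x k) * M2"
      using \<phi>_le[OF x] unfolding \<phi>_eq[OF x] norm_mult \<beta>_def M2_def by (simp only: mult.assoc)
    then show ?thesis using pos by simp
  qed
  have "cmod (u i x) \<le> real CARD(2) * 0 * exp (real CARD(2) ^ 2 * X.Gtot)"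
  proof (rule X.system_gronwall[where u = u and \<beta> = "\<lambda>x. 0" and M = "max (M 1) M2" and k = k and x = x and i = i])
    show "set_borel_measurable lebesgue {0..} (u j)" for j
    proof -
      have "(\<lambda>x'. osc j (- x') k * (indicator {0..} x' *\<^sub>R (LINT y:{x'<..}|lebesgue. f j y))) \<in> borel_measurable lebesgue"
        using F_meas[of j] unfolding set_borel_measurable_def by measurable
      then have "(\<lambda>x'. - (osc j (- x') k * (indicator {0..} x' *\<^sub>R (LINT y:{x'<..}|lebesgue. f j y)))) \<in> borel_measurable lebesgue"
        by (rule borel_measurable_uminus)
      moreover have "- (osc j (- x') k * (indicator {0..} x' *\<^sub>R (LINT y:{x'<..}|lebesgue. f j y))) = indicator {0..} x' *\<^sub>R u j x'" for x'
        by (simp add: u_eq' indicator_def)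
      ultimately show ?thesis by (simp only: set_borel_measurable_def)
    qed
    show "cmod (u j y) \<le> max (M 1) M2" if "y \<in> {0..}" for j y
      using u1[of y] u2[of y] that exhaust_2[of j] by auto
    fix i and x' :: real assume "x' \<in> {0..}"
    then have x': "0 \<le> x'" by simp
    have "(LINT y|lebesgue. (\<Sum>j\<in>UNIV. KX UNIV i j x' y k * u j y)) = - (LINT y:{x'<..}|lebesgue. osc i (- x') k * f i y)"
      unfolding KX_rhs osc_shift f_def set_lebesgue_integral_def by simp
    also have "\<dots> = u i x'"
      unfolding set_integral_mult_right u_eq'[OF x'] ..
    finally show "cmod (u i x') \<le> 0 + cmod (LINT y|lebesgue. (\<Sum>j\<in>UNIV. KX UNIV i j x' y k * u j y))"
      by simp
  qed (use x in auto)
  then show ?thesis by (simp add: u_def)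
qed

lemma solY_ode: "solY k z \<Longrightarrow> ode k z"
  unfolding ode_def
proof (intro allI impI conjI)
  fix x :: real and i assume z: "solY k z" and x: "0 \<le> x"
  show "set_integrable lebesgue {0..<x} (\<lambda>y. osc i y k * rhs z k i y)" by (rule solY_unfold(1)[OF z x])
  show "osc i x k * z i x = z i 0 + (LINT y:{0..<x}|lebesgue. osc i y k * rhs z k i y)"
    using solY_unfold(2)[OF z x, of i] solY_unfold(2)[OF z order.refl, of i]
    by (simp add: set_lebesgue_integral_def[of _ "{}"])
qed

lemma solX_ode: "solX k z \<Longrightarrow> ode k z"
  unfolding ode_def
proof (intro allI impI conjI)
  fix x :: real and i assume z: "solX k z" and x: "0 \<le> x"
  let ?f = "\<lambda>y. osc i y k * rhs z k i y"
  have f0: "set_integrable lebesgue {0<..} ?f" by (rule solX_unfold(1)[OF z order.refl])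
  have null: "set_integrable lebesgue {0..<x} ?f \<longleftrightarrow> set_integrable lebesgue {0<..x} ?f"
    "(LINT y:{0..<x}|lebesgue. ?f y) = (LINT y:{0<..x}|lebesgue. ?f y)"
    by (rule set_integral_null_difference[of "{0, x}"]; auto)+
  have fx: "set_integrable lebesgue {0<..x} ?f"
    by (rule set_integrable_subset[OF f0]) (auto simp: borel_imp_lebesgue_sets)
  then show "set_integrable lebesgue {0..<x} ?f" by (simp add: null)
  have "(LINT y:{0<..x} \<union> {x<..}|lebesgue. ?f y) = (LINT y:{0<..x}|lebesgue. ?f y) + (LINT y:{x<..}|lebesgue. ?f y)"
    by (rule set_integral_Un[OF _ fx solX_unfold(1)[OF z x]]) auto
  moreover have "{0<..x} \<union> {x<..} = {0<..}" using x by auto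
  ultimately show "osc i x k * z i x = z i 0 + (LINT y:{0..<x}|lebesgue. ?f y)"
    using solX_unfold(2)[OF z x, of i] solX_unfold(2)[OF z order.refl, of i] null(2) by simp
qed

lemma P_reflect': "P 2 1 y (- k) = - P 1 2 y k"
  using P_reflect(2)[of y "- k"] by simp

text \<open>
  The Wronskian of a column at \<open>k\<close> and a column at \<open>- k\<close> is \<open>1\<close>: it is constant because the
  potential has trace zero, and \<open>1\<close> at the point from which the integrals start. That point is \<open>0\<close>
  for \<open>s = 1\<close> and infinity for \<open>s = - 1\<close>.
\<close>
lemma wronskian:
  assumes seg: "segments D J" and x: "x \<in> D"
    and int: "\<And>i. set_integrable lebesgue (J x) (\<lambda>y. osc i y k * rhs z k i y)"
      "\<And>i. set_integrable lebesgue (J x) (\<lambda>y. osc i y (- k) * rhs z' (- k) i y)"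
    and eq: "\<And>i y. y \<in> D \<Longrightarrow> osc i y k * z i y = e1 i + s * (LINT t:J y|lebesgue. osc i t k * rhs z k i t)"
      "\<And>i y. y \<in> D \<Longrightarrow> osc i y (- k) * z' i y = e1 i + s * (LINT t:J y|lebesgue. osc i t (- k) * rhs z' (- k) i t)"
  shows "z 1 x * z' 1 x + z 2 x * z' 2 x = 1"
proof -
  interpret segments D J by (rule seg)
  let ?f = "\<lambda>i y. s * (osc i y k * rhs z k i y)" and ?f' = "\<lambda>i y. s * (osc i y (- k) * rhs z' (- k) i y)"
  let ?F = "\<lambda>i y. osc i y k * z i y" and ?F' = "\<lambda>i y. osc i y (- k) * z' i y"
  let ?h = "\<lambda>i y. ?f i y * ?F' i y + ?F i y * ?f' i y"
  have m: "set_integrable lebesgue (J x) (?h i)"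
    "(LINT y:J x|lebesgue. ?h i y) = ?F i x * ?F' i x - e1 i * e1 i" for i
    by (rule segment_integral_mult_const[OF x]; use int eq in \<open>auto simp: set_integral_mult_right\<close>)+
  have cancel: "osc i y k * a * (osc i y (- k) * b) = a * b" for i y a b
  proof -
    have "osc i y k * a * (osc i y (- k) * b) = (osc i y k * osc i (- y) k) * (a * b)" by (simp add: osc_minus mult_ac)
    then show ?thesis by (simp add: osc_inverse)
  qed
  have h: "?h i y = s * (rhs z k i y * z' i y + z i y * rhs z' (- k) i y)" for i y
    using cancel[of i y "rhs z k i y" "z' i y"] cancel[of i y "z i y" "rhs z' (- k) i y"] by algebra
  have "rhs z k 1 y * z' 1 y + z 1 y * rhs z' (- k) 1 y + (rhs z k 2 y * z' 2 y + z 2 y * rhs z' (- k) 2 y) = 0" for y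
    by (simp add: rhs_def sum_2 P_trace P_reflect P_reflect' algebra_simps)
  then have "?h 1 y + ?h 2 y = 0" for y
    unfolding h by (simp flip: distrib_left)
  then have "(LINT y:J x|lebesgue. ?h 1 y + ?h 2 y) = 0"
    by (simp only: set_lebesgue_integral_def) simp
  then have "(?F 1 x * ?F' 1 x - e1 1 * e1 1) + (?F 2 x * ?F' 2 x - e1 2 * e1 2) = 0"
    using set_integral_add(2)[OF m(1)[of 1] m(1)[of 2]] unfolding m(2) by simp
  then show ?thesis unfolding cancel by (simp add: e1_def algebra_simps)
qed

lemma wronskian_X:
  assumes "solX k z" "solX (- k) z'" "0 \<le> x"
  shows "z 1 x * z' 1 x + z 2 x * z' 2 x = 1"
  by (rule wronskian[OF segments_right, where s = "- 1"]) (use assms in \<open>auto intro: solX_unfold(1) simp: solX_unfold(2)\<close>)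

lemma wronskian_Y:
  assumes "solY k z" "solY (- k) z'" "0 \<le> x"
  shows "z 1 x * z' 1 x + z 2 x * z' 2 x = 1"
  by (rule wronskian[OF segments_left[of x], where s = 1]) (use assms in \<open>auto intro: solY_unfold(1) simp: solY_unfold(2)\<close>)

end

section \<open>Weak differentiability\<close>

lemma test_function_facts:
  assumes "test_function_on {0<..} \<phi>"
  shows "(\<phi> has_real_derivative deriv \<phi> x) (at x)" and "continuous_on UNIV (deriv \<phi>)"
    and "\<exists>R>0. \<forall>x. x \<le> 0 \<or> R \<le> x \<longrightarrow> \<phi> x = 0 \<and> deriv \<phi> x = 0"
proof -
  have d: "(deriv ^^ m) \<phi> differentiable_on UNIV" for m using assms by (simp add: test_function_on_def)
  have "\<phi> differentiable_on UNIV" using d[of 0] by simp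
  then have "\<phi> differentiable (at x)" for x by (simp add: differentiable_on_def)
  then show der: "(\<phi> has_real_derivative deriv \<phi> x) (at x)" for x
    using DERIV_deriv_iff_real_differentiable by blast
  show "continuous_on UNIV (deriv \<phi>)"
    using differentiable_imp_continuous_on[OF d[of 1]] by simp
  define K where "K = closure {x. \<phi> x \<noteq> 0}"
  have K: "compact K" "K \<subseteq> {0<..}" using assms by (auto simp: test_function_on_def K_def)
  have out: "\<phi> x = 0 \<and> deriv \<phi> x = 0" if "x \<notin> K" for x
  proof
    show "\<phi> x = 0" using that closure_subset[of "{x. \<phi> x \<noteq> 0}"] by (auto simp: K_def)
    have "(\<phi> has_real_derivative 0) (at x)"
    proof (rule has_field_derivative_transform_within_open[where f = "\<lambda>x. 0" and S = "- K"])
      show "open (- K)" by (simp add: K_def open_Compl)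
      show "0 = \<phi> y" if "y \<in> - K" for y
        using that closure_subset[of "{x. \<phi> x \<noteq> 0}"] by (auto simp: K_def)
    qed (use that in auto)
    then show "deriv \<phi> x = 0" by (rule DERIV_imp_deriv)
  qed
  obtain B where B: "\<forall>x\<in>K. norm x \<le> B" using compact_imp_bounded[OF K(1)] by (auto simp: bounded_iff)
  have "\<bar>B\<bar> + 1 > 0" "\<forall>x. x \<le> 0 \<or> \<bar>B\<bar> + 1 \<le> x \<longrightarrow> x \<notin> K" using B K(2) by fastforce+
  then show "\<exists>R>0. \<forall>x. x \<le> 0 \<or> R \<le> x \<longrightarrow> \<phi> x = 0 \<and> deriv \<phi> x = 0" using out by blast
qed

lemma continuous_set_integrable:
  fixes f :: "real \<Rightarrow> complex"
  assumes "continuous_on {0..x} f"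
  shows "set_integrable lebesgue {0..<x} f"
proof -
  have "f absolutely_integrable_on {0..x}"
    using absolutely_integrable_continuous[of 0 x f] assms by simp
  then show ?thesis by (rule set_integrable_subset) (auto simp: borel_imp_lebesgue_sets)
qed

lemma integral_of_derivative:
  fixes f :: "real \<Rightarrow> complex"
  assumes der: "\<And>y. (f has_vector_derivative f' y) (at y)" and cont: "continuous_on UNIV f'" and x: "0 \<le> x"
  shows "(LINT y:{0..<x}|lebesgue. f' y) = f x - f 0"
proof -
  have "f' absolutely_integrable_on {0..x}"
    using absolutely_integrable_continuous[of 0 x f'] continuous_on_subset[OF cont] by simp
  then have "(LINT y:{0..x}|lebesgue. f' y) = integral {0..x} f'" by (rule set_lebesgue_integral_eq_integral(2))
  also have "\<dots> = f x - f 0"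
    using fundamental_theorem_of_calculus[OF x, of f f'] der
    by (intro integral_unique) (auto intro: has_vector_derivative_at_within)
  also have "(LINT y:{0..x}|lebesgue. f' y) = (LINT y:{0..<x}|lebesgue. f' y)"
    by (rule set_integral_null_difference(2)[of "{x}"]) auto
  finally show ?thesis .
qed

lemma osc_has_vector_derivative:
  "((\<lambda>x. osc i (- x) k) has_vector_derivative ((if i = 1 then 0 else 2 * \<i> * theta1 k) * osc i (- x) k)) (at x)"
proof (cases "i = 1")
  case False
  have "((\<lambda>x. exp (of_real x * (2 * \<i> * theta1 k))) has_vector_derivative
      (2 * \<i> * theta1 k) * exp (of_real x * (2 * \<i> * theta1 k))) (at x)"
  proof -
    have "((\<lambda>z. exp (z * (2 * \<i> * theta1 k))) has_field_derivative
        (2 * \<i> * theta1 k) * exp (of_real x * (2 * \<i> * theta1 k))) (at (of_real x))"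
      by (auto intro!: derivative_eq_intros)
    from has_vector_derivative_real_field[OF this] show ?thesis .
  qed
  then show ?thesis using False by (simp add: osc_def mult_ac)
qed (simp add: osc_def)

context lax_potential
begin

text \<open>The weak derivative of a solution of the integrated equation.\<close>
definition zdot :: "(2 \<Rightarrow> real \<Rightarrow> complex) \<Rightarrow> complex \<Rightarrow> 2 \<Rightarrow> real \<Rightarrow> complex" where
  "zdot z k i x = rhs z k i x + (if i = 1 then 0 else 2 * \<i> * theta1 k) * z i x"

lemma ode_bounded:
  assumes z: "ode k z" and k: "k \<noteq> 0" and R: "0 \<le> R"
  shows "set_integrable lebesgue {0..<R} (z i)" and "set_integrable lebesgue {0..<R} (zdot z k i)"
proof -
  let ?f = "\<lambda>y. osc i y k * rhs z k i y"
  define E where "E = exp (\<bar>Im k\<bar> * R * (1 + 1 / cmod k ^ 2) / 2)"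
  have E: "cmod (osc i (- x) k) \<le> E" if "x \<in> {0..R}" for x
    unfolding E_def by (rule osc_bound_abs[OF k]) (use that in auto)
  have f: "set_integrable lebesgue {0..<x} ?f" if "0 \<le> x" for x using z that by (simp add: ode_def)
  have z_eq: "z i x = osc i (- x) k * (z i 0 + (LINT y:{0..<x}|lebesgue. ?f y))" if "0 \<le> x" for x
  proof -
    have "z i x = osc i (- x) k * (osc i x k * z i x)" by (simp flip: mult.assoc add: osc_inverse)
    also have "osc i x k * z i x = z i 0 + (LINT y:{0..<x}|lebesgue. ?f y)" using z that by (simp add: ode_def)
    finally show ?thesis .
  qed
  define M where "M = (LINT y:{0..<R}|lebesgue. cmod (?f y))"
  have bound: "cmod (z i x) \<le> E * (cmod (z i 0) + M)" if x: "x \<in> {0..R}" for x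
  proof -
    have "cmod (LINT y:{0..<x}|lebesgue. ?f y) \<le> M"
      unfolding M_def by (rule norm_set_integral_le[OF f[OF R]]) (use x in \<open>auto simp: borel_imp_lebesgue_sets\<close>)
    then have "cmod (z i 0 + (LINT y:{0..<x}|lebesgue. ?f y)) \<le> cmod (z i 0) + M"
      using norm_triangle_ineq[of "z i 0" "LINT y:{0..<x}|lebesgue. ?f y"] by linarith
    then show ?thesis
      using x by (subst z_eq) (auto simp: norm_mult E_def intro!: mult_mono E[unfolded E_def])
  qed
  have meas: "set_borel_measurable lebesgue {0..R} (z i)"
  proof -
    have "set_borel_measurable lebesgue {0..R} (\<lambda>x. LINT y:{0..<x}|lebesgue. ?f y)"
      by (rule set_integral_family_measurable[OF indicator_pair_measurable(2) _ _ f[OF R]])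
        (auto simp: borel_imp_lebesgue_sets)
    moreover have "(\<lambda>x. indicator {0..R} x *\<^sub>R z i 0) \<in> borel_measurable lebesgue"
      by (intro borel_measurable_scaleR borel_measurable_indicator borel_measurable_const borel_imp_lebesgue_sets) simp
    ultimately have "(\<lambda>x. osc i (- x) k * (indicator {0..R} x *\<^sub>R z i 0
        + indicator {0..R} x *\<^sub>R (LINT y:{0..<x}|lebesgue. ?f y))) \<in> borel_measurable lebesgue"
      unfolding set_borel_measurable_def by measurable
    moreover have "osc i (- x) k * (indicator {0..R} x *\<^sub>R z i 0 + indicator {0..R} x *\<^sub>R (LINT y:{0..<x}|lebesgue. ?f y))
        = indicator {0..R} x *\<^sub>R z i x" for x
      using z_eq[of x] by (simp add: indicator_def)
    ultimately show ?thesis by (simp only: set_borel_measurable_def)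
  qed
  have "set_integrable lebesgue {0..R} (z i)"
  proof (rule set_integrable_bound[OF _ meas])
    show "set_integrable lebesgue {0..R} (\<lambda>y. E * (cmod (z i 0) + M))"
      using absolutely_integrable_continuous[of 0 R "\<lambda>y. E * (cmod (z i 0) + M)"] by simp
    show "AE y in lebesgue. y \<in> {0..R} \<longrightarrow> norm (z i y) \<le> norm (E * (cmod (z i 0) + M))"
      by (intro AE_I2 impI order_trans[OF bound]) auto
  qed
  then show zi: "set_integrable lebesgue {0..<R} (z i)"
    by (rule set_integrable_subset) (auto simp: borel_imp_lebesgue_sets)
  have "set_integrable lebesgue {0..<R} (\<lambda>y. osc i (- y) k * ?f y)"
    by (rule set_integrable_bounded_mult[OF f[OF R], where B = E]) (use E in auto)
  then have "set_integrable lebesgue {0..<R} (rhs z k i)"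
    by (simp flip: mult.assoc add: osc_inverse)
  then show "set_integrable lebesgue {0..<R} (zdot z k i)"
    unfolding zdot_def[abs_def] using zi by (intro set_integral_add) auto
qed

lemma ode_weak_derivative:
  assumes z: "ode k z" and k: "k \<noteq> 0" and \<phi>: "test_function_on {0<..} \<phi>"
  shows "set_integrable lebesgue {0<..} (\<lambda>x. deriv \<phi> x *\<^sub>R z i x)"
    and "set_integrable lebesgue {0<..} (\<lambda>x. \<phi> x *\<^sub>R zdot z k i x)"
    and "(LINT x:{0<..}|lebesgue. deriv \<phi> x *\<^sub>R z i x) = - (LINT x:{0<..}|lebesgue. \<phi> x *\<^sub>R zdot z k i x)"
proof -
  note \<phi>' = test_function_facts[OF \<phi>]
  obtain R where R: "0 < R" "\<And>x. x \<le> 0 \<or> R \<le> x \<Longrightarrow> \<phi> x = 0 \<and> deriv \<phi> x = 0" using \<phi>'(3) by blast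
  have \<phi>_cont: "continuous_on UNIV \<phi>"
    using \<phi>'(1) by (meson DERIV_isCont continuous_at_imp_continuous_on)
  define c where "c = (if i = 1 then 0 else 2 * \<i> * theta1 k)"
  define \<psi> where "\<psi> = (\<lambda>x. of_real (\<phi> x) * osc i (- x) k)"
  define \<psi>' where "\<psi>' = (\<lambda>x. of_real (\<phi> x) * (c * osc i (- x) k) + of_real (deriv \<phi> x) * osc i (- x) k)"
  have osc_cont: "continuous_on UNIV (\<lambda>x. osc i (- x) k)"
    unfolding osc_def by (cases "i = 1") (auto intro!: continuous_intros)
  have \<psi>_der: "(\<psi> has_vector_derivative \<psi>' x) (at x)" for x
  proof -
    have "((\<lambda>x. complex_of_real (\<phi> x)) has_vector_derivative of_real (deriv \<phi> x)) (at x)"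
      using \<phi>'(1)[of x] by (intro has_vector_derivative_of_real) (simp add: has_real_derivative_iff_has_vector_derivative)
    from has_vector_derivative_mult[OF this osc_has_vector_derivative[of i k x]]
    show ?thesis by (simp add: \<psi>_def \<psi>'_def c_def)
  qed
  have \<psi>'_cont: "continuous_on UNIV \<psi>'"
    unfolding \<psi>'_def by (intro continuous_intros \<phi>_cont \<phi>'(2) osc_cont)
  have \<psi>_int: "\<psi> y = 0 + (LINT t:{0..<y}|lebesgue. \<psi>' t)" if "y \<in> {0..R}" for y
    using integral_of_derivative[OF \<psi>_der \<psi>'_cont, of y] that R(2)[of 0] by (simp add: \<psi>_def)
  let ?f = "\<lambda>y. osc i y k * rhs z k i y" and ?F = "\<lambda>y. osc i y k * z i y"
  interpret segments "{0..R}" "\<lambda>x. {0..<x}" by (rule segments_left)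
  have RD: "R \<in> {0..R}" using R by simp
  have F: "?F y = z i 0 + (LINT t:{0..<y}|lebesgue. ?f t)" if "y \<in> {0..R}" for y using z that by (simp add: ode_def)
  have f: "set_integrable lebesgue {0..<R} ?f" using z R by (simp add: ode_def)
  have \<psi>'i: "set_integrable lebesgue {0..<R} \<psi>'"
    by (rule continuous_set_integrable[OF continuous_on_subset[OF \<psi>'_cont]]) simp
  note parts = segment_integral_mult_const[OF RD \<psi>'i f \<psi>_int F]
  let ?a = "\<lambda>y. deriv \<phi> y *\<^sub>R z i y" and ?b = "\<lambda>y. \<phi> y *\<^sub>R zdot z k i y"
  have ab: "\<psi>' y * ?F y + \<psi> y * ?f y = ?a y + ?b y" for y
  proof -
    have "\<psi>' y * ?F y + \<psi> y * ?f y
        = (osc i (- y) k * osc i y k) * (of_real (\<phi> y) * c * z i y + of_real (deriv \<phi> y) * z i y + of_real (\<phi> y) * rhs z k i y)"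
      by (simp add: \<psi>_def \<psi>'_def algebra_simps)
    then show ?thesis by (simp only: osc_inverse) (simp add: zdot_def c_def scaleR_conv_of_real algebra_simps)
  qed
  have bdd: "\<exists>B. \<forall>y\<in>{0..<R}. cmod (of_real (h y)) \<le> B" if "continuous_on UNIV h" for h :: "real \<Rightarrow> real"
  proof -
    have "compact (h ` {0..R})" by (rule compact_continuous_image[OF continuous_on_subset[OF that]]) auto
    then obtain B where "\<forall>y\<in>h ` {0..R}. norm y \<le> B" using compact_imp_bounded bounded_iff by metis
    then show ?thesis by (auto intro!: exI[of _ B])
  qed
  have prod_int: "set_integrable lebesgue {0..<R} (\<lambda>y. h y *\<^sub>R g y)"
    if h: "continuous_on UNIV h" and g: "set_integrable lebesgue {0..<R} g" for h :: "real \<Rightarrow> real" and g :: "real \<Rightarrow> complex"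
  proof -
    obtain B where B: "\<forall>y\<in>{0..<R}. cmod (of_real (h y)) \<le> B" using bdd[OF h] by blast
    have "h \<in> borel_measurable borel" using h by (rule borel_measurable_continuous_onI)
    then have [measurable]: "h \<in> borel_measurable lebesgue" by (simp add: measurable_completion)
    have "(\<lambda>y. complex_of_real (h y)) \<in> borel_measurable lebesgue" by measurable
    then have "set_integrable lebesgue {0..<R} (\<lambda>y. of_real (h y) * g y)"
      by (rule set_integrable_bounded_mult[OF g]) (use B in auto)
    then show ?thesis by (simp add: scaleR_conv_of_real)
  qed
  have ai: "set_integrable lebesgue {0..<R} ?a" by (rule prod_int[OF \<phi>'(2) ode_bounded(1)[OF z k]]) (use R in simp)
  have bi: "set_integrable lebesgue {0..<R} ?b" by (rule prod_int[OF \<phi>_cont ode_bounded(2)[OF z k]]) (use R in simp)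
  have sum0: "(LINT y:{0..<R}|lebesgue. ?a y) + (LINT y:{0..<R}|lebesgue. ?b y) = 0"
  proof -
    have "(LINT y:{0..<R}|lebesgue. ?a y) + (LINT y:{0..<R}|lebesgue. ?b y) = (LINT y:{0..<R}|lebesgue. \<psi>' y * ?F y + \<psi> y * ?f y)"
      unfolding ab by (rule set_integral_add(2)[OF ai bi, symmetric])
    also have "\<dots> = 0" using parts(2) R(2)[of R] by (simp add: \<psi>_def)
    finally show ?thesis .
  qed
  \<comment> \<open>Both integrands vanish outside \<open>{0<..<R}\<close>.\<close>
  have ext: "(\<lambda>y. indicator {0..<R} y *\<^sub>R ?a y) = (\<lambda>y. indicator {0<..} y *\<^sub>R ?a y)"
    "(\<lambda>y. indicator {0..<R} y *\<^sub>R ?b y) = (\<lambda>y. indicator {0<..} y *\<^sub>R ?b y)"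
  proof -
    have "indicator {0..<R} y *\<^sub>R ?a y = indicator {0<..} y *\<^sub>R ?a y"
      "indicator {0..<R} y *\<^sub>R ?b y = indicator {0<..} y *\<^sub>R ?b y" for y
      using R(2)[of y] by (cases "y \<le> 0"; cases "R \<le> y"; simp)+
    then show "(\<lambda>y. indicator {0..<R} y *\<^sub>R ?a y) = (\<lambda>y. indicator {0<..} y *\<^sub>R ?a y)"
      "(\<lambda>y. indicator {0..<R} y *\<^sub>R ?b y) = (\<lambda>y. indicator {0<..} y *\<^sub>R ?b y)" by blast+
  qed
  show "set_integrable lebesgue {0<..} ?a" using ai by (simp only: set_integrable_def ext)
  show "set_integrable lebesgue {0<..} ?b" using bi by (simp only: set_integrable_def ext)
  show "(LINT x:{0<..}|lebesgue. ?a x) = - (LINT x:{0<..}|lebesgue. ?b x)"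
    using sum0 unfolding set_lebesgue_integral_def ext by (simp only: add_eq_0_iff2)
qed

lemma ode_locally_integrable:
  assumes z: "ode k z" and k: "k \<noteq> 0" and K: "compact K" "K \<subseteq> {0<..}"
  shows "set_integrable lebesgue K (z i)" and "set_integrable lebesgue K (zdot z k i)"
proof -
  obtain B where B: "\<forall>x\<in>K. norm x \<le> B" using compact_imp_bounded[OF K(1)] by (auto simp: bounded_iff)
  have sub: "K \<subseteq> {0..<\<bar>B\<bar> + 1}" using B K(2) by fastforce
  have Ks: "K \<in> sets lebesgue" using compact_imp_closed[OF K(1)] by (simp add: borel_imp_lebesgue_sets)
  show "set_integrable lebesgue K (z i)"
    by (rule set_integrable_subset[OF ode_bounded(1)[OF z k] Ks sub]) simp
  show "set_integrable lebesgue K (zdot z k i)"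
    by (rule set_integrable_subset[OF ode_bounded(2)[OF z k] Ks sub]) simp
qed

end

section \<open>Assembling the matrices\<close>

text \<open>
  A matrix is recovered from its first column: the second column at \<open>k\<close> is the first column at
  \<open>- k\<close> with its entries interchanged and one sign changed, which is the symmetry
  \<open>A(k) = \<sigma>\<^sub>2 A(- k) \<sigma>\<^sub>2\<close>.
\<close>
definition reflect_mat :: "(2 \<Rightarrow> complex \<Rightarrow> complex) \<Rightarrow> complex \<Rightarrow> cmat" where
  "reflect_mat v k = (\<chi> i l. if l = 1 then v i k else if i = 1 then - v 2 (- k) else v 1 (- k))"

text \<open>
  Entry \<open>(i, l)\<close> of this matrix is \<open>esgn l i\<close> times the component \<open>eidx l i\<close> of the first column at
  \<open>ksgn l * k\<close>.
\<close>
definition ksgn :: "2 \<Rightarrow> complex" where "ksgn l = (if l = 1 then 1 else - 1)"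
definition esgn :: "2 \<Rightarrow> 2 \<Rightarrow> complex" where "esgn l i = (if l = 2 \<and> i = 1 then - 1 else 1)"
definition eidx :: "2 \<Rightarrow> 2 \<Rightarrow> 2" where "eidx l i = (if l = 1 then i else if i = 1 then 2 else 1)"

text \<open>The first-column components encoded by column \<open>l\<close>; inverse to the encoding above.\<close>
definition comp :: "2 \<Rightarrow> complex ^ 2 \<Rightarrow> 2 \<Rightarrow> complex" where
  "comp l c i = (if l = 1 then c $ i else if i = 1 then c $ 2 else - c $ 1)"

lemma two_cases: "(i :: 2) = 1 \<or> i = 2" by (rule exhaust_2)

lemma reflect_mat_nth: "reflect_mat v k $ i $ l = esgn l i * v (eidx l i) (ksgn l * k)"
  using two_cases[of i] two_cases[of l] by (auto simp: reflect_mat_def esgn_def eidx_def ksgn_def)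

lemma comp_nth: "c $ i = esgn l i * comp l c (eidx l i)"
  using two_cases[of i] two_cases[of l] by (auto simp: comp_def esgn_def eidx_def)

lemma comp_eq_iff: "c = d \<longleftrightarrow> (\<forall>i. comp l c i = comp l d i)"
  using two_cases[of l] by (auto simp: comp_def vec_eq_iff forall_2)

lemma comp_reflect: "comp l (column l (reflect_mat v k)) i = v i (ksgn l * k)"
  using two_cases[of i] two_cases[of l] by (auto simp: comp_def reflect_mat_def column_def ksgn_def)

lemma comp_add: "comp l (c + d) i = comp l c i + comp l d i"
  by (simp add: comp_def)

lemma comp_uminus: "comp l (- c) i = - comp l c i"
  by (simp add: comp_def)

lemma comp_scaleR: "comp l (r *\<^sub>R c) i = r *\<^sub>R comp l c i"
  by (simp add: comp_def)

lemma comp_one: "comp l (column l (mat 1)) i = e1 i"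
  using two_cases[of i] two_cases[of l] by (auto simp: comp_def column_def mat_def e1_def)

lemma ksgn_simps: "ksgn l * ksgn l = 1" "cmod (ksgn l) = 1" "ksgn l \<noteq> 0"
  by (auto simp: ksgn_def)

lemma esgn_norm: "cmod (esgn l i) = 1" by (simp add: esgn_def)

lemma bounded_linear_comp: "bounded_linear (\<lambda>c. comp l c i)"
proof (cases "l = 1 \<or> i = 1")
  case True
  then have "(\<lambda>c. comp l c i) = (\<lambda>c. c $ (if l = 1 then i else 2))" by (auto simp: comp_def)
  then show ?thesis using bounded_linear_vec_nth by metis
next
  case False
  then have "(\<lambda>c. comp l c i) = (\<lambda>c. - (c $ 1))" by (auto simp: comp_def)
  then show ?thesis using bounded_linear_minus[OF bounded_linear_vec_nth] by metis
qed

lemma integrable_vec2_iff: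
  fixes f :: "'b \<Rightarrow> complex ^ 2"
  shows "integrable M f \<longleftrightarrow> (\<forall>i. integrable M (\<lambda>x. comp l (f x) i))"
proof
  assume "integrable M f"
  then show "\<forall>i. integrable M (\<lambda>x. comp l (f x) i)"
    using integrable_bounded_linear[OF bounded_linear_comp] by blast
next
  assume c: "\<forall>i. integrable M (\<lambda>x. comp l (f x) i)"
  have "integrable M (\<lambda>x. \<Sum>i\<in>UNIV. axis i (f x $ i))"
  proof (rule Bochner_Integration.integrable_sum)
    fix i :: 2
    have "integrable M (\<lambda>x. f x $ i)"
      unfolding comp_nth[of _ i l] using c by (intro integrable_mult_right) blast
    moreover have "bounded_linear (\<lambda>z :: complex. axis i z :: complex ^ 2)"
      by (intro linear_conv_bounded_linear[THEN iffD1] linearI) (auto simp: axis_def vec_eq_iff)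
    ultimately show "integrable M (\<lambda>x. axis i (f x $ i) :: complex ^ 2)"
      using integrable_bounded_linear by blast
  qed
  moreover have "(\<Sum>i\<in>UNIV. axis i (f x $ i)) = f x" for x
    by (simp add: vec_eq_iff sum_2 axis_def forall_2)
  ultimately show "integrable M f" by simp
qed

lemma set_integrable_vec2_iff:
  fixes f :: "real \<Rightarrow> complex ^ 2"
  shows "set_integrable M A f \<longleftrightarrow> (\<forall>i. set_integrable M A (\<lambda>x. comp l (f x) i))"
  unfolding set_integrable_def integrable_vec2_iff[where l = l] comp_scaleR ..

lemma set_integral_comp:
  fixes f :: "real \<Rightarrow> complex ^ 2"
  assumes "set_integrable M A f"
  shows "comp l (LINT x:A|M. f x) i = (LINT x:A|M. comp l (f x) i)"
  unfolding set_lebesgue_integral_def comp_scaleR[symmetric]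
  by (rule integral_bounded_linear[OF bounded_linear_comp, symmetric])
    (use assms in \<open>simp only: set_integrable_def\<close>)

lemma has_weak_derivative_comp:
  fixes f g :: "real \<Rightarrow> complex ^ 2"
  assumes loc: "\<And>i K. compact K \<Longrightarrow> K \<subseteq> S \<Longrightarrow> set_integrable lebesgue K (\<lambda>x. comp l (f x) i)"
    "\<And>i K. compact K \<Longrightarrow> K \<subseteq> S \<Longrightarrow> set_integrable lebesgue K (\<lambda>x. comp l (g x) i)"
    and int: "\<And>i \<phi>. test_function_on S \<phi> \<Longrightarrow> set_integrable lebesgue S (\<lambda>x. deriv \<phi> x *\<^sub>R comp l (f x) i)"
      "\<And>i \<phi>. test_function_on S \<phi> \<Longrightarrow> set_integrable lebesgue S (\<lambda>x. \<phi> x *\<^sub>R comp l (g x) i)"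
    and eq: "\<And>i \<phi>. test_function_on S \<phi> \<Longrightarrow>
      (LINT x:S|lebesgue. deriv \<phi> x *\<^sub>R comp l (f x) i) = - (LINT x:S|lebesgue. \<phi> x *\<^sub>R comp l (g x) i)"
  shows "has_weak_derivative_on f g S"
  unfolding has_weak_derivative_on_def locally_integrable_on_def
proof (intro conjI allI impI)
  show "set_integrable lebesgue K f" if "compact K \<and> K \<subseteq> S" for K
    unfolding set_integrable_vec2_iff[where l = l] using loc(1) that by blast
  show "set_integrable lebesgue K g" if "compact K \<and> K \<subseteq> S" for K
    unfolding set_integrable_vec2_iff[where l = l] using loc(2) that by blast
  fix \<phi> assume \<phi>: "test_function_on S \<phi>"
  have i: "set_integrable lebesgue S (\<lambda>x. deriv \<phi> x *\<^sub>R f x)" "set_integrable lebesgue S (\<lambda>x. \<phi> x *\<^sub>R g x)"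
    unfolding set_integrable_vec2_iff[where l = l] comp_scaleR using int[OF \<phi>] by blast+
  show "(LINT x:S|lebesgue. deriv \<phi> x *\<^sub>R f x) = - (LINT x:S|lebesgue. \<phi> x *\<^sub>R g x)"
    unfolding comp_eq_iff[where l = l] comp_uminus set_integral_comp[OF i(1)] set_integral_comp[OF i(2)] comp_scaleR
    using eq[OF \<phi>] by blast
qed

lemma sigma2_conj_reflect: "sigma2 ** A ** sigma2 = vector [vector [A $ 2 $ 2, - A $ 2 $ 1], vector [- A $ 1 $ 2, A $ 1 $ 1]]"
  by (simp add: sigma2_def vec_eq_iff forall_2 matrix_matrix_mult_def sum_2 algebra_simps)

lemma reflect_mat_symmetry: "reflect_mat v k = sigma2 ** reflect_mat v (- k) ** sigma2"
  by (simp add: sigma2_conj_reflect reflect_mat_def vec_eq_iff forall_2)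

lemma reflect_mat_cnj:
  assumes "\<And>i. v i (- cnj (ksgn l * k)) = cnj (v i (ksgn l * k))"
  shows "column l (reflect_mat v k) = column l (sigma2 ** cnj_mat (reflect_mat v (cnj k)) ** sigma2)"
  using two_cases[of l] assms
  by (auto simp: sigma2_conj_reflect reflect_mat_def cnj_mat_def column_def vec_eq_iff forall_2 ksgn_def)

lemma reflect_mat_det: "det (reflect_mat v k) = v 1 k * v 1 (- k) + v 2 k * v 2 (- k)"
  by (simp add: det_2 reflect_mat_def algebra_simps)

text \<open>Up to signs, the derivatives of the matrix are those of the first column, evaluated at \<open>\<plusminus> k\<close>.\<close>
lemma kderiv_reflect:
  assumes hol: "\<And>i. v i holomorphic_on A" and A: "open A" and k: "ksgn l * k \<in> A"
  shows "kderiv j (reflect_mat v) k $ i $ l = esgn l i * (ksgn l ^ j * (deriv ^^ j) (v (eidx l i)) (ksgn l * k))"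
proof -
  have nth: "(\<lambda>k. reflect_mat v k $ i $ l) = (\<lambda>k. esgn l i * v (eidx l i) (ksgn l * k))"
    by (simp add: reflect_mat_nth)
  define S where "S = (\<lambda>k. ksgn l * k) -` A"
  have S: "open S" unfolding S_def using A by (intro open_vimage continuous_intros)
  have "(\<lambda>k. v (eidx l i) (ksgn l * k)) holomorphic_on S"
    using holomorphic_on_compose_gen[OF _ hol[of "eidx l i"], of "\<lambda>k. ksgn l * k" S]
    by (auto simp: o_def S_def intro!: holomorphic_intros)
  then have "(deriv ^^ j) (\<lambda>k. esgn l i * v (eidx l i) (ksgn l * k)) k
      = esgn l i * (deriv ^^ j) (\<lambda>k. v (eidx l i) (ksgn l * k)) k"
    by (rule higher_deriv_cmult[OF _ _ S]) (use k in \<open>simp add: S_def\<close>)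
  also have "(deriv ^^ j) (\<lambda>k. v (eidx l i) (ksgn l * k)) k = ksgn l ^ j * (deriv ^^ j) (v (eidx l i)) (ksgn l * k)"
    by (rule higher_deriv_compose_linear[OF hol S A]) (use k in \<open>auto simp: S_def\<close>)
  finally show ?thesis by (simp add: kderiv_def nth)
qed

lemma norm_column_le:
  fixes A :: cmat
  assumes "\<And>i. cmod (A $ i $ l) \<le> B"
  shows "norm (column l A) \<le> 2 * B"
proof -
  have "norm (column l A) \<le> (\<Sum>i\<in>UNIV. cmod (column l A $ i))" 
    unfolding norm_vec_def by (rule L2_set_le_sum) simp
  also have "\<dots> \<le> 2 * B" using assms[of 1] assms[of 2] by (simp add: sum_2 column_def)
  finally show ?thesis .
qed

lemma reflect_cont:
  assumes "\<And>i. continuous_on A (v i)" "\<And>k. k \<in> S \<Longrightarrow> ksgn l * k \<in> A"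
  shows "continuous_on S (\<lambda>k. \<chi> i. esgn l i * (c * v (eidx l i) (ksgn l * k)))"
  by (intro continuous_on_vec_lambda continuous_on_mult continuous_on_const
      continuous_on_compose2[OF assms(1)]) (use assms(2) in \<open>auto intro!: continuous_intros\<close>)

lemma ksgn_lower:
  assumes "k \<in> cols (closure C_minus - {0}) (closure C_plus - {0}) l"
  shows "ksgn l * k \<noteq> 0" "Im (ksgn l * k) \<le> 0"
proof -
  have "closure C_minus \<subseteq> {k. Im k \<le> 0}" "closure C_plus \<subseteq> {k. 0 \<le> Im k}"
    by (intro closure_minimal closed_halfspace_Im_le closed_halfspace_Im_ge; auto simp: C_minus_def C_plus_def)+
  then show "ksgn l * k \<noteq> 0" "Im (ksgn l * k) \<le> 0"
    using assms by (auto simp: cols_def ksgn_def split: if_splits)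
qed

lemma ksgn_lower_open: "k \<in> cols C_minus C_plus l \<longleftrightarrow> Im (ksgn l * k) < 0"
  by (auto simp: cols_def ksgn_def C_minus_def C_plus_def)

lemma closure_D:
  "closure D4 \<subseteq> {k. Im k \<le> 0 \<and> 1 \<le> cmod k}" "closure D1 \<subseteq> {k. 0 \<le> Im k \<and> 1 \<le> cmod k}"
proof -
  have c: "closed {k. Im k \<le> 0 \<and> 1 \<le> cmod k}" "closed {k. 0 \<le> Im k \<and> 1 \<le> cmod k}"
    by (intro closed_Collect_conj closed_Collect_le continuous_intros)+
  show "closure D4 \<subseteq> {k. Im k \<le> 0 \<and> 1 \<le> cmod k}" "closure D1 \<subseteq> {k. 0 \<le> Im k \<and> 1 \<le> cmod k}"
    by (intro closure_minimal c; auto simp: D4_def D1_def)+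
qed

lemma ksgn_D4:
  assumes "k \<in> cols (closure D4) (closure D1) l"
  shows "1 \<le> cmod (ksgn l * k)" "Im (ksgn l * k) \<le> 0"
    "k \<in> cols (closure C_minus - {0}) (closure C_plus - {0}) l"
proof -
  have "closure D4 \<subseteq> closure C_minus" "closure D1 \<subseteq> closure C_plus"
    by (intro closure_mono; auto simp: D4_def D1_def C_minus_def C_plus_def)+
  then show "1 \<le> cmod (ksgn l * k)" "Im (ksgn l * k) \<le> 0"
    "k \<in> cols (closure C_minus - {0}) (closure C_plus - {0}) l"
    using assms closure_D by (auto simp: cols_def ksgn_def split: if_splits)
qed

lemma ksgn_D1:
  assumes "k \<in> cols (closure D1) (closure D4) l"
  shows "1 \<le> cmod (ksgn l * k)" "0 \<le> Im (ksgn l * k)"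
  using assms closure_D by (auto simp: cols_def ksgn_def split: if_splits)

text \<open>The limit that defines the extended derivative at a boundary point is not along a trivial filter.\<close>
lemma not_trivial_within_half:
  assumes "k \<in> cols (closure C_minus - {0}) (closure C_plus - {0}) l" "k \<notin> cols C_minus C_plus l"
  shows "at k within cols C_minus C_plus l \<noteq> bot"
  using assms by (auto simp: cols_def trivial_limit_within closure_def split: if_splits)

lemma open_lower: "open {k. Im k < 0}" by (rule open_halfspace_Im_lt)

lemma open_cols: "open (cols C_minus C_plus l)"
  by (auto simp: cols_def C_minus_def C_plus_def open_halfspace_Im_lt open_halfspace_Im_gt)

lemma reflect_holomorphic:
  assumes "\<And>i. v i holomorphic_on A" "\<And>k. k \<in> S \<Longrightarrow> ksgn l * k \<in> A"
  shows "(\<lambda>k. reflect_mat v k $ i $ l) holomorphic_on S"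
proof -
  have "(\<lambda>k. v (eidx l i) (ksgn l * k)) holomorphic_on S"
    using holomorphic_on_compose_gen[OF _ assms(1)[of "eidx l i"], of "\<lambda>k. ksgn l * k" S] assms(2)
    by (auto simp: o_def intro!: holomorphic_intros)
  then show ?thesis unfolding reflect_mat_nth by (intro holomorphic_intros)
qed

lemma esgn_ksgn_norm: "cmod (esgn l i * (ksgn l ^ j * c)) = cmod c"
  by (simp add: norm_mult norm_power esgn_norm ksgn_simps)

section \<open>The solutions for given initial data\<close>

text \<open>Initial data for which the \<open>n\<close>-th moment of the potential is finite.\<close>
locale initial_data =
  fixes n :: nat and N :: int and u0 u0x u1 :: "real \<Rightarrow> real"
  assumes meas: "u0 \<in> borel_measurable (lebesgue_on {0..})"
      "u0x \<in> borel_measurable (lebesgue_on {0..})"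
      "u1 \<in> borel_measurable (lebesgue_on {0..})"
    and L1: "(\<lambda>x. (1 + x) ^ n * (\<bar>u0 x - 2 * pi * of_int N\<bar> + \<bar>u0x x\<bar> + \<bar>u1 x\<bar>))
      absolutely_integrable_on {0..}"
begin

abbreviation "U \<equiv> Umat u0 u0x u1"

text \<open>
  The entries of the potential and its size, extended by zero to the negative half-line so that they
  are measurable on the whole line. Since sine and cosine minus one vanish at \<open>2 \<pi> N\<close>, they are bounded by
  the distance of \<open>u0\<close> to that value.
\<close>
definition P :: "2 \<Rightarrow> 2 \<Rightarrow> real \<Rightarrow> complex \<Rightarrow> complex" where
  "P i j y k = (if 0 \<le> y then U y k $ i $ j else 0)"

definition w0 :: "real \<Rightarrow> real" where
  "w0 y = (if 0 \<le> y then \<bar>u0 y - 2 * pi * of_int N\<bar> + \<bar>u0x y\<bar> + \<bar>u1 y\<bar> else 0)"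

lemma U_entries:
  "U y k $ 1 $ 1 = \<i> * of_real (cos (u0 y) - 1) / (4 * k)"
  "U y k $ 2 $ 2 = - (\<i> * of_real (cos (u0 y) - 1) / (4 * k))"
  "U y k $ 1 $ 2 = - (of_real (u0x y + u1 y) / 4) + \<i> * of_real (sin (u0 y)) / (4 * k)"
  "U y k $ 2 $ 1 = of_real (u0x y + u1 y) / 4 + \<i> * of_real (sin (u0 y)) / (4 * k)"
  by (cases "k = 0"; simp add: Umat_def smult_mat_def sigma1_def sigma2_def sigma3_def field_simps)+

lemma trig_bounds:
  "\<bar>sin (u0 y)\<bar> \<le> \<bar>u0 y - 2 * pi * of_int N\<bar>" "\<bar>cos (u0 y) - 1\<bar> \<le> \<bar>u0 y - 2 * pi * of_int N\<bar>"
proof -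
  define t where "t = u0 y - 2 * pi * of_int N"
  have u0: "u0 y = t + (2 * pi) * of_int N" by (simp add: t_def)
  have sc: "sin (u0 y) = sin t" "cos (u0 y) = cos t"
    unfolding u0 by (simp_all add: sin_add cos_add)
  show "\<bar>sin (u0 y)\<bar> \<le> \<bar>u0 y - 2 * pi * of_int N\<bar>"
    unfolding sc t_def[symmetric] by (rule abs_sin_x_le_abs_x)
  have "cos t - 1 = - 2 * sin (t / 2) * sin (t / 2)"
    using cos_double_sin[of "t / 2"] by (simp add: power2_eq_square)
  then have "\<bar>cos t - 1\<bar> = 2 * \<bar>sin (t / 2)\<bar> * \<bar>sin (t / 2)\<bar>" by (simp add: abs_mult)
  also have "\<dots> \<le> 2 * \<bar>t / 2\<bar> * 1"
    by (intro mult_mono abs_sin_x_le_abs_x) auto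
  finally show "\<bar>cos (u0 y) - 1\<bar> \<le> \<bar>u0 y - 2 * pi * of_int N\<bar>" unfolding sc t_def[symmetric] by simp
qed

lemma P_bound_aux:
  assumes "k \<noteq> 0" shows "cmod (P i j y k) \<le> (1 + 1 / cmod k) * w0 y"
proof (cases "0 \<le> y")
  case True
  define a where "a = \<bar>u0 y - 2 * pi * of_int N\<bar>"
  define b where "b = \<bar>u0x y\<bar> + \<bar>u1 y\<bar>"
  have a: "0 \<le> a" "\<bar>sin (u0 y)\<bar> \<le> a" "\<bar>cos (u0 y) - 1\<bar> \<le> a" and b: "0 \<le> b" "\<bar>u0x y + u1 y\<bar> \<le> b"
    using trig_bounds by (auto simp: a_def b_def)
  have k: "0 < cmod k" using assms by simp
  have small: "cmod (\<i> * of_real r / (4 * k)) \<le> a / cmod k" if "\<bar>r\<bar> \<le> a" for r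
  proof -
    have "cmod (\<i> * of_real r / (4 * k)) = \<bar>r\<bar> / 4 / cmod k" by (simp add: norm_divide norm_mult)
    also have "\<dots> \<le> a / cmod k" using that k by (intro divide_right_mono) auto
    finally show ?thesis .
  qed
  have p: "cmod (of_real (u0x y + u1 y) / 4) \<le> b"
  proof -
    have "cmod (of_real (u0x y + u1 y) / 4) = \<bar>u0x y + u1 y\<bar> / 4"
      by (simp only: norm_divide norm_of_real) simp
    also have "\<dots> \<le> \<bar>u0x y + u1 y\<bar>" by simp
    also have "\<dots> \<le> b" by (rule b(2))
    finally show ?thesis .
  qed
  have le: "a / cmod k + b \<le> (1 + 1 / cmod k) * (a + b)" "a / cmod k \<le> a / cmod k + b"
    using a(1) b(1) k by (auto simp: field_simps)
  have e: "cmod (U y k $ i $ j) \<le> a / cmod k + b" for i j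
  proof -
    have d: "cmod (U y k $ 1 $ 1) \<le> a / cmod k" "cmod (U y k $ 2 $ 2) \<le> a / cmod k"
      unfolding U_entries norm_minus_cancel by (rule small[OF a(3)])+
    have o: "cmod (U y k $ 1 $ 2) \<le> b + a / cmod k" "cmod (U y k $ 2 $ 1) \<le> b + a / cmod k"
      unfolding U_entries
      by (rule order_trans[OF norm_triangle_ineq add_mono[OF _ small[OF a(2)]]]; use p in \<open>simp only: norm_minus_cancel\<close>)+
    show ?thesis using d o le(2) two_cases[of i] two_cases[of j] by auto
  qed
  have "w0 y = a + b" using True by (simp add: w0_def a_def b_def)
  then show ?thesis using True order_trans[OF e le(1)] by (simp add: P_def)
qed (simp add: P_def w0_def)

lemma measurable_extend:
  fixes f :: "real \<Rightarrow> real"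
  assumes "f \<in> borel_measurable (lebesgue_on {0..})"
  shows "(\<lambda>y. if y \<in> {0..} then f y else (0::real)) \<in> borel_measurable lebesgue"
  using borel_measurable_if[of "{0::real..}" f] assms by (simp add: borel_imp_lebesgue_sets)

lemma P_measurable: "(\<lambda>y. P i j y k) \<in> borel_measurable lebesgue"
proof -
  have trig: "(cos :: real \<Rightarrow> real) \<in> borel_measurable borel" "(sin :: real \<Rightarrow> real) \<in> borel_measurable borel"
    by (intro borel_measurable_continuous_onI continuous_intros)+
  have t: "(\<lambda>y. if y \<in> {0..} then cos (u0 y) - 1 else 0) \<in> borel_measurable lebesgue"
    "(\<lambda>y. if y \<in> {0..} then sin (u0 y) else 0) \<in> borel_measurable lebesgue"
    "(\<lambda>y. if y \<in> {0..} then u0x y + u1 y else 0) \<in> borel_measurable lebesgue"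
    by (intro measurable_extend borel_measurable_diff borel_measurable_add borel_measurable_const meas
        measurable_compose[OF meas(1) trig(1)] measurable_compose[OF meas(1) trig(2)])+
  define c s p where "c = (\<lambda>y. if y \<in> {0..} then cos (u0 y) - 1 else 0)"
    and "s = (\<lambda>y. if y \<in> {0..} then sin (u0 y) else 0)" and "p = (\<lambda>y. if y \<in> {0..} then u0x y + u1 y else 0)"
  have [measurable]: "c \<in> borel_measurable lebesgue" "s \<in> borel_measurable lebesgue" "p \<in> borel_measurable lebesgue"
    using t by (simp_all add: c_def s_def p_def)
  have "P 1 1 y k = \<i> * of_real (c y) / (4 * k)" "P 2 2 y k = - (\<i> * of_real (c y) / (4 * k))"
    "P 1 2 y k = - (of_real (p y) / 4) + \<i> * of_real (s y) / (4 * k)"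
    "P 2 1 y k = of_real (p y) / 4 + \<i> * of_real (s y) / (4 * k)" for y
    by (simp_all add: P_def U_entries c_def s_def p_def)
  moreover have "(\<lambda>y. \<i> * of_real (c y) / (4 * k)) \<in> borel_measurable lebesgue"
    "(\<lambda>y. - (\<i> * of_real (c y) / (4 * k))) \<in> borel_measurable lebesgue"
    "(\<lambda>y. - (of_real (p y) / 4) + \<i> * of_real (s y) / (4 * k)) \<in> borel_measurable lebesgue"
    "(\<lambda>y. of_real (p y) / 4 + \<i> * of_real (s y) / (4 * k)) \<in> borel_measurable lebesgue"
    by measurable
  ultimately show ?thesis using two_cases[of i] two_cases[of j] by auto
qed

lemma P_holomorphic: "P i j y holomorphic_on - {0}"
proof (cases "0 \<le> y")
  case True
  have "P 1 1 y holomorphic_on - {0}" "P 2 2 y holomorphic_on - {0}"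
    "P 1 2 y holomorphic_on - {0}" "P 2 1 y holomorphic_on - {0}"
    unfolding P_def[abs_def] U_entries using True by (auto intro!: holomorphic_intros)
  then show ?thesis using two_cases[of i] two_cases[of j] by auto
qed (simp add: P_def[abs_def])

lemma P_conjugate: "P i j y (- cnj k) = cnj (P i j y k)"
proof -
  have "U y (- cnj k) $ 1 $ 1 = cnj (U y k $ 1 $ 1)" "U y (- cnj k) $ 2 $ 2 = cnj (U y k $ 2 $ 2)"
    "U y (- cnj k) $ 1 $ 2 = cnj (U y k $ 1 $ 2)" "U y (- cnj k) $ 2 $ 1 = cnj (U y k $ 2 $ 1)"
    unfolding U_entries by simp_all
  then show ?thesis using two_cases[of i] two_cases[of j] by (auto simp: P_def)
qed

lemma w0_measurable: "w0 \<in> borel_measurable lebesgue"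
proof -
  note [measurable] = meas
  have "(\<lambda>y. if y \<in> {0..} then \<bar>u0 y - 2 * pi * of_int N\<bar> + \<bar>u0x y\<bar> + \<bar>u1 y\<bar> else 0) \<in> borel_measurable lebesgue"
    by (rule measurable_extend) measurable
  then show ?thesis by (simp add: w0_def[abs_def])
qed

sublocale lax_potential P w0 n
proof
  show "set_integrable lebesgue {0..} (\<lambda>y. (1 + y) ^ n * w0 y)"
    using L1 by (subst set_integrable_cong[OF refl refl]) (auto simp: w0_def)
  show "cmod (P i j y k) \<le> (1 + 1 / cmod k) * w0 y" if "k \<noteq> 0" for i j y k by (rule P_bound_aux[OF that])
qed (simp_all only: P_measurable P_conjugate w0_measurable P_holomorphic, simp_all add: w0_def P_def U_entries)

lemma comp_ad_exp:
  assumes "0 \<le> y"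
  shows "comp l (column l (ad_exp (\<i> * theta1 k * of_real t) (U y k ** Z y))) i
    = osc i t (ksgn l * k) * rhs (\<lambda>j x. comp l (column l (Z x)) j) (ksgn l * k) i y"
  using two_cases[of i] two_cases[of l] assms
  by (auto simp: comp_def column_def ad_exp_eq osc_def rhs_def sum_2 ksgn_def matrix_matrix_mult_def
      P_def U_entries theta1_minus algebra_simps)

text \<open>A matrix integral equation for column \<open>l\<close>, over a set \<open>A\<close> and with sign \<open>s\<close>, in components.\<close>
lemma volterra_column_iff:
  fixes s :: real and k :: complex
  defines "z \<equiv> \<lambda>l Z i x. comp l (column l (Z x)) i"
    and "h \<equiv> \<lambda>Z x y. ad_exp (\<i> * theta1 k * of_real (y - x)) (U y k ** Z y)"
  assumes A: "A \<in> sets lebesgue" "A \<subseteq> {0..}"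
  shows "(set_integrable lebesgue A (\<lambda>y. column l (h Z x y)) \<and>
      column l (Z x) = column l (mat 1) + s *\<^sub>R (LINT y:A|lebesgue. column l (h Z x y))) \<longleftrightarrow>
    (\<forall>i. set_integrable lebesgue A (\<lambda>y. osc i (y - x) (ksgn l * k) * rhs (z l Z) (ksgn l * k) i y) \<and>
      z l Z i x = e1 i + s *\<^sub>R (LINT y:A|lebesgue. osc i (y - x) (ksgn l * k) * rhs (z l Z) (ksgn l * k) i y))"
proof -
  let ?h = "\<lambda>y. column l (h Z x y)"
  let ?r = "\<lambda>i y. osc i (y - x) (ksgn l * k) * rhs (z l Z) (ksgn l * k) i y"
  have h: "comp l (?h y) i = ?r i y" if "0 \<le> y" for y i
    unfolding h_def z_def by (rule comp_ad_exp[OF that])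
  have int: "set_integrable lebesgue A (\<lambda>y. comp l (?h y) i) \<longleftrightarrow> set_integrable lebesgue A (?r i)"
    "(LINT y:A|lebesgue. comp l (?h y) i) = (LINT y:A|lebesgue. ?r i y)" for i
    by (rule set_integrable_cong set_lebesgue_integral_cong; use A in \<open>auto intro!: h\<close>)+
  have zx: "comp l (column l (Z x)) i = z l Z i x" for i by (simp add: z_def)
  have all: "set_integrable lebesgue A ?h \<longleftrightarrow> (\<forall>i. set_integrable lebesgue A (?r i))"
    unfolding set_integrable_vec2_iff[where l = l] int(1) ..
  show ?thesis
  proof (cases "set_integrable lebesgue A ?h")
    case True
    show ?thesis
      unfolding comp_eq_iff[where l = l] comp_add comp_scaleR comp_one set_integral_comp[OF True] int(2) zx
      using True all by blast
  qed (use all in blast)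
qed

lemma volterra_X_iff:
  "volterra_X_col U k l Z \<longleftrightarrow> solX (ksgn l * k) (\<lambda>i x. comp l (column l (Z x)) i)"
proof -
  have ei: "einterval (ereal x) \<infinity> = {x<..}" for x by (auto simp: einterval_def)
  have "{x<..} \<in> sets lebesgue" "{x<..} \<subseteq> {0..}" if "0 \<le> x" for x :: real
    using that by (auto simp: borel_imp_lebesgue_sets)
  from volterra_column_iff[OF this, where s = "- 1" and k = k and l = l and Z = Z] show ?thesis
    unfolding volterra_X_col_def solX_def interval_lebesgue_integrable_def interval_lebesgue_integral_def
    by (simp add: ei)
qed

lemma volterra_Y_iff:
  "volterra_Y_col U k l Z \<longleftrightarrow> solY (ksgn l * k) (\<lambda>i x. comp l (column l (Z x)) i)"
proof -
  have ei: "einterval (ereal 0) (ereal x) = {0<..<x}" for x by (auto simp: einterval_def)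
  have "{0<..<x} \<in> sets lebesgue" "{0<..<x} \<subseteq> {0..}" for x :: real
    by (auto simp: borel_imp_lebesgue_sets)
  from volterra_column_iff[OF this, where s = 1 and k = k and l = l and Z = Z] show ?thesis
    unfolding volterra_Y_col_def solY_def interval_lebesgue_integrable_def interval_lebesgue_integral_def
    by (simp add: ei)
qed

lemma weak_ode:
  assumes ode: "ode (ksgn l * k) (\<lambda>i x. comp l (column l (Z x)) i)" and k: "ksgn l * k \<noteq> 0"
  shows "weak_ode_col U k l Z"
proof -
  define Zx where "Zx = (\<lambda>x. (\<chi> i j. (U x k ** Z x) $ i $ j
    - ((\<i> * theta1 k) \<cdot>\<^sub>m (sigma3 ** Z x - Z x ** sigma3)) $ i $ j) :: cmat)"
  let ?z = "\<lambda>i x. comp l (column l (Z x)) i"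
  have Zx: "comp l (column l (Zx x)) i = zdot ?z (ksgn l * k) i x" if "0 \<le> x" for i x
    using two_cases[of i] two_cases[of l] that
    by (auto simp: Zx_def comp_def column_def zdot_def rhs_def sum_2 ksgn_def matrix_matrix_mult_def
        P_def U_entries theta1_minus smult_mat_def sigma3_def algebra_simps)
  have "has_weak_derivative_on (\<lambda>x. column l (Z x)) (\<lambda>x. column l (Zx x)) {0<..}"
  proof (rule has_weak_derivative_comp[where l = l])
    fix i :: 2
    show "set_integrable lebesgue K (\<lambda>x. comp l (column l (Z x)) i)" if "compact K" "K \<subseteq> {0<..}" for K
      by (rule ode_locally_integrable(1)[OF ode k that])
    show "set_integrable lebesgue K (\<lambda>x. comp l (column l (Zx x)) i)" if "compact K" "K \<subseteq> {0<..}" for K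
      using ode_locally_integrable(2)[OF ode k that, of i] that(2)
      by (subst set_integrable_cong[OF refl refl Zx]) auto
    fix \<phi> :: "real \<Rightarrow> real" assume \<phi>: "test_function_on {0<..} \<phi>"
    note d = ode_weak_derivative[OF ode k \<phi>, of i]
    have Zx': "\<phi> x *\<^sub>R comp l (column l (Zx x)) i = \<phi> x *\<^sub>R zdot ?z (ksgn l * k) i x" if "x \<in> {0<..}" for x
      using that by (simp add: Zx)
    show "set_integrable lebesgue {0<..} (\<lambda>x. deriv \<phi> x *\<^sub>R comp l (column l (Z x)) i)" by (rule d(1))
    show "set_integrable lebesgue {0<..} (\<lambda>x. \<phi> x *\<^sub>R comp l (column l (Zx x)) i)"
      using d(2) by (subst set_integrable_cong[OF refl refl Zx']) auto
    have "(LINT x:{0<..}|lebesgue. \<phi> x *\<^sub>R comp l (column l (Zx x)) i)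
        = (LINT x:{0<..}|lebesgue. \<phi> x *\<^sub>R zdot ?z (ksgn l * k) i x)"
      by (rule set_lebesgue_integral_cong) (use Zx' in \<open>auto simp: borel_imp_lebesgue_sets\<close>)
    then show "(LINT x:{0<..}|lebesgue. deriv \<phi> x *\<^sub>R comp l (column l (Z x)) i)
        = - (LINT x:{0<..}|lebesgue. \<phi> x *\<^sub>R comp l (column l (Zx x)) i)"
      using d(3) by simp
  qed
  moreover have "AE x in lebesgue. x > 0 \<longrightarrow>
      column l (Zx x + (\<i> * theta1 k) \<cdot>\<^sub>m (sigma3 ** Z x - Z x ** sigma3)) = column l (U x k ** Z x)"
    by (intro AE_I2) (simp add: Zx_def column_def vec_eq_iff)
  ultimately show ?thesis unfolding weak_ode_col_def by blast
qed

text \<open>The two matrix solutions.\<close>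
definition X :: "real \<Rightarrow> complex \<Rightarrow> cmat" where "X x = reflect_mat (\<lambda>i. vX UNIV i x)"
definition Y :: "real \<Rightarrow> complex \<Rightarrow> cmat" where "Y x = reflect_mat (\<lambda>i. vY i x)"

lemma comp_X: "comp l (column l (X x k)) i = vX UNIV i x (ksgn l * k)"
  unfolding X_def by (rule comp_reflect)

lemma comp_Y: "comp l (column l (Y x k)) i = vY i x (ksgn l * k)"
  unfolding Y_def by (rule comp_reflect)

lemma X_minus_one: "(\<lambda>k. X x k - mat 1) = reflect_mat (\<lambda>i k. vX UNIV i x k - e1 i)"
  by (simp add: X_def reflect_mat_def vec_eq_iff forall_2 mat_def e1_def fun_eq_iff)

lemma Y_minus_one: "(\<lambda>k. Y x k - mat 1) = reflect_mat (\<lambda>i k. vY i x k - e1 i)"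
  by (simp add: Y_def reflect_mat_def vec_eq_iff forall_2 mat_def e1_def fun_eq_iff)

lemma Y_minus_one_osc: "(\<lambda>k. (Y x k - mat 1) ** mexp ((- 2 * \<i> * theta1 k * of_real x) \<cdot>\<^sub>m sigma3))
    = reflect_mat (\<lambda>i k. (vY i x k - e1 i) * osc 2 x k)"
  by (simp add: mexp_sigma3 Y_def reflect_mat_def vec_eq_iff forall_2 mat_def e1_def fun_eq_iff
      matrix_matrix_mult_def sum_2 osc_def theta1_minus mult_ac)

lemma vX_continuous: "0 \<le> x \<Longrightarrow> continuous_on {k. k \<noteq> 0 \<and> Im k \<le> 0} (vX UNIV i x)"
proof -
  assume x: "0 \<le> x"
  have "continuous_on {k. k \<noteq> 0 \<and> Im k \<le> 0} (\<lambda>k. GX 0 i x k + e1 i)"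
    by (intro continuous_intros GX_continuous x) simp
  then show ?thesis by (rule continuous_on_cong[THEN iffD1, OF refl, rotated]) (use GX_0[OF x] in auto)
qed

lemma vX_holomorphic_lower: "0 \<le> x \<Longrightarrow> vX UNIV i x holomorphic_on {k. Im k < 0}"
proof -
  assume x: "0 \<le> x"
  have "(\<lambda>k. (vX UNIV i x k - e1 i) + e1 i) holomorphic_on {k. Im k < 0}"
    by (intro holomorphic_on_add GX_deriv(2)[OF x, of 0 "- \<i>"]) auto
  then show ?thesis by simp
qed

lemma X_kderiv_interior:
  assumes x: "0 \<le> x" and j: "j \<le> n" and k: "k \<in> cols C_minus C_plus l"
  shows "kderiv j (\<lambda>k. X x k - mat 1) k $ i $ l = esgn l i * (ksgn l ^ j * GX j (eidx l i) x (ksgn l * k))"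
proof -
  have k': "Im (ksgn l * k) < 0" using k by (simp only: ksgn_lower_open)
  have "kderiv j (\<lambda>k. X x k - mat 1) k $ i $ l
      = esgn l i * (ksgn l ^ j * (deriv ^^ j) (\<lambda>k. vX UNIV (eidx l i) x k - e1 (eidx l i)) (ksgn l * k))"
    unfolding X_minus_one
    by (rule kderiv_reflect[OF GX_deriv(2)[OF x j k'] open_lower]) (use k' in simp)
  then show ?thesis using GX_deriv(1)[OF x j k'] by simp
qed

lemma X_kderiv_ext:
  assumes x: "0 \<le> x" and j: "j \<le> n" and k: "k \<in> cols (closure C_minus - {0}) (closure C_plus - {0}) l"
  shows "kderiv_ext (cols C_minus C_plus) j (\<lambda>k. X x k - mat 1) k $ i $ l
    = esgn l i * (ksgn l ^ j * GX j (eidx l i) x (ksgn l * k))"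
proof (cases "k \<in> cols C_minus C_plus l")
  case True
  then show ?thesis using X_kderiv_interior[OF x j True] by (simp add: kderiv_ext_def)
next
  case False
  let ?S = "cols C_minus C_plus l" and ?A = "cols (closure C_minus - {0}) (closure C_plus - {0}) l"
  let ?g = "\<lambda>k. esgn l i * (ksgn l ^ j * GX j (eidx l i) x (ksgn l * k))"
  have sub: "?S \<subseteq> ?A" using closure_subset[of C_minus] closure_subset[of C_plus]
    by (auto simp: cols_def C_minus_def C_plus_def)
  have "continuous_on ?A ?g"
    by (intro continuous_on_mult continuous_on_const continuous_on_compose2[OF GX_continuous[OF x j]])
      (use ksgn_lower in \<open>auto intro!: continuous_intros\<close>)
  then have "(?g \<longlongrightarrow> ?g k) (at k within ?A)" using k by (simp add: continuous_on_def)
  then have "(?g \<longlongrightarrow> ?g k) (at k within ?S)" by (rule tendsto_within_subset[OF _ sub])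
  moreover have "\<forall>\<^sub>F k' in at k within ?S. ?g k' = kderiv j (\<lambda>k. X x k - mat 1) k' $ i $ l"
    using X_kderiv_interior[OF x j] by (auto simp: eventually_at_filter)
  ultimately have "((\<lambda>k'. kderiv j (\<lambda>k. X x k - mat 1) k' $ i $ l) \<longlongrightarrow> ?g k) (at k within ?S)"
    by (rule Lim_transform_eventually)
  then have "Lim (at k within ?S) (\<lambda>k'. kderiv j (\<lambda>k. X x k - mat 1) k' $ i $ l) = ?g k"
    by (rule tendsto_Lim[OF not_trivial_within_half[OF k False]])
  then show ?thesis using False by (simp add: kderiv_ext_def)
qed

text \<open>A common constant for the three estimates of the \<open>j\<close>-th derivatives.\<close>
definition Cj :: "nat \<Rightarrow> real" where
  "Cj j = 2 * (fact j * 8 ^ j * (\<bar>Cdiff (1 / 2) * tail n 0\<bar> + \<bar>Vbound (1 / 2)\<bar> + 1 + \<bar>Wbound\<bar>))"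

lemma X_estimate:
  assumes x: "0 \<le> x" and j: "j \<le> n" and k: "k \<in> cols (closure D4) (closure D1) l"
  shows "norm (column l (kderiv_ext (cols C_minus C_plus) j (\<lambda>k. X x k - mat 1) k)) \<le> Cj j / (1 + x) ^ (n - j)"
proof -
  define q where "q = 1 / (1 + x) ^ (n - j)"
  have q: "0 \<le> q" using x by (simp add: q_def)
  have "norm (column l (kderiv_ext (cols C_minus C_plus) j (\<lambda>k. X x k - mat 1) k))
      \<le> 2 * (fact j * Cdiff (1 / 2) * 8 ^ j * tail n 0 / (1 + x) ^ (n - j))"
  proof (rule norm_column_le)
    show "cmod (kderiv_ext (cols C_minus C_plus) j (\<lambda>k. X x k - mat 1) k $ i $ l)
        \<le> fact j * Cdiff (1 / 2) * 8 ^ j * tail n 0 / (1 + x) ^ (n - j)" for i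
      unfolding X_kderiv_ext[OF x j ksgn_D4(3)[OF k]] esgn_ksgn_norm
      by (rule GX_bound[OF x j ksgn_D4(1,2)[OF k]])
  qed
  also have "\<dots> = (2 * (fact j * 8 ^ j * (Cdiff (1 / 2) * tail n 0))) * q" by (simp add: q_def)
  also have "\<dots> \<le> Cj j * q"
    unfolding Cj_def using q by (intro mult_right_mono mult_left_mono) auto
  finally show ?thesis by (simp add: q_def)
qed

lemma Y_estimate:
  assumes x: "0 \<le> x" and k: "k \<in> cols (closure D1) (closure D4) l"
  shows "norm (column l (kderiv j (\<lambda>k. Y x k - mat 1) k)) \<le> Cj j * (1 + x) ^ j"
proof -
  have k0: "ksgn l * k \<in> - {0}" using ksgn_D1(1)[OF k] by auto
  have "norm (column l (kderiv j (\<lambda>k. Y x k - mat 1) k)) \<le> 2 * (fact j * (Vbound (1 / 2) + 1) * 2 ^ j * (1 + x) ^ j)"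
  proof (rule norm_column_le)
    fix i
    have "kderiv j (\<lambda>k. Y x k - mat 1) k $ i $ l
        = esgn l i * (ksgn l ^ j * (deriv ^^ j) (\<lambda>k. vY (eidx l i) x k - e1 (eidx l i)) (ksgn l * k))"
      unfolding Y_minus_one
      by (rule kderiv_reflect[OF _ _ k0]) (auto intro!: holomorphic_intros vY_holomorphic x)
    then show "cmod (kderiv j (\<lambda>k. Y x k - mat 1) k $ i $ l) \<le> fact j * (Vbound (1 / 2) + 1) * 2 ^ j * (1 + x) ^ j"
      unfolding esgn_ksgn_norm using vY_deriv_bound[OF x ksgn_D1[OF k]] by (simp only: esgn_ksgn_norm)
  qed
  also have "\<dots> = 2 * (fact j * 2 ^ j * (Vbound (1 / 2) + 1)) * (1 + x) ^ j" by simp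
  also have "\<dots> \<le> Cj j * (1 + x) ^ j"
    unfolding Cj_def using x by (intro mult_right_mono mult_left_mono mult_mono power_mono) (auto simp: Vbound_def)
  finally show ?thesis .
qed

lemma W_estimate:
  assumes x: "0 \<le> x" and k: "k \<in> cols (closure D4) (closure D1) l"
  shows "norm (column l (kderiv j (\<lambda>k. (Y x k - mat 1) ** mexp ((- 2 * \<i> * theta1 k * of_real x) \<cdot>\<^sub>m sigma3)) k))
    \<le> Cj j * (1 + x) ^ j"
  unfolding Y_minus_one_osc
proof -
  let ?v = "\<lambda>i k. (vY i x k - e1 i) * osc 2 x k"
  have k0: "ksgn l * k \<in> - {0}" using ksgn_D4(1)[OF k] by auto
  have W0: "0 \<le> Wbound" using Ccoef_pos[of "1/2" 1] W0_nonneg by (simp add: Wbound_def)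
  have "norm (column l (kderiv j (reflect_mat ?v) k)) \<le> 2 * (fact j * Wbound * 2 ^ j * (1 + x) ^ j)"
  proof (rule norm_column_le)
    fix i
    have "kderiv j (reflect_mat ?v) k $ i $ l = esgn l i * (ksgn l ^ j * (deriv ^^ j) (?v (eidx l i)) (ksgn l * k))"
      by (rule kderiv_reflect[OF _ _ k0]) (auto intro!: holomorphic_intros vY_holomorphic osc_holomorphic x)
    then show "cmod (kderiv j (reflect_mat ?v) k $ i $ l) \<le> fact j * Wbound * 2 ^ j * (1 + x) ^ j"
      using vW_deriv_bound[OF x ksgn_D4(1,2)[OF k]] by (simp only: esgn_ksgn_norm)
  qed
  also have "\<dots> = 2 * (fact j * 2 ^ j * Wbound) * (1 + x) ^ j" by simp
  also have "\<dots> \<le> Cj j * (1 + x) ^ j"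
    unfolding Cj_def using x W0 by (intro mult_right_mono mult_left_mono mult_mono power_mono) auto
  finally show "norm (column l (kderiv j (reflect_mat ?v) k)) \<le> Cj j * (1 + x) ^ j" .
qed

lemma X_deriv_extension:
  assumes x: "0 \<le> x" and j: "j \<in> {1..n}"
  shows "\<exists>G. continuous_on (cols (closure C_minus - {0}) (closure C_plus - {0}) l) G \<and>
    (\<forall>k\<in>cols C_minus C_plus l. G k = column l (kderiv j (X x) k))"
proof (intro exI conjI ballI)
  let ?G = "\<lambda>k. \<chi> i. esgn l i * (ksgn l ^ j * GX j (eidx l i) x (ksgn l * k))"
  have jn: "j \<le> n" "j \<noteq> 0" using j by auto
  show "continuous_on (cols (closure C_minus - {0}) (closure C_plus - {0}) l) ?G"
    by (rule reflect_cont[OF GX_continuous[OF x jn(1)]]) (use ksgn_lower in auto)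
  fix k assume k: "k \<in> cols C_minus C_plus l"
  then have k': "Im (ksgn l * k) < 0" by (simp only: ksgn_lower_open)
  have "kderiv j (X x) k $ i $ l = esgn l i * (ksgn l ^ j * GX j (eidx l i) x (ksgn l * k))" for i
  proof -
    have "(deriv ^^ j) (\<lambda>k. vX UNIV (eidx l i) x k - e1 (eidx l i)) (ksgn l * k) = (deriv ^^ j) (vX UNIV (eidx l i) x) (ksgn l * k)"
      using jn(2) by (subst higher_deriv_diff[OF vX_holomorphic_lower[OF x] _ open_lower]) (use k' in auto)
    moreover have "kderiv j (X x) k $ i $ l = esgn l i * (ksgn l ^ j * (deriv ^^ j) (vX UNIV (eidx l i) x) (ksgn l * k))"
      unfolding X_def by (rule kderiv_reflect[OF vX_holomorphic_lower[OF x] open_lower]) (use k' in simp)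
    ultimately show ?thesis using GX_deriv(1)[OF x jn(1) k'] by simp
  qed
  then show "?G k = column l (kderiv j (X x) k)" by (simp add: vec_eq_iff column_def)
qed

end

theorem theorem3p1:
  fixes n :: nat and N :: int and u0 u0x u1 :: "real \<Rightarrow> real"
  assumes n: "n \<ge> 1"
    and meas: "u0 \<in> borel_measurable (lebesgue_on {0..})"
      "u0x \<in> borel_measurable (lebesgue_on {0..})"
      "u1 \<in> borel_measurable (lebesgue_on {0..})"
    and weak: "has_weak_derivative_on u0 u0x {0<..}"
    and L1: "(\<lambda>x. (1 + x) ^ n * (\<bar>u0 x - 2 * pi * of_int N\<bar> + \<bar>u0x x\<bar> + \<bar>u1 x\<bar>))
      absolutely_integrable_on {0..}"
  defines "U \<equiv> Umat u0 u0x u1"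
    and "domX \<equiv> cols (closure C_minus - {0}) (closure C_plus - {0})"
    and "intX \<equiv> cols C_minus C_plus"
  shows "\<exists>X Y :: real \<Rightarrow> complex \<Rightarrow> cmat.
    \<comment> \<open>unique solutions of the Volterra equations\<close>
    (\<forall>l. \<forall>k\<in>domX l. volterra_X_col U k l (\<lambda>x. X x k) \<and>
       (\<forall>Z. volterra_X_col U k l Z \<longrightarrow> (\<forall>x\<ge>0. column l (Z x) = column l (X x k)))) \<and>
    (\<forall>l. \<forall>k\<in>-{0}. volterra_Y_col U k l (\<lambda>x. Y x k) \<and>
       (\<forall>Z. volterra_Y_col U k l Z \<longrightarrow> (\<forall>x\<ge>0. column l (Z x) = column l (Y x k)))) \<and>
    \<comment> \<open>(a)\<close>
    (\<forall>l. \<forall>k\<in>domX l. weak_ode_col U k l (\<lambda>x. X x k)) \<and>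
    \<comment> \<open>(b)\<close>
    (\<forall>l. \<forall>k\<in>-{0}. weak_ode_col U k l (\<lambda>x. Y x k)) \<and>
    \<comment> \<open>(c)\<close>
    (\<forall>x\<ge>0. \<forall>l. continuous_on (domX l) (\<lambda>k. column l (X x k)) \<and>
       (\<forall>i. (\<lambda>k. X x k $ i $ l) analytic_on intX l)) \<and>
    \<comment> \<open>(d)\<close>
    (\<forall>x\<ge>0. \<forall>i l. (\<lambda>k. Y x k $ i $ l) analytic_on - {0}) \<and>
    \<comment> \<open>(e)\<close>
    (\<forall>x\<ge>0. \<forall>j\<in>{1..n}. \<forall>l. \<exists>G. continuous_on (domX l) G \<and>
       (\<forall>k\<in>intX l. G k = column l (kderiv j (X x) k))) \<and>
    \<comment> \<open>(f)\<close>
    (\<exists>C>0. \<forall>x\<ge>0. \<forall>j\<le>n. \<forall>l.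
       (\<forall>k\<in>cols (closure D4) (closure D1) l.
          norm (column l (kderiv_ext intX j (\<lambda>k. X x k - mat 1) k)) \<le> C / (1 + x) ^ (n - j)) \<and>
       (\<forall>k\<in>cols (closure D1) (closure D4) l.
          norm (column l (kderiv j (\<lambda>k. Y x k - mat 1) k)) \<le> C * (1 + x) ^ j) \<and>
       (\<forall>k\<in>cols (closure D4) (closure D1) l.
          norm (column l (kderiv j (\<lambda>k. (Y x k - mat 1) **
            mexp ((- 2 * \<i> * theta1 k * of_real x) \<cdot>\<^sub>m sigma3)) k)) \<le> C * (1 + x) ^ j)) \<and>
    \<comment> \<open>(g)\<close>
    (\<forall>x\<ge>0. (\<forall>k\<in>\<real> - {0}. det (X x k) = 1) \<and> (\<forall>k\<in>-{0}. det (Y x k) = 1)) \<and>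
    \<comment> \<open>(h)\<close>
    (\<forall>x\<ge>0. \<forall>l. \<forall>k\<in>domX l.
       column l (X x k) = column l (sigma2 ** X x (- k) ** sigma2) \<and>
       column l (X x k) = column l (sigma2 ** cnj_mat (X x (cnj k)) ** sigma2)) \<and>
    (\<forall>x\<ge>0. \<forall>k\<in>-{0}.
       Y x k = sigma2 ** Y x (- k) ** sigma2 \<and>
       Y x k = sigma2 ** cnj_mat (Y x (cnj k)) ** sigma2)"
proof -
  interpret D: initial_data n N u0 u0x u1
    by (rule initial_data.intro[OF meas L1])
  have dom: "ksgn l * k \<noteq> 0" "Im (ksgn l * k) \<le> 0" if "k \<in> domX l" for l k
    using ksgn_lower that by (auto simp: domX_def)
  have nz: "ksgn l * k \<noteq> 0" if "k \<in> - {0}" for l k using that by (simp add: ksgn_simps)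
  have X: "D.solX (ksgn l * k) (\<lambda>i x. comp l (column l (D.X x k)) i)" if "k \<in> domX l" for l k
    unfolding D.comp_X by (rule D.vX_solX[OF dom[OF that]])
  have Y: "D.solY (ksgn l * k) (\<lambda>i x. comp l (column l (D.Y x k)) i)" if "k \<in> - {0}" for l k
    unfolding D.comp_Y by (rule D.vY_solY[OF nz[OF that]])
  show ?thesis
  proof (rule exI[of _ D.X], rule exI[of _ D.Y], intro conjI)
    show "\<forall>l. \<forall>k\<in>domX l. volterra_X_col U k l (\<lambda>x. D.X x k) \<and>
       (\<forall>Z. volterra_X_col U k l Z \<longrightarrow> (\<forall>x\<ge>0. column l (Z x) = column l (D.X x k)))"
      unfolding U_def D.volterra_X_iff
    proof (intro allI ballI conjI impI)
      fix l k assume k: "k \<in> domX l"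
      show "D.solX (ksgn l * k) (\<lambda>i x. comp l (column l (D.X x k)) i)" by (rule X[OF k])
      fix Z and x :: real assume Z: "D.solX (ksgn l * k) (\<lambda>i x. comp l (column l (Z x)) i)" and x: "0 \<le> x"
      show "column l (Z x) = column l (D.X x k)"
        unfolding comp_eq_iff[where l = l] D.comp_X using D.solX_unique[OF dom[OF k] Z x] by blast
    qed
    show "\<forall>l. \<forall>k\<in>-{0}. volterra_Y_col U k l (\<lambda>x. D.Y x k) \<and>
       (\<forall>Z. volterra_Y_col U k l Z \<longrightarrow> (\<forall>x\<ge>0. column l (Z x) = column l (D.Y x k)))"
      unfolding U_def D.volterra_Y_iff
    proof (intro allI ballI conjI impI)
      fix l and k :: complex assume k: "k \<in> - {0}"
      show "D.solY (ksgn l * k) (\<lambda>i x. comp l (column l (D.Y x k)) i)" by (rule Y[OF k])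
      fix Z and x :: real assume Z: "D.solY (ksgn l * k) (\<lambda>i x. comp l (column l (Z x)) i)" and x: "0 \<le> x"
      show "column l (Z x) = column l (D.Y x k)"
        unfolding comp_eq_iff[where l = l] D.comp_Y using D.solY_unique[OF nz[OF k] Z x] by blast
    qed
    show "\<forall>l. \<forall>k\<in>domX l. weak_ode_col U k l (\<lambda>x. D.X x k)"
      unfolding U_def by (intro allI ballI D.weak_ode D.solX_ode X dom)
    show "\<forall>l. \<forall>k\<in>-{0}. weak_ode_col U k l (\<lambda>x. D.Y x k)"
      unfolding U_def by (intro allI ballI D.weak_ode D.solY_ode Y nz)
    show "\<forall>x\<ge>0. \<forall>l. continuous_on (domX l) (\<lambda>k. column l (D.X x k)) \<and>
       (\<forall>i. (\<lambda>k. D.X x k $ i $ l) analytic_on intX l)"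
    proof (intro allI impI conjI)
      fix x :: real and l assume x: "0 \<le> x"
      have "continuous_on (domX l) (\<lambda>k. \<chi> i. esgn l i * (1 * D.vX UNIV (eidx l i) x (ksgn l * k)))"
        by (rule reflect_cont[OF D.vX_continuous[OF x]]) (use dom in auto)
      then show "continuous_on (domX l) (\<lambda>k. column l (D.X x k))"
        by (simp add: D.X_def reflect_mat_nth column_def)
      show "(\<lambda>k. D.X x k $ i $ l) analytic_on intX l" for i
        unfolding intX_def analytic_on_open[OF open_cols] D.X_def
        by (rule reflect_holomorphic[OF D.vX_holomorphic_lower[OF x]]) (simp add: ksgn_lower_open)
    qed
    show "\<forall>x\<ge>0. \<forall>i l. (\<lambda>k. D.Y x k $ i $ l) analytic_on - {0}"
    proof (intro allI impI)
      fix x :: real and i l assume x: "0 \<le> x"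
      have o: "open (- {0::complex})" by auto
      show "(\<lambda>k. D.Y x k $ i $ l) analytic_on - {0}"
        unfolding analytic_on_open[OF o] D.Y_def
        by (rule reflect_holomorphic[OF D.vY_holomorphic[OF x]]) (simp add: ksgn_simps)
    qed
    show "\<forall>x\<ge>0. \<forall>j\<in>{1..n}. \<forall>l. \<exists>G. continuous_on (domX l) G \<and>
       (\<forall>k\<in>intX l. G k = column l (kderiv j (D.X x) k))"
      unfolding domX_def intX_def by (intro allI impI ballI D.X_deriv_extension)
    show "\<exists>C>0. \<forall>x\<ge>0. \<forall>j\<le>n. \<forall>l.
       (\<forall>k\<in>cols (closure D4) (closure D1) l.
          norm (column l (kderiv_ext intX j (\<lambda>k. D.X x k - mat 1) k)) \<le> C / (1 + x) ^ (n - j)) \<and>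
       (\<forall>k\<in>cols (closure D1) (closure D4) l.
          norm (column l (kderiv j (\<lambda>k. D.Y x k - mat 1) k)) \<le> C * (1 + x) ^ j) \<and>
       (\<forall>k\<in>cols (closure D4) (closure D1) l.
          norm (column l (kderiv j (\<lambda>k. (D.Y x k - mat 1) **
            mexp ((- 2 * \<i> * theta1 k * of_real x) \<cdot>\<^sub>m sigma3)) k)) \<le> C * (1 + x) ^ j)"
    proof (intro exI[of _ "\<Sum>j\<le>n. D.Cj j"] conjI allI impI ballI)
      have pos: "0 < D.Cj j" for j
        unfolding D.Cj_def by (intro mult_pos_pos add_pos_nonneg add_nonneg_pos) auto
      show "0 < (\<Sum>j\<le>n. D.Cj j)" using pos by (intro sum_pos) auto
      fix x :: real and j l assume x: "0 \<le> x" and j: "j \<le> n"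
      have C: "D.Cj j \<le> (\<Sum>j\<le>n. D.Cj j)" using j pos by (intro member_le_sum) (auto intro: less_imp_le)
      have div: "D.Cj j / (1 + x) ^ (n - j) \<le> (\<Sum>j\<le>n. D.Cj j) / (1 + x) ^ (n - j)"
        using C x by (intro divide_right_mono) auto
      have mul: "D.Cj j * (1 + x) ^ j \<le> (\<Sum>j\<le>n. D.Cj j) * (1 + x) ^ j"
        using C x by (intro mult_right_mono) auto
      show "norm (column l (kderiv_ext intX j (\<lambda>k. D.X x k - mat 1) k)) \<le> (\<Sum>j\<le>n. D.Cj j) / (1 + x) ^ (n - j)"
        if "k \<in> cols (closure D4) (closure D1) l" for k
        unfolding intX_def by (rule order_trans[OF D.X_estimate[OF x j that] div])
      show "norm (column l (kderiv j (\<lambda>k. D.Y x k - mat 1) k)) \<le> (\<Sum>j\<le>n. D.Cj j) * (1 + x) ^ j"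
        if "k \<in> cols (closure D1) (closure D4) l" for k
        by (rule order_trans[OF D.Y_estimate[OF x that] mul])
      show "norm (column l (kderiv j (\<lambda>k. (D.Y x k - mat 1) **
            mexp ((- 2 * \<i> * theta1 k * of_real x) \<cdot>\<^sub>m sigma3)) k)) \<le> (\<Sum>j\<le>n. D.Cj j) * (1 + x) ^ j"
        if "k \<in> cols (closure D4) (closure D1) l" for k
        by (rule order_trans[OF D.W_estimate[OF x that] mul])
    qed
    show "\<forall>x\<ge>0. (\<forall>k\<in>\<real> - {0}. det (D.X x k) = 1) \<and> (\<forall>k\<in>-{0}. det (D.Y x k) = 1)"
    proof (intro allI impI conjI ballI)
      fix x :: real assume x: "0 \<le> x"
      show "det (D.X x k) = 1" if k: "k \<in> \<real> - {0}" for k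
      proof -
        have "k \<noteq> 0" "Im k = 0" using k by (auto simp: complex_is_Real_iff)
        then show ?thesis
          unfolding D.X_def reflect_mat_det
          using D.wronskian_X[OF D.vX_solX[of k] D.vX_solX[of "- k"] x] by simp
      qed
      show "det (D.Y x k) = 1" if k: "k \<in> - {0}" for k
        unfolding D.Y_def reflect_mat_det
        using D.wronskian_Y[OF D.vY_solY[of k] D.vY_solY[of "- k"] x] k by simp
    qed
    show "\<forall>x\<ge>0. \<forall>l. \<forall>k\<in>domX l.
       column l (D.X x k) = column l (sigma2 ** D.X x (- k) ** sigma2) \<and>
       column l (D.X x k) = column l (sigma2 ** cnj_mat (D.X x (cnj k)) ** sigma2)"
    proof (intro allI impI ballI conjI)
      fix x :: real and l k assume x: "0 \<le> x" and k: "k \<in> domX l"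
      show "column l (D.X x k) = column l (sigma2 ** D.X x (- k) ** sigma2)"
        unfolding D.X_def using reflect_mat_symmetry by metis
      show "column l (D.X x k) = column l (sigma2 ** cnj_mat (D.X x (cnj k)) ** sigma2)"
        unfolding D.X_def by (rule reflect_mat_cnj) (rule D.vX_cnj[OF x dom[OF k]])
    qed
    show "\<forall>x\<ge>0. \<forall>k\<in>-{0}.
       D.Y x k = sigma2 ** D.Y x (- k) ** sigma2 \<and>
       D.Y x k = sigma2 ** cnj_mat (D.Y x (cnj k)) ** sigma2"
    proof (intro allI impI ballI conjI)
      fix x :: real and k :: complex assume x: "0 \<le> x" and k: "k \<in> - {0}"
      show "D.Y x k = sigma2 ** D.Y x (- k) ** sigma2"
        unfolding D.Y_def by (rule reflect_mat_symmetry)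
      have "column l (D.Y x k) = column l (sigma2 ** cnj_mat (D.Y x (cnj k)) ** sigma2)" for l
        unfolding D.Y_def by (rule reflect_mat_cnj) (rule D.vY_cnj[OF x nz[OF k]])
      then show "D.Y x k = sigma2 ** cnj_mat (D.Y x (cnj k)) ** sigma2"
        by (simp add: vec_eq_iff column_def)
    qed
  qed
qed

end
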